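(* Let $\mathcal{E}$ be a suitable category with a suitable functorial cylinder $I$ and a suitable weak factorization system $(\mathbf{C}, \mathbf{TF})$, and let $(\mathbf{TC}, \mathbf{F})$ be the induced weak factorization system of trivial cofibrations and fibrations. Assume that fibrations satisfy (A.1) and (A.2) (stated in the context). Let $m \colon A \to B$ be a cofibration, let $Y_1 \to B$ be a fibration, let $X_1 \to A$ be its pullback along $m$ (with projection $X_1 \to Y_1$), let $X_0 \to A$ be a fibration, and let $f \colon X_0 \to X_1$ be a map over $A$ that is an equivalence over $A$. Then there exist an object $Y_0$, a fibration $Y_0 \to B$, a map $g \colon Y_0 \to Y_1$ over $B$ that is an equivalence over $B$, and a map $X_0 \to Y_0$ such that the square formed by $X_0 \to Y_0$, $X_0 \to A$, $Y_0 \to B$, and $m \colon A \to B$ is a pullback square, and the square formed by $X_0 \to Y_0$, $f$, $g$, and $X_1 \to Y_1$ commutes.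
   Context: Van Kampen colimit: a colimiting cocone $D_i \to C$ such that for any natural transformation $D' \to D$ with all naturality squares pullbacks, any cocone $D'_i \to C'$ and any compatible $C' \to C$, the cocone $D'_i \to C'$ is colimiting iff all squares formed by $D'_i \to C'$, $D'_i \to D_i$, $C' \to C$, $D_i \to C$ are pullbacks. Suitable category: locally presentable, locally cartesian closed, and infinitary extensive (small coproducts are van Kampen). Suitable functorial cylinder on $\mathcal{E}$: an endofunctor $I \otimes (-)$ with a right adjoint $P$, and natural transformations $\delta_0 \otimes X, \delta_1 \otimes X \colon X \to I \otimes X$ (endpoint inclusions), $\epsilon \otimes X \colon I \otimes X \to X$ (contraction), $c^0_X, c^1_X \colon I \otimes I \otimes X \to I \otimes X$ (connections) such that for $k \in \{0,1\}$: $\epsilon \circ \delta_k = \mathrm{id}$; $c^k \circ (\delta_k \otimes (I \otimes X)) = \delta_k \circ \epsilon = c^k \circ (I \otimes (\delta_k \otimes X))$; $c^k \circ (\delta_{1-k} \otimes (I \otimes X)) = \mathrm{id} = c^k \circ (I \otimes (\delta_{1-k} \otimes X))$; $(\epsilon \otimes X) \circ c^k_X = (\epsilon \otimes X) \circ (I \otimes (\epsilon \otimes X))$; and the pullback of $\delta_0 \otimes X$ and $\delta_1 \otimes X$ is the initial object $0$. The transposed transformations are written $d_k \colon P X \to X$ (from $\delta_k$) and $r \colon X \to P X$ (from $\epsilon$). Suitable weak factorization system $(\mathbf{C}, \mathbf{TF})$ (elements: cofibrations, trivial fibrations): it is cofibrantly generated; cofibrations are adhesive (for every pullback $m'$ of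 a cofibration, pushouts along $m'$ are stable under pullback and are pullback squares; such pushouts are then van Kampen) and exhaustive (colimits of transfinite compositions of cofibrations are van Kampen); cofibrations are closed under pullback and under finitary unions of subobjects (nullary case: $0 \to X$ is a cofibration for every $X$); $I \otimes (-)$ preserves cofibrations; and all $\delta_k \otimes X$ are cofibrations. Fibrations $\mathbf{F}$: maps with the right lifting property against $\delta_k \widehat{\otimes} m \colon B +_A (I \otimes A) \to I \otimes B$ for all cofibrations $m \colon A \to B$ and $k \in \{0,1\}$ (the pushout uses $\delta_k \otimes A \colon A \to I \otimes A$; the map has components $\delta_k \otimes B$ and $I \otimes m$). Trivial cofibrations $\mathbf{TC}$: maps with the left lifting property against $\mathbf{F}$. (A.1) For every fibration $p \colon X \to Y$ the map $P X \to P Y \times_{Y \times Y} (X \times X)$ induced by $P p$ and $(d_0, d_1)$ is a fibration. (A.2) Fibrations are local: given a small diagram in the arrow category $\mathcal{E}^{\to}$ all of whose objects are fibrations and all of whose morphisms are pullback squares, with a colimiting cocone to $p$ all of whose components are pullback squares, $p$ is a fibration. Relative notions: for an object $A$, the slice $\mathcal{E}_{/A}$ has the suitable functorial cylinder sending $X \to A$ to $I \otimes X \to I \otimes A \to A$ (last map $\epsilon \otimes A$), with right adjoint $P_A(X) = P X \times_{P A} A$ (pullback along $r \colon A \to P A$), and endpoint projections $d_0, d_1 \colon P_A X \to X$. A map in $\mathcal{E}_{/A}$ is a fibration or trivial fibration if its underlying map in $\mathcal{E}$ is. Equivalence over $A$: given fibrations $X_0 \to A$ and $X_1 \to A$ and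 a map $f \colon X_0 \to X_1$ over $A$, let $M f = X_0 \times_{X_1} P_A X_1$ be the pullback of $d_0 \colon P_A X_1 \to X_1$ along $f$, and $e \colon M f \to X_1$ the composite of the projection to $P_A X_1$ with $d_1$. The map $f$ is an equivalence over $A$ if $e$ is a trivial fibration. *)

theory Defs
  imports Main
begin

unbundle cardinal_syntax

text \<open>
  Smallness is relative to a strongly inaccessible cardinal \<open>\<kappa>\<close> (equivalently, a Grothendieck
  universe containing the natural numbers). Every \<open>\<kappa>\<close>-small category is isomorphic to one whose
  objects and arrows are elements of the carrier type \<open>'u\<close> of \<open>\<kappa>\<close>, and likewise for orders, so
  quantifying over index categories of type \<open>('u, 'u) cat\<close> and index orders of type \<open>'u rel\<close> loses
  no generality.
\<close>

definition inaccessible :: "'u rel \<Rightarrow> bool" where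
  "inaccessible \<kappa> \<longleftrightarrow>
     Card_order \<kappa> \<and> natLeq <o \<kappa> \<and> regularCard \<kappa> \<and>
     (\<forall>S :: 'u set. |S| <o \<kappa> \<longrightarrow> |Pow S| <o \<kappa>)"

abbreviation small :: "'u rel \<Rightarrow> 'b set \<Rightarrow> bool" where
  "small \<kappa> S \<equiv> |S| <o \<kappa>"


section \<open>Categories, functors, natural transformations\<close>

record ('o, 'a) cat =
  Obj :: "'o set"
  Arr :: "'a set"
  Dom :: "'a \<Rightarrow> 'o"
  Cod :: "'a \<Rightarrow> 'o"
  Ident :: "'o \<Rightarrow> 'a"
  Comp :: "'a \<Rightarrow> 'a \<Rightarrow> 'a" (infixl "\<odot>\<index>" 70)

definition hom :: "('o, 'a) cat \<Rightarrow> 'o \<Rightarrow> 'o \<Rightarrow> 'a set" where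
  "hom C X Y = {f \<in> Arr C. Dom C f = X \<and> Cod C f = Y}"

definition category :: "('o, 'a) cat \<Rightarrow> bool" where
  "category C \<longleftrightarrow>
     (\<forall>f \<in> Arr C. Dom C f \<in> Obj C \<and> Cod C f \<in> Obj C) \<and>
     (\<forall>X \<in> Obj C. Ident C X \<in> hom C X X) \<and>
     (\<forall>X Y Z. \<forall>f \<in> hom C X Y. \<forall>g \<in> hom C Y Z. g \<odot>\<^bsub>C\<^esub> f \<in> hom C X Z) \<and>
     (\<forall>X Y. \<forall>f \<in> hom C X Y. f \<odot>\<^bsub>C\<^esub> Ident C X = f \<and> Ident C Y \<odot>\<^bsub>C\<^esub> f = f) \<and>
     (\<forall>W X Y Z. \<forall>f \<in> hom C W X. \<forall>g \<in> hom C X Y. \<forall>h \<in> hom C Y Z.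
        h \<odot>\<^bsub>C\<^esub> (g \<odot>\<^bsub>C\<^esub> f) = (h \<odot>\<^bsub>C\<^esub> g) \<odot>\<^bsub>C\<^esub> f)"

definition small_category :: "'u rel \<Rightarrow> ('i, 'j) cat \<Rightarrow> bool" where
  "small_category \<kappa> J \<longleftrightarrow> category J \<and> small \<kappa> (Obj J) \<and> small \<kappa> (Arr J)"

record ('i, 'j, 'o, 'a) fctr =
  on_obj :: "'i \<Rightarrow> 'o"
  on_arr :: "'j \<Rightarrow> 'a"

definition is_functor ::
  "('i, 'j) cat \<Rightarrow> ('o, 'a) cat \<Rightarrow> ('i, 'j, 'o, 'a) fctr \<Rightarrow> bool" where
  "is_functor J C D \<longleftrightarrow>
     category J \<and> category C \<and>
     (\<forall>i \<in> Obj J. on_obj D i \<in> Obj C) \<and>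
     (\<forall>i k. \<forall>a \<in> hom J i k. on_arr D a \<in> hom C (on_obj D i) (on_obj D k)) \<and>
     (\<forall>i \<in> Obj J. on_arr D (Ident J i) = Ident C (on_obj D i)) \<and>
     (\<forall>i k l. \<forall>a \<in> hom J i k. \<forall>b \<in> hom J k l.
        on_arr D (b \<odot>\<^bsub>J\<^esub> a) = on_arr D b \<odot>\<^bsub>C\<^esub> on_arr D a)"

definition id_fctr :: "('o, 'a, 'o, 'a) fctr" where
  "id_fctr = \<lparr>on_obj = (\<lambda>X. X), on_arr = (\<lambda>f. f)\<rparr>"

definition comp_fctr ::
  "('p, 'b, 'q, 'c) fctr \<Rightarrow> ('o, 'a, 'p, 'b) fctr \<Rightarrow> ('o, 'a, 'q, 'c) fctr" where
  "comp_fctr G F =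
     \<lparr>on_obj = (\<lambda>X. on_obj G (on_obj F X)), on_arr = (\<lambda>f. on_arr G (on_arr F f))\<rparr>"

definition nat_trans ::
  "('i, 'j) cat \<Rightarrow> ('o, 'a) cat \<Rightarrow> ('i, 'j, 'o, 'a) fctr \<Rightarrow> ('i, 'j, 'o, 'a) fctr
     \<Rightarrow> ('i \<Rightarrow> 'a) \<Rightarrow> bool" where
  "nat_trans J C F G \<tau> \<longleftrightarrow>
     is_functor J C F \<and> is_functor J C G \<and>
     (\<forall>i \<in> Obj J. \<tau> i \<in> hom C (on_obj F i) (on_obj G i)) \<and>
     (\<forall>i k. \<forall>a \<in> hom J i k. \<tau> k \<odot>\<^bsub>C\<^esub> on_arr F a = on_arr G a \<odot>\<^bsub>C\<^esub> \<tau> i)"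

definition adjunction ::
  "('o, 'a) cat \<Rightarrow> ('p, 'b) cat \<Rightarrow> ('o, 'a, 'p, 'b) fctr \<Rightarrow> ('p, 'b, 'o, 'a) fctr
     \<Rightarrow> ('o \<Rightarrow> 'a) \<Rightarrow> ('p \<Rightarrow> 'b) \<Rightarrow> bool" where
  "adjunction C D L R \<eta> \<epsilon> \<longleftrightarrow>
     is_functor C D L \<and> is_functor D C R \<and>
     nat_trans C C id_fctr (comp_fctr R L) \<eta> \<and>
     nat_trans D D (comp_fctr L R) id_fctr \<epsilon> \<and>
     (\<forall>X \<in> Obj C. \<epsilon> (on_obj L X) \<odot>\<^bsub>D\<^esub> on_arr L (\<eta> X) = Ident D (on_obj L X)) \<and>
     (\<forall>Y \<in> Obj D. on_arr R (\<epsilon> Y) \<odot>\<^bsub>C\<^esub> \<eta> (on_obj R Y) = Ident C (on_obj R Y))"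

text \<open>An arrow of a slice or arrow category carries its source and target.\<close>

definition slice :: "('o, 'a) cat \<Rightarrow> 'o \<Rightarrow> ('a, 'a \<times> 'a \<times> 'a) cat" where
  "slice C A =
     \<lparr>Obj = {p \<in> Arr C. Cod C p = A},
      Arr = {(p, f, q). p \<in> Arr C \<and> q \<in> Arr C \<and> Cod C p = A \<and> Cod C q = A \<and>
                        f \<in> hom C (Dom C p) (Dom C q) \<and> q \<odot>\<^bsub>C\<^esub> f = p},
      Dom = (\<lambda>(p, f, q). p),
      Cod = (\<lambda>(p, f, q). q),
      Ident = (\<lambda>p. (p, Ident C (Dom C p), p)),
      Comp = (\<lambda>(_, g, r) (p, f, _). (p, g \<odot>\<^bsub>C\<^esub> f, r))\<rparr>"

definition arrow_cat :: "('o, 'a) cat \<Rightarrow> ('a, 'a \<times> 'a \<times> 'a \<times> 'a) cat" where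
  "arrow_cat C =
     \<lparr>Obj = Arr C,
      Arr = {(f, u, v, g). f \<in> Arr C \<and> g \<in> Arr C \<and> u \<in> hom C (Dom C f) (Dom C g) \<and>
                           v \<in> hom C (Cod C f) (Cod C g) \<and> g \<odot>\<^bsub>C\<^esub> u = v \<odot>\<^bsub>C\<^esub> f},
      Dom = (\<lambda>(f, u, v, g). f),
      Cod = (\<lambda>(f, u, v, g). g),
      Ident = (\<lambda>f. (f, Ident C (Dom C f), Ident C (Cod C f), f)),
      Comp = (\<lambda>(_, u', v', h) (f, u, v, _). (f, u' \<odot>\<^bsub>C\<^esub> u, v' \<odot>\<^bsub>C\<^esub> v, h))\<rparr>"

text \<open>The category of a reflexive transitive relation, with objects its field.\<close>

definition poset_cat :: "'i rel \<Rightarrow> ('i, 'i \<times> 'i) cat" where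
  "poset_cat r =
     \<lparr>Obj = Field r, Arr = r, Dom = fst, Cod = snd, Ident = (\<lambda>i. (i, i)),
      Comp = (\<lambda>b a. (fst a, snd b))\<rparr>"


section \<open>Limits and colimits\<close>

definition terminal :: "('o, 'a) cat \<Rightarrow> 'o \<Rightarrow> bool" where
  "terminal C T \<longleftrightarrow> T \<in> Obj C \<and> (\<forall>X \<in> Obj C. \<exists>!f. f \<in> hom C X T)"

definition initial :: "('o, 'a) cat \<Rightarrow> 'o \<Rightarrow> bool" where
  "initial C Z \<longleftrightarrow> Z \<in> Obj C \<and> (\<forall>X \<in> Obj C. \<exists>!f. f \<in> hom C Z X)"

definition monic :: "('o, 'a) cat \<Rightarrow> 'a \<Rightarrow> bool" where
  "monic C m \<longleftrightarrow> m \<in> Arr C \<and>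
     (\<forall>W. \<forall>f \<in> hom C W (Dom C m). \<forall>g \<in> hom C W (Dom C m). m \<odot>\<^bsub>C\<^esub> f = m \<odot>\<^bsub>C\<^esub> g \<longrightarrow> f = g)"

text \<open>\<open>is_product C P \<pi>\<^sub>0 \<pi>\<^sub>1 X Y\<close>: the span \<open>X \<leftarrow> P \<rightarrow> Y\<close> is a product of \<open>X\<close> and \<open>Y\<close>.\<close>

definition is_product :: "('o, 'a) cat \<Rightarrow> 'o \<Rightarrow> 'a \<Rightarrow> 'a \<Rightarrow> 'o \<Rightarrow> 'o \<Rightarrow> bool" where
  "is_product C P \<pi>\<^sub>0 \<pi>\<^sub>1 X Y \<longleftrightarrow>
     P \<in> Obj C \<and> \<pi>\<^sub>0 \<in> hom C P X \<and> \<pi>\<^sub>1 \<in> hom C P Y \<and>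
     (\<forall>W. \<forall>u \<in> hom C W X. \<forall>v \<in> hom C W Y.
        \<exists>!h. h \<in> hom C W P \<and> \<pi>\<^sub>0 \<odot>\<^bsub>C\<^esub> h = u \<and> \<pi>\<^sub>1 \<odot>\<^bsub>C\<^esub> h = v)"

text \<open>
  \<open>is_pullback C p q f g\<close>: the square \<open>f \<circ> p = g \<circ> q\<close> is a pullback, so \<open>q\<close> is the pullback of
  \<open>f\<close> along \<open>g\<close>. Dually, \<open>is_pushout C f g p q\<close> concerns the square \<open>p \<circ> f = q \<circ> g\<close>, and \<open>q\<close> is the
  pushout of \<open>f\<close> along \<open>g\<close>.
\<close>

definition is_pullback :: "('o, 'a) cat \<Rightarrow> 'a \<Rightarrow> 'a \<Rightarrow> 'a \<Rightarrow> 'a \<Rightarrow> bool" where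
  "is_pullback C p q f g \<longleftrightarrow>
     p \<in> Arr C \<and> q \<in> Arr C \<and> f \<in> Arr C \<and> g \<in> Arr C \<and>
     Dom C p = Dom C q \<and> Cod C p = Dom C f \<and> Cod C q = Dom C g \<and> Cod C f = Cod C g \<and>
     f \<odot>\<^bsub>C\<^esub> p = g \<odot>\<^bsub>C\<^esub> q \<and>
     (\<forall>W. \<forall>u \<in> hom C W (Dom C f). \<forall>v \<in> hom C W (Dom C g). f \<odot>\<^bsub>C\<^esub> u = g \<odot>\<^bsub>C\<^esub> v \<longrightarrow>
        (\<exists>!h. h \<in> hom C W (Dom C p) \<and> p \<odot>\<^bsub>C\<^esub> h = u \<and> q \<odot>\<^bsub>C\<^esub> h = v))"

definition is_pushout :: "('o, 'a) cat \<Rightarrow> 'a \<Rightarrow> 'a \<Rightarrow> 'a \<Rightarrow> 'a \<Rightarrow> bool" where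
  "is_pushout C f g p q \<longleftrightarrow>
     f \<in> Arr C \<and> g \<in> Arr C \<and> p \<in> Arr C \<and> q \<in> Arr C \<and>
     Dom C f = Dom C g \<and> Cod C f = Dom C p \<and> Cod C g = Dom C q \<and> Cod C p = Cod C q \<and>
     p \<odot>\<^bsub>C\<^esub> f = q \<odot>\<^bsub>C\<^esub> g \<and>
     (\<forall>W. \<forall>u \<in> hom C (Cod C f) W. \<forall>v \<in> hom C (Cod C g) W. u \<odot>\<^bsub>C\<^esub> f = v \<odot>\<^bsub>C\<^esub> g \<longrightarrow>
        (\<exists>!h. h \<in> hom C (Cod C p) W \<and> h \<odot>\<^bsub>C\<^esub> p = u \<and> h \<odot>\<^bsub>C\<^esub> q = v))"

definition is_cocone ::
  "('i, 'j) cat \<Rightarrow> ('o, 'a) cat \<Rightarrow> ('i, 'j, 'o, 'a) fctr \<Rightarrow> 'o \<Rightarrow> ('i \<Rightarrow> 'a) \<Rightarrow> bool" where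
  "is_cocone J C D X c \<longleftrightarrow>
     is_functor J C D \<and> X \<in> Obj C \<and>
     (\<forall>i \<in> Obj J. c i \<in> hom C (on_obj D i) X) \<and>
     (\<forall>i k. \<forall>a \<in> hom J i k. c k \<odot>\<^bsub>C\<^esub> on_arr D a = c i)"

definition is_colimit ::
  "('i, 'j) cat \<Rightarrow> ('o, 'a) cat \<Rightarrow> ('i, 'j, 'o, 'a) fctr \<Rightarrow> 'o \<Rightarrow> ('i \<Rightarrow> 'a) \<Rightarrow> bool" where
  "is_colimit J C D X c \<longleftrightarrow>
     is_cocone J C D X c \<and>
     (\<forall>Y c'. is_cocone J C D Y c' \<longrightarrow>
        (\<exists>!h. h \<in> hom C X Y \<and> (\<forall>i \<in> Obj J. h \<odot>\<^bsub>C\<^esub> c i = c' i)))"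

definition van_kampen ::
  "('i, 'j) cat \<Rightarrow> ('o, 'a) cat \<Rightarrow> ('i, 'j, 'o, 'a) fctr \<Rightarrow> 'o \<Rightarrow> ('i \<Rightarrow> 'a) \<Rightarrow> bool" where
  "van_kampen J C D X c \<longleftrightarrow>
     is_colimit J C D X c \<and>
     (\<forall>D' \<alpha> X' c' h.
        nat_trans J C D' D \<alpha> \<and>
        (\<forall>i k. \<forall>a \<in> hom J i k. is_pullback C (on_arr D' a) (\<alpha> i) (\<alpha> k) (on_arr D a)) \<and>
        is_cocone J C D' X' c' \<and>
        h \<in> hom C X' X \<and> (\<forall>i \<in> Obj J. h \<odot>\<^bsub>C\<^esub> c' i = c i \<odot>\<^bsub>C\<^esub> \<alpha> i) \<longrightarrow>
        (is_colimit J C D' X' c' \<longleftrightarrow> (\<forall>i \<in> Obj J. is_pullback C (c' i) (\<alpha> i) h (c i))))"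


section \<open>Suitable categories\<close>

definition cocomplete :: "'u rel \<Rightarrow> ('o, 'a) cat \<Rightarrow> bool" where
  "cocomplete \<kappa> C \<longleftrightarrow>
     category C \<and>
     (\<forall>(J :: ('u, 'u) cat) D. small_category \<kappa> J \<and> is_functor J C D \<longrightarrow>
        (\<exists>X c. is_colimit J C D X c))"

definition small_directed :: "'u rel \<Rightarrow> 'u rel \<Rightarrow> 'u rel \<Rightarrow> bool" where
  "small_directed \<kappa> \<mu> r \<longleftrightarrow>
     partial_order_on (Field r) r \<and> small \<kappa> (Field r) \<and>
     (\<forall>S \<subseteq> Field r. |S| <o \<mu> \<longrightarrow> (\<exists>b \<in> Field r. \<forall>s \<in> S. (s, b) \<in> r))"

text \<open>
  \<open>hom(X, -)\<close> preserves the colimit of a \<open>\<mu>\<close>-directed diagram \<open>D\<close> iff the canonical map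
  \<open>colim hom(X, D i) \<rightarrow> hom(X, colim D)\<close> is surjective and injective; the two conjuncts below say
  this, using the explicit description of directed colimits of sets.
\<close>

definition presentable :: "'u rel \<Rightarrow> 'u rel \<Rightarrow> ('o, 'a) cat \<Rightarrow> 'o \<Rightarrow> bool" where
  "presentable \<kappa> \<mu> C X \<longleftrightarrow>
     X \<in> Obj C \<and>
     (\<forall>r D L c. small_directed \<kappa> \<mu> r \<and> is_colimit (poset_cat r) C D L c \<longrightarrow>
        (\<forall>f \<in> hom C X L. \<exists>i \<in> Field r. \<exists>g \<in> hom C X (on_obj D i). f = c i \<odot>\<^bsub>C\<^esub> g) \<and>
        (\<forall>i \<in> Field r. \<forall>g \<in> hom C X (on_obj D i). \<forall>g' \<in> hom C X (on_obj D i).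
           c i \<odot>\<^bsub>C\<^esub> g = c i \<odot>\<^bsub>C\<^esub> g' \<longrightarrow>
           (\<exists>k. (i, k) \<in> r \<and> on_arr D (i, k) \<odot>\<^bsub>C\<^esub> g = on_arr D (i, k) \<odot>\<^bsub>C\<^esub> g')))"

definition locally_presentable :: "'u rel \<Rightarrow> ('o, 'a) cat \<Rightarrow> bool" where
  "locally_presentable \<kappa> C \<longleftrightarrow>
     category C \<and>
     (\<forall>X \<in> Obj C. \<forall>Y \<in> Obj C. small \<kappa> (hom C X Y)) \<and>
     cocomplete \<kappa> C \<and>
     (\<exists>(\<mu> :: 'u rel) G.
        Card_order \<mu> \<and> natLeq \<le>o \<mu> \<and> regularCard \<mu> \<and> \<mu> <o \<kappa> \<and>
        small \<kappa> G \<and> (\<forall>X \<in> G. presentable \<kappa> \<mu> C X) \<and>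
        (\<forall>X \<in> Obj C. \<exists>r D c. small_directed \<kappa> \<mu> r \<and> (\<forall>i \<in> Field r. on_obj D i \<in> G) \<and>
                               is_colimit (poset_cat r) C D X c))"

text \<open>\<open>is_exponential C W P \<pi>\<^sub>0 \<pi>\<^sub>1 ev X Y\<close>: \<open>W = Y\<^sup>X\<close> with evaluation \<open>ev : P = W \<times> X \<rightarrow> Y\<close>.\<close>

definition is_exponential ::
  "('o, 'a) cat \<Rightarrow> 'o \<Rightarrow> 'o \<Rightarrow> 'a \<Rightarrow> 'a \<Rightarrow> 'a \<Rightarrow> 'o \<Rightarrow> 'o \<Rightarrow> bool" where
  "is_exponential C W P \<pi>\<^sub>0 \<pi>\<^sub>1 ev X Y \<longleftrightarrow>
     is_product C P \<pi>\<^sub>0 \<pi>\<^sub>1 W X \<and> ev \<in> hom C P Y \<and>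
     (\<forall>Z Q \<rho>\<^sub>0 \<rho>\<^sub>1 f. is_product C Q \<rho>\<^sub>0 \<rho>\<^sub>1 Z X \<and> f \<in> hom C Q Y \<longrightarrow>
        (\<exists>!h. h \<in> hom C Z W \<and>
              (\<exists>u \<in> hom C Q P. \<pi>\<^sub>0 \<odot>\<^bsub>C\<^esub> u = h \<odot>\<^bsub>C\<^esub> \<rho>\<^sub>0 \<and> \<pi>\<^sub>1 \<odot>\<^bsub>C\<^esub> u = \<rho>\<^sub>1 \<and> ev \<odot>\<^bsub>C\<^esub> u = f)))"

definition cartesian_closed :: "('o, 'a) cat \<Rightarrow> bool" where
  "cartesian_closed C \<longleftrightarrow>
     category C \<and> (\<exists>T. terminal C T) \<and>
     (\<forall>X \<in> Obj C. \<forall>Y \<in> Obj C. \<exists>P \<pi>\<^sub>0 \<pi>\<^sub>1. is_product C P \<pi>\<^sub>0 \<pi>\<^sub>1 X Y) \<and>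
     (\<forall>X \<in> Obj C. \<forall>Y \<in> Obj C. \<exists>W P \<pi>\<^sub>0 \<pi>\<^sub>1 ev. is_exponential C W P \<pi>\<^sub>0 \<pi>\<^sub>1 ev X Y)"

text \<open>
  A locally cartesian closed category is a category with finite limits all of whose slices are
  cartesian closed. Binary products in the slices are the pullbacks of \<open>C\<close>, so a terminal object is
  the only additional requirement.
\<close>

definition locally_cartesian_closed :: "('o, 'a) cat \<Rightarrow> bool" where
  "locally_cartesian_closed C \<longleftrightarrow>
     category C \<and> (\<exists>T. terminal C T) \<and> (\<forall>A \<in> Obj C. cartesian_closed (slice C A))"

text \<open>Coproducts are the colimits of diagrams indexed by a discrete order \<open>Id_on S\<close>.\<close>

definition infinitary_extensive :: "'u rel \<Rightarrow> ('o, 'a) cat \<Rightarrow> bool" where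
  "infinitary_extensive \<kappa> C \<longleftrightarrow>
     (\<forall>S :: 'u set. small \<kappa> S \<longrightarrow>
        (\<forall>D. is_functor (poset_cat (Id_on S)) C D \<longrightarrow>
           (\<exists>X c. is_colimit (poset_cat (Id_on S)) C D X c)) \<and>
        (\<forall>D X c. is_colimit (poset_cat (Id_on S)) C D X c \<longrightarrow>
           van_kampen (poset_cat (Id_on S)) C D X c))"

definition suitable_category :: "'u rel \<Rightarrow> ('o, 'a) cat \<Rightarrow> bool" where
  "suitable_category \<kappa> C \<longleftrightarrow>
     locally_presentable \<kappa> C \<and> locally_cartesian_closed C \<and> infinitary_extensive \<kappa> C"


section \<open>Suitable functorial cylinders\<close>

text \<open>
  The adjunction between \<open>I \<otimes> (-)\<close> (field \<open>cyl\<close>) and its right adjoint \<open>P\<close> (field \<open>path\<close>) is given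
  by unit and counit. The index of \<open>\<delta>\<close> and of the connections \<open>c\<close> is only used at \<open>0\<close> and \<open>1\<close>.
\<close>

record ('o, 'a) cylinder =
  cyl :: "('o, 'a, 'o, 'a) fctr"
  path :: "('o, 'a, 'o, 'a) fctr"
  adj_unit :: "'o \<Rightarrow> 'a"
  adj_counit :: "'o \<Rightarrow> 'a"
  delta :: "nat \<Rightarrow> 'o \<Rightarrow> 'a"
  contr :: "'o \<Rightarrow> 'a"
  conn :: "nat \<Rightarrow> 'o \<Rightarrow> 'a"

definition suitable_cylinder :: "('o, 'a) cat \<Rightarrow> ('o, 'a) cylinder \<Rightarrow> bool" where
  "suitable_cylinder E I \<longleftrightarrow>
     (let I\<^sub>o = on_obj (cyl I); I\<^sub>a = on_arr (cyl I); \<delta> = delta I; \<epsilon> = contr I; c = conn I in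
     adjunction E E (cyl I) (path I) (adj_unit I) (adj_counit I) \<and>
     nat_trans E E (cyl I) id_fctr \<epsilon> \<and>
     (\<forall>k \<in> {0, 1}.
        nat_trans E E id_fctr (cyl I) (\<delta> k) \<and>
        nat_trans E E (comp_fctr (cyl I) (cyl I)) (cyl I) (c k)) \<and>
     (\<forall>k \<in> {0, 1}. \<forall>X \<in> Obj E.
        \<epsilon> X \<odot>\<^bsub>E\<^esub> \<delta> k X = Ident E X \<and>
        c k X \<odot>\<^bsub>E\<^esub> \<delta> k (I\<^sub>o X) = \<delta> k X \<odot>\<^bsub>E\<^esub> \<epsilon> X \<and>
        c k X \<odot>\<^bsub>E\<^esub> I\<^sub>a (\<delta> k X) = \<delta> k X \<odot>\<^bsub>E\<^esub> \<epsilon> X \<and>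
        c k X \<odot>\<^bsub>E\<^esub> \<delta> (1 - k) (I\<^sub>o X) = Ident E (I\<^sub>o X) \<and>
        c k X \<odot>\<^bsub>E\<^esub> I\<^sub>a (\<delta> (1 - k) X) = Ident E (I\<^sub>o X) \<and>
        \<epsilon> X \<odot>\<^bsub>E\<^esub> c k X = \<epsilon> X \<odot>\<^bsub>E\<^esub> I\<^sub>a (\<epsilon> X)) \<and>
     (\<forall>X \<in> Obj E. \<exists>p q. is_pullback E p q (\<delta> 0 X) (\<delta> 1 X) \<and> initial E (Dom E p)))"

text \<open>The transposes \<open>d\<^sub>k : P X \<rightarrow> X\<close> of \<open>\<delta>\<^sub>k\<close> and \<open>r : X \<rightarrow> P X\<close> of \<open>\<epsilon>\<close>.\<close>

definition path_d :: "('o, 'a) cat \<Rightarrow> ('o, 'a) cylinder \<Rightarrow> nat \<Rightarrow> 'o \<Rightarrow> 'a" where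
  "path_d E I k X = adj_counit I X \<odot>\<^bsub>E\<^esub> delta I k (on_obj (path I) X)"

definition path_r :: "('o, 'a) cat \<Rightarrow> ('o, 'a) cylinder \<Rightarrow> 'o \<Rightarrow> 'a" where
  "path_r E I X = on_arr (path I) (contr I X) \<odot>\<^bsub>E\<^esub> adj_unit I X"


section \<open>Suitable weak factorization systems\<close>

definition has_lifts :: "('o, 'a) cat \<Rightarrow> 'a \<Rightarrow> 'a \<Rightarrow> bool" where
  "has_lifts E i p \<longleftrightarrow>
     (\<forall>u \<in> hom E (Dom E i) (Dom E p). \<forall>v \<in> hom E (Cod E i) (Cod E p).
        p \<odot>\<^bsub>E\<^esub> u = v \<odot>\<^bsub>E\<^esub> i \<longrightarrow>
        (\<exists>h \<in> hom E (Cod E i) (Dom E p). h \<odot>\<^bsub>E\<^esub> i = u \<and> p \<odot>\<^bsub>E\<^esub> h = v))"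

definition rlp :: "('o, 'a) cat \<Rightarrow> 'a set \<Rightarrow> 'a set" where
  "rlp E S = {p \<in> Arr E. \<forall>i \<in> S. has_lifts E i p}"

definition llp :: "('o, 'a) cat \<Rightarrow> 'a set \<Rightarrow> 'a set" where
  "llp E S = {i \<in> Arr E. \<forall>p \<in> S. has_lifts E i p}"

definition weak_factorization_system :: "('o, 'a) cat \<Rightarrow> 'a set \<Rightarrow> 'a set \<Rightarrow> bool" where
  "weak_factorization_system E L R \<longleftrightarrow>
     L = llp E R \<and> R = rlp E L \<and>
     (\<forall>f \<in> Arr E. \<exists>l \<in> L. \<exists>r \<in> R. Cod E l = Dom E r \<and> f = r \<odot>\<^bsub>E\<^esub> l)"

definition cofibrantly_generated :: "'u rel \<Rightarrow> ('o, 'a) cat \<Rightarrow> 'a set \<Rightarrow> bool" where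
  "cofibrantly_generated \<kappa> E R \<longleftrightarrow> (\<exists>G \<subseteq> Arr E. small \<kappa> G \<and> R = rlp E G)"

text \<open>
  Stability of the pushout square \<open>g \<circ> m = n \<circ> f\<close> with corner \<open>D\<close> under pullback along any
  \<open>k : D' \<rightarrow> D\<close>; the maps \<open>a\<close>, \<open>b\<close>, \<open>c\<close> and \<open>k\<close> are the sides of the cube over the square.
\<close>

definition stable_pushout :: "('o, 'a) cat \<Rightarrow> 'a \<Rightarrow> 'a \<Rightarrow> 'a \<Rightarrow> 'a \<Rightarrow> bool" where
  "stable_pushout E m f g n \<longleftrightarrow>
     (\<forall>m' f' g' n' a b c k.
        is_pullback E g' b k g \<and> is_pullback E n' c k n \<and>
        is_pullback E (g' \<odot>\<^bsub>E\<^esub> m') a k (g \<odot>\<^bsub>E\<^esub> m) \<and>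
        m' \<in> hom E (Dom E a) (Dom E b) \<and> b \<odot>\<^bsub>E\<^esub> m' = m \<odot>\<^bsub>E\<^esub> a \<and>
        f' \<in> hom E (Dom E a) (Dom E c) \<and> c \<odot>\<^bsub>E\<^esub> f' = f \<odot>\<^bsub>E\<^esub> a \<and>
        g' \<odot>\<^bsub>E\<^esub> m' = n' \<odot>\<^bsub>E\<^esub> f' \<longrightarrow>
        is_pushout E m' f' g' n')"

definition adhesive :: "('o, 'a) cat \<Rightarrow> 'a \<Rightarrow> bool" where
  "adhesive E m \<longleftrightarrow>
     (\<forall>m' s t. is_pullback E s m' m t \<longrightarrow>
        (\<forall>f g n. is_pushout E m' f g n \<longrightarrow>
           stable_pushout E m' f g n \<and> is_pullback E m' f g n))"

definition is_succ :: "'u rel \<Rightarrow> 'u \<Rightarrow> 'u \<Rightarrow> bool" where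
  "is_succ r i i' \<longleftrightarrow> i \<in> underS r i' \<and> (\<forall>k. i \<in> underS r k \<longrightarrow> (i', k) \<in> r)"

text \<open>Ordinals are well-orders \<open>r\<close>; \<open>underS r i\<close> is the set of predecessors of \<open>i\<close>.\<close>

definition transfinite_composition ::
  "('o, 'a) cat \<Rightarrow> 'a set \<Rightarrow> 'u rel \<Rightarrow> ('u, 'u \<times> 'u, 'o, 'a) fctr \<Rightarrow> bool" where
  "transfinite_composition E S r D \<longleftrightarrow>
     Well_order r \<and> is_functor (poset_cat r) E D \<and>
     (\<forall>i i'. is_succ r i i' \<longrightarrow> on_arr D (i, i') \<in> S) \<and>
     (\<forall>i \<in> Field r. underS r i \<noteq> {} \<and> (\<forall>k. \<not> is_succ r k i) \<longrightarrow>
        is_colimit (poset_cat (Restr r (underS r i))) E D (on_obj D i) (\<lambda>k. on_arr D (k, i)))"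

definition exhaustive :: "'u rel \<Rightarrow> ('o, 'a) cat \<Rightarrow> 'a set \<Rightarrow> bool" where
  "exhaustive \<kappa> E S \<longleftrightarrow>
     (\<forall>(r :: 'u rel) D X c.
        small \<kappa> (Field r) \<and> transfinite_composition E S r D \<and>
        is_colimit (poset_cat r) E D X c \<longrightarrow>
        van_kampen (poset_cat r) E D X c)"

definition factors_through :: "('o, 'a) cat \<Rightarrow> 'a \<Rightarrow> 'a \<Rightarrow> bool" where
  "factors_through E f g \<longleftrightarrow> (\<exists>h \<in> hom E (Dom E f) (Dom E g). f = g \<odot>\<^bsub>E\<^esub> h)"

text \<open>\<open>u\<close> represents the join of \<open>m\<^sub>1\<close> and \<open>m\<^sub>2\<close> in the preorder of subobjects of their codomain.\<close>

definition is_union :: "('o, 'a) cat \<Rightarrow> 'a \<Rightarrow> 'a \<Rightarrow> 'a \<Rightarrow> bool" where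
  "is_union E m\<^sub>1 m\<^sub>2 u \<longleftrightarrow>
     monic E m\<^sub>1 \<and> monic E m\<^sub>2 \<and> monic E u \<and> Cod E m\<^sub>1 = Cod E u \<and> Cod E m\<^sub>2 = Cod E u \<and>
     factors_through E m\<^sub>1 u \<and> factors_through E m\<^sub>2 u \<and>
     (\<forall>v. monic E v \<and> Cod E v = Cod E u \<and> factors_through E m\<^sub>1 v \<and> factors_through E m\<^sub>2 v \<longrightarrow>
        factors_through E u v)"

definition suitable_wfs ::
  "'u rel \<Rightarrow> ('o, 'a) cat \<Rightarrow> ('o, 'a) cylinder \<Rightarrow> 'a set \<Rightarrow> 'a set \<Rightarrow> bool" where
  "suitable_wfs \<kappa> E I Cof TFib \<longleftrightarrow>
     weak_factorization_system E Cof TFib \<and>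
     cofibrantly_generated \<kappa> E TFib \<and>
     (\<forall>m \<in> Cof. adhesive E m) \<and>
     exhaustive \<kappa> E Cof \<and>
     (\<forall>m \<in> Cof. \<forall>m' s t. is_pullback E s m' m t \<longrightarrow> m' \<in> Cof) \<and>
     (\<forall>Z z. initial E Z \<and> z \<in> Arr E \<and> Dom E z = Z \<longrightarrow> z \<in> Cof) \<and>
     (\<forall>m\<^sub>1 \<in> Cof. \<forall>m\<^sub>2 \<in> Cof. \<forall>u. is_union E m\<^sub>1 m\<^sub>2 u \<longrightarrow> u \<in> Cof) \<and>
     (\<forall>m \<in> Cof. on_arr (cyl I) m \<in> Cof) \<and>
     (\<forall>k \<in> {0, 1}. \<forall>X \<in> Obj E. delta I k X \<in> Cof)"


section \<open>Fibrations and equivalences\<close>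

text \<open>
  The pushout products of \<open>\<delta>\<^sub>k\<close> and \<open>m\<close>. Pushouts and pullbacks are determined up to isomorphism and
  classes given by lifting properties are closed under isomorphism, so here and below
  it does not matter which ones are chosen.
\<close>

definition delta_pushout_products ::
  "('o, 'a) cat \<Rightarrow> ('o, 'a) cylinder \<Rightarrow> 'a set \<Rightarrow> 'a set" where
  "delta_pushout_products E I Cof =
     {u. \<exists>k \<in> {0, 1}. \<exists>m \<in> Cof. \<exists>i j.
           is_pushout E m (delta I k (Dom E m)) i j \<and>
           u \<in> hom E (Cod E i) (on_obj (cyl I) (Cod E m)) \<and>
           u \<odot>\<^bsub>E\<^esub> i = delta I k (Cod E m) \<and> u \<odot>\<^bsub>E\<^esub> j = on_arr (cyl I) m}"

definition fibrations :: "('o, 'a) cat \<Rightarrow> ('o, 'a) cylinder \<Rightarrow> 'a set \<Rightarrow> 'a set" where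
  "fibrations E I Cof = rlp E (delta_pushout_products E I Cof)"

text \<open>
  Condition (A.1). Here \<open>\<pi>\<^sub>k\<close> and \<open>\<rho>\<^sub>k\<close> are the projections of \<open>X \<times> X\<close> and \<open>Y \<times> Y\<close>, \<open>pp = p \<times> p\<close>,
  \<open>dY = (d\<^sub>0, d\<^sub>1) : P Y \<rightarrow> Y \<times> Y\<close>, and \<open>s\<close>, \<open>t\<close> are the projections of \<open>P Y \<times>\<^bsub>Y \<times> Y\<^esub> (X \<times> X)\<close>.
\<close>

definition path_fibrations :: "('o, 'a) cat \<Rightarrow> ('o, 'a) cylinder \<Rightarrow> 'a set \<Rightarrow> bool" where
  "path_fibrations E I Fib \<longleftrightarrow>
     (\<forall>p \<in> Fib. \<forall>X Y XX YY \<pi>\<^sub>0 \<pi>\<^sub>1 \<rho>\<^sub>0 \<rho>\<^sub>1 pp dY s t u.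
        p \<in> hom E X Y \<and>
        is_product E XX \<pi>\<^sub>0 \<pi>\<^sub>1 X X \<and> is_product E YY \<rho>\<^sub>0 \<rho>\<^sub>1 Y Y \<and>
        pp \<in> hom E XX YY \<and> \<rho>\<^sub>0 \<odot>\<^bsub>E\<^esub> pp = p \<odot>\<^bsub>E\<^esub> \<pi>\<^sub>0 \<and> \<rho>\<^sub>1 \<odot>\<^bsub>E\<^esub> pp = p \<odot>\<^bsub>E\<^esub> \<pi>\<^sub>1 \<and>
        dY \<in> hom E (on_obj (path I) Y) YY \<and>
        \<rho>\<^sub>0 \<odot>\<^bsub>E\<^esub> dY = path_d E I 0 Y \<and> \<rho>\<^sub>1 \<odot>\<^bsub>E\<^esub> dY = path_d E I 1 Y \<and>
        is_pullback E s t dY pp \<and>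
        u \<in> hom E (on_obj (path I) X) (Dom E s) \<and>
        s \<odot>\<^bsub>E\<^esub> u = on_arr (path I) p \<and>
        \<pi>\<^sub>0 \<odot>\<^bsub>E\<^esub> (t \<odot>\<^bsub>E\<^esub> u) = path_d E I 0 X \<and> \<pi>\<^sub>1 \<odot>\<^bsub>E\<^esub> (t \<odot>\<^bsub>E\<^esub> u) = path_d E I 1 X \<longrightarrow>
        u \<in> Fib)"

definition pullback_morphism :: "('o, 'a) cat \<Rightarrow> 'a \<times> 'a \<times> 'a \<times> 'a \<Rightarrow> bool" where
  "pullback_morphism E = (\<lambda>(f, u, v, g). is_pullback E u f g v)"

text \<open>Condition (A.2).\<close>

definition local_class :: "'u rel \<Rightarrow> ('o, 'a) cat \<Rightarrow> 'a set \<Rightarrow> bool" where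
  "local_class \<kappa> E Fib \<longleftrightarrow>
     (\<forall>(J :: ('u, 'u) cat) D p c.
        small_category \<kappa> J \<and> is_functor J (arrow_cat E) D \<and>
        (\<forall>i \<in> Obj J. on_obj D i \<in> Fib) \<and>
        (\<forall>a \<in> Arr J. pullback_morphism E (on_arr D a)) \<and>
        is_colimit J (arrow_cat E) D p c \<and>
        (\<forall>i \<in> Obj J. pullback_morphism E (c i)) \<longrightarrow>
        p \<in> Fib)"

text \<open>
  For \<open>f : X\<^sub>0 \<rightarrow> X\<^sub>1\<close> over \<open>A\<close> with structure maps \<open>p\<^sub>0\<close> and \<open>p\<^sub>1\<close>: \<open>s\<close> and \<open>t\<close> are the projections of
  \<open>P\<^sub>A X\<^sub>1 = P X\<^sub>1 \<times>\<^bsub>P A\<^esub> A\<close>, whose endpoint projections are \<open>d\<^sub>k \<circ> s\<close>; \<open>v\<close> and \<open>w\<close> are the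
  projections of \<open>M f = X\<^sub>0 \<times>\<^bsub>X\<^sub>1\<^esub> P\<^sub>A X\<^sub>1\<close>.
\<close>

definition equivalence_over ::
  "('o, 'a) cat \<Rightarrow> ('o, 'a) cylinder \<Rightarrow> 'a set \<Rightarrow> 'a \<Rightarrow> 'a \<Rightarrow> 'a \<Rightarrow> bool" where
  "equivalence_over E I TFib p\<^sub>0 p\<^sub>1 f \<longleftrightarrow>
     p\<^sub>0 \<in> Arr E \<and> p\<^sub>1 \<in> Arr E \<and> Cod E p\<^sub>0 = Cod E p\<^sub>1 \<and>
     f \<in> hom E (Dom E p\<^sub>0) (Dom E p\<^sub>1) \<and> p\<^sub>1 \<odot>\<^bsub>E\<^esub> f = p\<^sub>0 \<and>
     (\<exists>s t v w.
        is_pullback E s t (on_arr (path I) p\<^sub>1) (path_r E I (Cod E p\<^sub>1)) \<and>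
        is_pullback E v w f (path_d E I 0 (Dom E p\<^sub>1) \<odot>\<^bsub>E\<^esub> s) \<and>
        (path_d E I 1 (Dom E p\<^sub>1) \<odot>\<^bsub>E\<^esub> s) \<odot>\<^bsub>E\<^esub> w \<in> TFib)"

end

theory Submission
  imports Defs
begin

text \<open>
  Write \<open>x\<^sub>1 : X\<^sub>1 \<rightarrow> Y\<^sub>1\<close> for the pullback of the cofibration \<open>m : A \<rightarrow> B\<close>. The arrow \<open>g : Y\<^sub>0 \<rightarrow> Y\<^sub>1\<close>
  is the pushforward of \<open>f : X\<^sub>0 \<rightarrow> X\<^sub>1\<close> along the monomorphism \<open>x\<^sub>1\<close>: an arrow \<open>D \<rightarrow> Y\<^sub>0\<close> is an arrow
  \<open>y : D \<rightarrow> Y\<^sub>1\<close> together with a factorization through \<open>f\<close> of its restriction to the part \<open>D\<^sub>A\<close> of \<open>D\<close>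
  lying over \<open>A\<close> (\<open>pushforward_along_monic\<close>). Over \<open>A\<close> itself this gives back \<open>f\<close>, because \<open>x\<^sub>1\<close> is
  monic. It remains to see that \<open>g\<close> is an equivalence and \<open>q\<^sub>1 \<circ> g : Y\<^sub>0 \<rightarrow> B\<close> a fibration.

  Both follow from a reformulation of equivalences. Unfolding the mapping path object and the
  adjunction between \<open>I \<otimes> (-)\<close> and \<open>P\<close>, an arrow \<open>f : X\<^sub>0 \<rightarrow> X\<^sub>1\<close> over \<open>A\<close> is an equivalence iff for every
  cofibration \<open>n : C \<rightarrow> D\<close>, every \<open>b : D \<rightarrow> X\<^sub>1\<close>, every \<open>u : C \<rightarrow> X\<^sub>0\<close> and every fibrewise homotopy from
  \<open>f u\<close> to \<open>b n\<close>, both \<open>u\<close> and the homotopy extend to \<open>D\<close>, the homotopy still ending at \<open>b\<close>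
  (\<open>equivalence_over_iff\<close>).

  This extension property passes from \<open>f\<close> to \<open>g\<close> (\<open>extends_homotopies_pushforward\<close>). Given data
  \<open>n\<close>, \<open>b\<close>, \<open>u\<close>, \<open>\<omega>\<close> for \<open>g\<close>, restrict everything to the parts over \<open>A\<close> and extend from \<open>C\<^sub>A\<close> to
  \<open>D\<^sub>A\<close> by the property of \<open>f\<close>. The homotopy so obtained on \<open>D\<^sub>A\<close> agrees with \<open>\<omega>\<close> on the intersection
  \<open>C\<^sub>A = C \<inter> D\<^sub>A\<close>, so the two glue on the union \<open>C \<union> D\<^sub>A\<close>, whose inclusion in \<open>D\<close> is a
  cofibration and which is computed by a pushout (\<open>Cof_union\<close>). As \<open>q\<^sub>1\<close> is a fibration, the
  result extends to a homotopy on \<open>D\<close> that ends at \<open>b\<close>. Its starting point is an arrow \<open>D \<rightarrow> Y\<^sub>1\<close> which factors through \<open>f\<close>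
  on \<open>D\<^sub>A\<close>, that is, an arrow \<open>D \<rightarrow> Y\<^sub>0\<close>.

  Finally, the composite of a fibration \<open>q\<^sub>1\<close> with any \<open>g\<close> having the extension property is a fibration
  (\<open>has_fillers_comp\<close>). An open box in \<open>Y\<^sub>0\<close> can be filled in \<open>Y\<^sub>1\<close>; the face of this filler opposite to the
  given one is moved into \<open>Y\<^sub>0\<close> by the extension property, applied to the constant homotopy where
  the walls meet that face. This produces the opposite face only, but the whole filler of a box is the
  opposite face of a box of one dimension more, obtained by means of a connection.
\<close>


section \<open>Pullbacks and pushouts\<close>

locale category_E =
  fixes E :: "('o, 'a) cat"
  assumes category_E: "category E"
begin

abbreviation comp_E :: "'a \<Rightarrow> 'a \<Rightarrow> 'a" (infixr "\<cdot>" 70) where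
  "g \<cdot> f \<equiv> g \<odot>\<^bsub>E\<^esub> f"

lemma hom_iff: "f \<in> hom E X Y \<longleftrightarrow> f \<in> Arr E \<and> Dom E f = X \<and> Cod E f = Y"
  by (auto simp: hom_def)

lemma homI: "f \<in> Arr E \<Longrightarrow> f \<in> hom E (Dom E f) (Cod E f)"
  by (simp add: hom_iff)

lemma Dom_Obj [simp]: "f \<in> Arr E \<Longrightarrow> Dom E f \<in> Obj E"
  and Cod_Obj [simp]: "f \<in> Arr E \<Longrightarrow> Cod E f \<in> Obj E"
  using category_E by (auto simp: category_def)

lemma homD:
  assumes "f \<in> hom E X Y"
  shows "f \<in> Arr E" "Dom E f = X" "Cod E f = Y" "X \<in> Obj E" "Y \<in> Obj E"
  using assms by (auto simp: hom_iff)

lemma comp_hom: "f \<in> hom E X Y \<Longrightarrow> g \<in> hom E Y Z \<Longrightarrow> g \<cdot> f \<in> hom E X Z"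
  using category_E by (auto simp: category_def)

lemma
  assumes "f \<in> Arr E" "g \<in> Arr E" "Cod E f = Dom E g"
  shows comp_Arr [simp]: "g \<cdot> f \<in> Arr E"
    and Dom_comp [simp]: "Dom E (g \<cdot> f) = Dom E f"
    and Cod_comp [simp]: "Cod E (g \<cdot> f) = Cod E g"
  using comp_hom[of f "Dom E f" "Cod E f" g "Cod E g"] assms by (auto simp: hom_iff)

lemma Ident_hom: "X \<in> Obj E \<Longrightarrow> Ident E X \<in> hom E X X"
  using category_E by (auto simp: category_def)

lemma
  assumes "X \<in> Obj E"
  shows Ident_Arr [simp]: "Ident E X \<in> Arr E"
    and Dom_Ident [simp]: "Dom E (Ident E X) = X"
    and Cod_Ident [simp]: "Cod E (Ident E X) = X"
  using Ident_hom[OF assms] by (auto simp: hom_iff)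

lemma
  assumes "f \<in> Arr E"
  shows comp_Ident [simp]: "Dom E f = X \<Longrightarrow> f \<cdot> Ident E X = f"
    and Ident_comp [simp]: "Cod E f = Y \<Longrightarrow> Ident E Y \<cdot> f = f"
  using category_E assms by (auto simp: category_def hom_iff)

lemma comp_assoc [simp]:
  assumes "f \<in> Arr E" "g \<in> Arr E" "h \<in> Arr E" "Cod E f = Dom E g" "Cod E g = Dom E h"
  shows "(h \<cdot> g) \<cdot> f = h \<cdot> g \<cdot> f"
proof -
  have "f \<in> hom E (Dom E f) (Dom E g)" "g \<in> hom E (Dom E g) (Dom E h)"
    "h \<in> hom E (Dom E h) (Cod E h)"
    using assms by (simp_all add: hom_iff)
  then show ?thesis
    using category_E unfolding category_def by metis
qed

text \<open>
  Composites are kept in right-associated form; this turns an equation between composites into a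
  rewrite rule that also applies when the left-hand side is followed by further arrows.
\<close>

lemma comp_eq_assoc:
  assumes "b \<cdot> a = c"
    and "a \<in> Arr E" "b \<in> Arr E" "Cod E a = Dom E b" "z \<in> Arr E" "Cod E z = Dom E a"
  shows "b \<cdot> a \<cdot> z = c \<cdot> z"
  using assms comp_assoc[of z a b] by simp

lemma pullbackD:
  assumes "is_pullback E p q f g"
  shows "p \<in> Arr E" "q \<in> Arr E" "f \<in> Arr E" "g \<in> Arr E" "Dom E p = Dom E q"
    "Cod E p = Dom E f" "Cod E q = Dom E g" "Cod E f = Cod E g" "f \<cdot> p = g \<cdot> q"
  using assms by (auto simp: is_pullback_def)

lemma pullback_homs:
  assumes "is_pullback E p q f g" "f \<in> hom E X Z" "g \<in> hom E Y Z"
  obtains P where "p \<in> hom E P X" "q \<in> hom E P Y" "f \<cdot> p = g \<cdot> q"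
  using pullbackD[OF assms(1)] assms(2,3) by (simp add: hom_iff)

lemma pullback_lift:
  assumes "is_pullback E p q f g" "u \<in> Arr E" "v \<in> Arr E" "Dom E u = Dom E v"
    "Cod E u = Dom E f" "Cod E v = Dom E g" "f \<cdot> u = g \<cdot> v"
  obtains h where "h \<in> hom E (Dom E u) (Dom E p)" "p \<cdot> h = u" "q \<cdot> h = v"
proof -
  have "u \<in> hom E (Dom E u) (Dom E f)" "v \<in> hom E (Dom E u) (Dom E g)"
    using assms by (simp_all add: hom_iff)
  then show thesis
    using assms(1,7) that unfolding is_pullback_def by metis
qed

lemma pullback_unique:
  assumes "is_pullback E p q f g" "h \<in> Arr E" "h' \<in> Arr E" "Dom E h = Dom E h'"
    "Cod E h = Dom E p" "Cod E h' = Dom E p" "p \<cdot> h = p \<cdot> h'" "q \<cdot> h = q \<cdot> h'"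
  shows "h = h'"
proof -
  note [simp] = pullbackD(1-8)[OF assms(1)] assms(2-6)
  have "f \<cdot> p \<cdot> h = g \<cdot> q \<cdot> h"
    using comp_eq_assoc[OF pullbackD(9)[OF assms(1)], of h] assms(5) by simp
  moreover have "p \<cdot> h \<in> hom E (Dom E h) (Dom E f)" "q \<cdot> h \<in> hom E (Dom E h) (Dom E g)"
    using assms(5) by (simp_all add: hom_iff)
  ultimately have "\<exists>!k. k \<in> hom E (Dom E h) (Dom E p) \<and> p \<cdot> k = p \<cdot> h \<and> q \<cdot> k = q \<cdot> h"
    using assms(1) unfolding is_pullback_def by blast
  moreover have "h \<in> hom E (Dom E h) (Dom E p)" "h' \<in> hom E (Dom E h) (Dom E p)"
    using assms by (simp_all add: hom_iff)
  ultimately show ?thesis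
    using assms(7,8) by metis
qed

lemma pullbackI:
  assumes "f \<in> hom E X Z" "g \<in> hom E Y Z" "p \<in> hom E P X" "q \<in> hom E P Y" "f \<cdot> p = g \<cdot> q"
    and lift: "\<And>W u v. u \<in> hom E W X \<Longrightarrow> v \<in> hom E W Y \<Longrightarrow> f \<cdot> u = g \<cdot> v \<Longrightarrow>
      \<exists>h \<in> hom E W P. p \<cdot> h = u \<and> q \<cdot> h = v"
    and unique: "\<And>W h h'. h \<in> hom E W P \<Longrightarrow> h' \<in> hom E W P \<Longrightarrow>
      p \<cdot> h = p \<cdot> h' \<Longrightarrow> q \<cdot> h = q \<cdot> h' \<Longrightarrow> h = h'"
  shows "is_pullback E p q f g"
proof -
  have "\<exists>!h. h \<in> hom E W P \<and> p \<cdot> h = u \<and> q \<cdot> h = v"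
    if "u \<in> hom E W X" "v \<in> hom E W Y" "f \<cdot> u = g \<cdot> v" for W u v
    using lift[OF that] unique by metis
  then show ?thesis
    using homD[OF assms(1)] homD[OF assms(2)] homD[OF assms(3)] homD[OF assms(4)] assms(5)
    by (simp add: is_pullback_def)
qed

lemma pullback_sym:
  assumes "is_pullback E p q f g"
  shows "is_pullback E q p g f"
proof (rule pullbackI[of _ "Dom E g" "Cod E f" _ "Dom E f" _ "Dom E p"])
  note pb = pullbackD[OF assms]
  show "g \<in> hom E (Dom E g) (Cod E f)" "f \<in> hom E (Dom E f) (Cod E f)"
    "q \<in> hom E (Dom E p) (Dom E g)" "p \<in> hom E (Dom E p) (Dom E f)" "g \<cdot> q = f \<cdot> p"
    using pb by (simp_all add: hom_iff)
  show "\<exists>h \<in> hom E W (Dom E p). q \<cdot> h = u \<and> p \<cdot> h = v"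
    if "u \<in> hom E W (Dom E g)" "v \<in> hom E W (Dom E f)" "g \<cdot> u = f \<cdot> v" for W u v
    using pullback_lift[OF assms, of v u] homD[OF that(1)] homD[OF that(2)] that(3) by metis
  show "h = h'" if "h \<in> hom E W (Dom E p)" "h' \<in> hom E W (Dom E p)"
    "q \<cdot> h = q \<cdot> h'" "p \<cdot> h = p \<cdot> h'" for W h h'
    using pullback_unique[OF assms, of h h'] homD[OF that(1)] homD[OF that(2)] that(3,4) by simp
qed

lemma pullback_Ident:
  assumes "f \<in> hom E X Y"
  shows "is_pullback E (Ident E X) f f (Ident E Y)"
proof (rule pullbackI[of _ X Y _ Y _ X])
  note [simp] = homD[OF assms]
  show "f \<in> hom E X Y" "Ident E Y \<in> hom E Y Y" "Ident E X \<in> hom E X X" "f \<in> hom E X Y"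
    "f \<cdot> Ident E X = Ident E Y \<cdot> f"
    by (simp_all add: hom_iff)
qed (auto simp: hom_iff)

lemma monicD:
  assumes "monic E m" "h \<in> Arr E" "h' \<in> Arr E" "Dom E h = Dom E h'"
    "Cod E h = Dom E m" "Cod E h' = Dom E m" "m \<cdot> h = m \<cdot> h'"
  shows "h = h'"
  using assms unfolding monic_def hom_def by auto

lemma pullback_monic:
  assumes "is_pullback E p q f g" "monic E g"
  shows "monic E p"
  unfolding monic_def
proof (intro conjI allI ballI impI)
  note pb = pullbackD[OF assms(1)]
  show "p \<in> Arr E" by fact
  fix W h h'
  assume h: "h \<in> hom E W (Dom E p)" and h': "h' \<in> hom E W (Dom E p)" and eq: "p \<cdot> h = p \<cdot> h'"
  note [simp] = pb(1-4) pb(6-8) pb(5)[symmetric] homD(1-3)[OF h] homD(1-3)[OF h']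
  have "g \<cdot> q \<cdot> h = g \<cdot> q \<cdot> h'"
    using comp_eq_assoc[OF pb(9), of h] comp_eq_assoc[OF pb(9), of h'] eq by simp
  then have "q \<cdot> h = q \<cdot> h'"
    by - (rule monicD[OF assms(2)]; simp_all)
  then show "h = h'"
    by - (rule pullback_unique[OF assms(1)]; (simp_all add: eq))
qed

lemma pushoutD:
  assumes "is_pushout E f g p q"
  shows "f \<in> Arr E" "g \<in> Arr E" "p \<in> Arr E" "q \<in> Arr E" "Dom E f = Dom E g"
    "Cod E f = Dom E p" "Cod E g = Dom E q" "Cod E p = Cod E q" "p \<cdot> f = q \<cdot> g"
  using assms by (auto simp: is_pushout_def)

lemma pushout_desc:
  assumes "is_pushout E f g p q" "u \<in> Arr E" "v \<in> Arr E" "Cod E u = Cod E v"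
    "Dom E u = Cod E f" "Dom E v = Cod E g" "u \<cdot> f = v \<cdot> g"
  obtains h where "h \<in> hom E (Cod E p) (Cod E u)" "h \<cdot> p = u" "h \<cdot> q = v"
proof -
  have "u \<in> hom E (Cod E f) (Cod E u)" "v \<in> hom E (Cod E g) (Cod E u)"
    using assms by (simp_all add: hom_iff)
  then show thesis
    using assms(1,7) that unfolding is_pushout_def by metis
qed

lemma pushout_unique:
  assumes "is_pushout E f g p q" "h \<in> Arr E" "h' \<in> Arr E" "Cod E h = Cod E h'"
    "Dom E h = Cod E p" "Dom E h' = Cod E p" "h \<cdot> p = h' \<cdot> p" "h \<cdot> q = h' \<cdot> q"
  shows "h = h'"
proof -
  note po = pushoutD[OF assms(1)]
  note [simp] = po(1-4) po(6-7) po(8)[symmetric] po(5) assms(2-6)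
  have "(h \<cdot> p) \<cdot> f = (h \<cdot> q) \<cdot> g"
    using po(9) by simp
  moreover have "h \<cdot> p \<in> hom E (Cod E f) (Cod E h)" "h \<cdot> q \<in> hom E (Cod E g) (Cod E h)"
    using assms(5) by (simp_all add: hom_iff)
  ultimately have "\<exists>!k. k \<in> hom E (Cod E p) (Cod E h) \<and> k \<cdot> p = h \<cdot> p \<and> k \<cdot> q = h \<cdot> q"
    using assms(1) unfolding is_pushout_def by blast
  moreover have "h \<in> hom E (Cod E p) (Cod E h)" "h' \<in> hom E (Cod E p) (Cod E h)"
    using assms by (simp_all add: hom_iff)
  ultimately show ?thesis
    using assms(7,8) by metis
qed

lemma pushoutI:
  assumes "f \<in> hom E Z X" "g \<in> hom E Z Y" "p \<in> hom E X P" "q \<in> hom E Y P" "p \<cdot> f = q \<cdot> g"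
    and desc: "\<And>W u v. u \<in> hom E X W \<Longrightarrow> v \<in> hom E Y W \<Longrightarrow> u \<cdot> f = v \<cdot> g \<Longrightarrow>
      \<exists>h \<in> hom E P W. h \<cdot> p = u \<and> h \<cdot> q = v"
    and unique: "\<And>W h h'. h \<in> hom E P W \<Longrightarrow> h' \<in> hom E P W \<Longrightarrow>
      h \<cdot> p = h' \<cdot> p \<Longrightarrow> h \<cdot> q = h' \<cdot> q \<Longrightarrow> h = h'"
  shows "is_pushout E f g p q"
proof -
  have "\<exists>!h. h \<in> hom E P W \<and> h \<cdot> p = u \<and> h \<cdot> q = v"
    if "u \<in> hom E X W" "v \<in> hom E Y W" "u \<cdot> f = v \<cdot> g" for W u v
    using desc[OF that] unique by metis
  then show ?thesis
    using homD[OF assms(1)] homD[OF assms(2)] homD[OF assms(3)] homD[OF assms(4)] assms(5)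
    by (simp add: is_pushout_def)
qed

lemma pullback_paste:
  assumes pb: "is_pullback E p q f g" and pb': "is_pullback E p' q' n p"
  shows "is_pullback E p' (q \<cdot> q') (f \<cdot> n) g"
proof -
  obtain P P' X X' Y Z where f: "f \<in> hom E X Z" and g: "g \<in> hom E Y Z" and p: "p \<in> hom E P X"
    and q: "q \<in> hom E P Y" and p': "p' \<in> hom E P' X'" and q': "q' \<in> hom E P' P"
    and n: "n \<in> hom E X' X"
    using pullbackD[OF pb] pullbackD[OF pb'] by (auto simp: hom_iff)
  note [simp] = homD[OF f] homD[OF g] homD[OF p] homD[OF q] homD[OF p'] homD[OF q'] homD[OF n]
  note eq = comp_eq_assoc[OF pullbackD(9)[OF pb]] and eq' = comp_eq_assoc[OF pullbackD(9)[OF pb']]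
  show ?thesis
  proof (rule pullbackI)
    show "f \<cdot> n \<in> hom E X' Z" "g \<in> hom E Y Z" "p' \<in> hom E P' X'" "q \<cdot> q' \<in> hom E P' Y"
      by (simp_all add: hom_iff)
    show "(f \<cdot> n) \<cdot> p' = g \<cdot> q \<cdot> q'"
      using eq[of q'] pullbackD(9)[OF pb'] by simp
  next
    fix W u v
    assume u: "u \<in> hom E W X'" and v: "v \<in> hom E W Y" and uv: "(f \<cdot> n) \<cdot> u = g \<cdot> v"
    note [simp] = homD[OF u] homD[OF v]
    obtain y where y: "y \<in> hom E W P" "p \<cdot> y = n \<cdot> u" "q \<cdot> y = v"
      using pullback_lift[OF pb, of "n \<cdot> u" v] uv by auto
    note [simp] = homD[OF y(1)]
    obtain h where h: "h \<in> hom E W P'" "p' \<cdot> h = u" "q' \<cdot> h = y"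
      using pullback_lift[OF pb', of u y] y(2) by auto
    then show "\<exists>h \<in> hom E W P'. p' \<cdot> h = u \<and> (q \<cdot> q') \<cdot> h = v"
      using y(3) homD[OF h(1)] by auto
  next
    fix W h h'
    assume h: "h \<in> hom E W P'" "h' \<in> hom E W P'"
      and ph: "p' \<cdot> h = p' \<cdot> h'" and qh: "(q \<cdot> q') \<cdot> h = (q \<cdot> q') \<cdot> h'"
    note [simp] = homD[OF h(1)] homD[OF h(2)]
    have "p \<cdot> q' \<cdot> h = p \<cdot> q' \<cdot> h'"
      using eq'[of h] eq'[of h'] ph by simp
    moreover have "q \<cdot> q' \<cdot> h = q \<cdot> q' \<cdot> h'"
      using qh by simp
    ultimately have "q' \<cdot> h = q' \<cdot> h'"
      using pullback_unique[OF pb, of "q' \<cdot> h" "q' \<cdot> h'"] by simp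
    then show "h = h'"
      using pullback_unique[OF pb', of h h'] ph by simp
  qed
qed

lemma monic_pullback_self:
  assumes x: "monic E x" "x \<in> hom E X Y" and f: "f \<in> hom E W X"
  shows "is_pullback E (Ident E W) f (x \<cdot> f) x"
proof (rule pullbackI)
  note [simp] = homD[OF x(2)] homD[OF f]
  show "x \<cdot> f \<in> hom E W Y" "x \<in> hom E X Y" "Ident E W \<in> hom E W W" "f \<in> hom E W X"
    "(x \<cdot> f) \<cdot> Ident E W = x \<cdot> f"
    using x f by (simp_all add: hom_iff)
next
  note [simp] = homD[OF x(2)] homD[OF f]
  fix V u v
  assume u: "u \<in> hom E V W" and v: "v \<in> hom E V X" and uv: "(x \<cdot> f) \<cdot> u = x \<cdot> v"
  note [simp] = homD[OF u] homD[OF v]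
  have "f \<cdot> u = v"
    using monicD[OF x(1), of "f \<cdot> u" v] uv by simp
  then show "\<exists>h \<in> hom E V W. Ident E W \<cdot> h = u \<and> f \<cdot> h = v"
    using u by (intro bexI[of _ u]) simp_all
next
  fix V h h'
  assume h: "h \<in> hom E V W" "h' \<in> hom E V W" "Ident E W \<cdot> h = Ident E W \<cdot> h'"
  then show "h = h'"
    using homD[OF h(1)] homD[OF h(2)] by simp
qed

text \<open>
  The pullback of \<open>b\<close> along \<open>x\<close> depends only on \<open>q \<circ> b\<close>, because \<open>x\<close> is itself a pullback along \<open>q\<close>.
  A homotopy within the fibres of \<open>q\<close> thus does not change the part of its domain that lies in \<open>x\<close>.
\<close>

lemma pullback_change_fibre:
  assumes x: "monic E x" and pbx: "is_pullback E x p q m" and pbi: "is_pullback E i c b x"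
    and y: "y \<in> hom E (Dom E b) (Cod E b)" "q \<cdot> y = q \<cdot> b"
    and c': "c' \<in> hom E (Dom E i) (Dom E x)" "y \<cdot> i = x \<cdot> c'"
  shows "is_pullback E i c' y x"
proof -
  obtain X Y A B D D' where x': "x \<in> hom E X Y" and p: "p \<in> hom E X A" and q: "q \<in> hom E Y B"
    and m: "m \<in> hom E A B" and i: "i \<in> hom E D' D" and c: "c \<in> hom E D' X" and b: "b \<in> hom E D Y"
    using pullbackD[OF pbx] pullbackD[OF pbi] by (auto simp: hom_iff)
  note [simp] = homD[OF x'] homD[OF p] homD[OF q] homD[OF m] homD[OF i] homD[OF c] homD[OF b]
  have y': "y \<in> hom E D Y" and c'': "c' \<in> hom E D' X"
    using y c' by simp_all
  note [simp] = homD[OF y'] homD[OF c'']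
  show ?thesis
  proof (rule pullbackI[OF y' x' i c'' c'(2)])
    fix W u v
    assume u: "u \<in> hom E W D" and v: "v \<in> hom E W X" and uv: "y \<cdot> u = x \<cdot> v"
    note [simp] = homD[OF u] homD[OF v]
    have "q \<cdot> b \<cdot> u = q \<cdot> x \<cdot> v"
      using comp_eq_assoc[OF y(2), of u] uv by simp
    also have "\<dots> = m \<cdot> p \<cdot> v"
      using comp_eq_assoc[OF pullbackD(9)[OF pbx], of v] by simp
    finally obtain z where z: "z \<in> hom E W X" "x \<cdot> z = b \<cdot> u"
      using pullback_lift[OF pbx, of "b \<cdot> u" "p \<cdot> v"] by auto
    note [simp] = homD[OF z(1)]
    obtain h where h: "h \<in> hom E W D'" "i \<cdot> h = u"
      using pullback_lift[OF pbi, of u z] z(2) by auto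
    note [simp] = homD[OF h(1)]
    have "x \<cdot> c' \<cdot> h = x \<cdot> v"
      using comp_eq_assoc[OF c'(2), of h] h(2) uv by simp
    then have "c' \<cdot> h = v"
      using monicD[OF x, of "c' \<cdot> h" v] by simp
    then show "\<exists>h \<in> hom E W D'. i \<cdot> h = u \<and> c' \<cdot> h = v"
      using h by blast
  next
    fix W h h'
    assume h: "h \<in> hom E W D'" "h' \<in> hom E W D'" "i \<cdot> h = i \<cdot> h'"
    then show "h = h'"
      using monicD[OF pullback_monic[OF pbi x], of h h'] homD[OF h(1)] homD[OF h(2)] by simp
  qed
qed

text \<open>
  Adhesiveness speaks about all pullbacks of \<open>m\<close>; here it is used for \<open>m\<close> as a pullback of itself.
\<close>

lemma adhesive_pushout:
  assumes "adhesive E m" "is_pushout E m f g n"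
  shows "stable_pushout E m f g n" "is_pullback E m f g n"
proof -
  have "is_pullback E (Ident E (Dom E m)) m m (Ident E (Cod E m))"
    using pushoutD[OF assms(2)] by (intro pullback_Ident homI)
  then have "stable_pushout E m f g n \<and> is_pullback E m f g n"
    using assms unfolding adhesive_def by blast
  then show "stable_pushout E m f g n" "is_pullback E m f g n" by simp_all
qed

end


section \<open>Existence of limits and colimits in a suitable category\<close>

locale suitable_E = category_E E
  for E :: "('o, 'a) cat" +
  fixes \<kappa> :: "'u rel"
  assumes inaccessible: "inaccessible \<kappa>"
    and suitable: "suitable_category \<kappa> E"
begin

lemma slice_cartesian_closed: "X \<in> Obj E \<Longrightarrow> cartesian_closed (slice E X)"
  using suitable by (simp add: suitable_category_def locally_cartesian_closed_def)

lemma hom_slice: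
  "(p, f, q) \<in> hom (slice E X) p' q' \<longleftrightarrow>
     p = p' \<and> q = q' \<and> p \<in> Arr E \<and> q \<in> Arr E \<and> Cod E p = X \<and> Cod E q = X \<and>
     f \<in> hom E (Dom E p) (Dom E q) \<and> q \<cdot> f = p"
  by (auto simp: hom_def slice_def)

lemma comp_slice: "(q, g, r) \<odot>\<^bsub>slice E X\<^esub> (p, f, q') = (p, g \<cdot> f, r)"
  by (simp add: slice_def)

lemma Obj_slice: "p \<in> Obj (slice E X) \<longleftrightarrow> p \<in> Arr E \<and> Cod E p = X"
  by (simp add: slice_def)

lemma slice_arrE:
  assumes "t \<in> hom (slice E X) p q"
  obtains f where "t = (p, f, q)" "p \<in> hom E (Dom E p) X" "q \<in> hom E (Dom E q) X"
    "f \<in> hom E (Dom E p) (Dom E q)" "q \<cdot> f = p"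
  using assms by (cases t) (auto simp: hom_slice hom_iff)

text \<open>
  Local cartesian closedness is a statement about slices; this lemma and its converse below turn
  the products found there into pullbacks.
\<close>

lemma pullback_of_slice_product:
  assumes "is_product (slice E X) d \<pi> \<rho> f g"
  obtains p q where "\<pi> = (d, p, f)" "\<rho> = (d, q, g)" "is_pullback E p q f g" "d = f \<cdot> p"
proof -
  have "\<pi> \<in> hom (slice E X) d f" "\<rho> \<in> hom (slice E X) d g"
    using assms by (auto simp: is_product_def)
  then obtain p q where pi: "\<pi> = (d, p, f)" and rho: "\<rho> = (d, q, g)"
    and f: "f \<in> hom E (Dom E f) X" and g: "g \<in> hom E (Dom E g) X"
    and d: "d \<in> hom E (Dom E d) X"
    and p: "p \<in> hom E (Dom E d) (Dom E f)" and q: "q \<in> hom E (Dom E d) (Dom E g)"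
    and eq: "f \<cdot> p = d" "g \<cdot> q = d"
    by (elim slice_arrE) blast
  have univ: "\<exists>!h. h \<in> hom (slice E X) t d \<and> \<pi> \<odot>\<^bsub>slice E X\<^esub> h = (t, u, f)
      \<and> \<rho> \<odot>\<^bsub>slice E X\<^esub> h = (t, v, g)"
    if "(t, u, f) \<in> hom (slice E X) t f" "(t, v, g) \<in> hom (slice E X) t g" for t u v
    using assms that unfolding is_product_def by blast
  have "is_pullback E p q f g"
  proof (rule pullbackI[OF f g p q])
    show "f \<cdot> p = g \<cdot> q" using eq by simp
  next
    fix W u v
    assume u: "u \<in> hom E W (Dom E f)" and v: "v \<in> hom E W (Dom E g)" and uv: "f \<cdot> u = g \<cdot> v"
    let ?t = "f \<cdot> u"
    have "(?t, u, f) \<in> hom (slice E X) ?t f" "(?t, v, g) \<in> hom (slice E X) ?t g"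
      using u v uv f g by (auto simp: hom_slice hom_iff)
    from univ[OF this] obtain h where h: "h \<in> hom (slice E X) ?t d"
      "\<pi> \<odot>\<^bsub>slice E X\<^esub> h = (?t, u, f)" "\<rho> \<odot>\<^bsub>slice E X\<^esub> h = (?t, v, g)"
      by blast
    from h(1) obtain k where k: "h = (?t, k, d)" "k \<in> hom E (Dom E ?t) (Dom E d)"
      by (rule slice_arrE)
    have "Dom E ?t = W" using u f by (simp add: hom_iff)
    then show "\<exists>h \<in> hom E W (Dom E d). p \<cdot> h = u \<and> q \<cdot> h = v"
      using h(2,3) k by (auto simp: pi rho comp_slice)
  next
    fix W h h'
    assume h: "h \<in> hom E W (Dom E d)" and h': "h' \<in> hom E W (Dom E d)"
      and ph: "p \<cdot> h = p \<cdot> h'" and qh: "q \<cdot> h = q \<cdot> h'"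
    note [simp] = homD(1,3)[OF f] homD(1,3)[OF g] homD(1,3)[OF d] homD(1-3)[OF p] homD(1-3)[OF q]
      homD(1-3)[OF h] homD(1-3)[OF h']
    let ?t = "d \<cdot> h"
    have t: "f \<cdot> p \<cdot> h = ?t" "g \<cdot> q \<cdot> h = ?t"
      by (simp_all add: comp_eq_assoc[OF eq(1)] comp_eq_assoc[OF eq(2)])
    have t': "d \<cdot> h' = ?t"
      using t(1) comp_eq_assoc[OF eq(1), of h'] by (simp add: ph)
    have "(?t, p \<cdot> h, f) \<in> hom (slice E X) ?t f" "(?t, q \<cdot> h, g) \<in> hom (slice E X) ?t g"
      using t by (auto simp: hom_slice hom_iff)
    then obtain k where k: "y = k" if "y \<in> hom (slice E X) ?t d"
      "\<pi> \<odot>\<^bsub>slice E X\<^esub> y = (?t, p \<cdot> h, f)" "\<rho> \<odot>\<^bsub>slice E X\<^esub> y = (?t, q \<cdot> h, g)" for y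
      using univ by metis
    have "(?t, h, d) = k" "(?t, h', d) = k"
      using t t' ph qh by (intro k; simp add: hom_slice hom_iff pi rho comp_slice)+
    then show "h = h'" by auto
  qed
  then show thesis using that pi rho eq by blast
qed

lemma slice_product_of_pullback:
  assumes "is_pullback E p q f g" "Cod E f = X"
  shows "is_product (slice E X) (f \<cdot> p) (f \<cdot> p, p, f) (f \<cdot> p, q, g) f g"
proof -
  note pb = pullbackD[OF assms(1)]
  note [simp] = pb(1-4) pb(6-7) pb(5)[symmetric] pb(8)[symmetric] assms(2)
  have "\<exists>!h. h \<in> hom (slice E X) t (f \<cdot> p) \<and> (f \<cdot> p, p, f) \<odot>\<^bsub>slice E X\<^esub> h = u \<and>
      (f \<cdot> p, q, g) \<odot>\<^bsub>slice E X\<^esub> h = v"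
    if u: "u \<in> hom (slice E X) t f" and v: "v \<in> hom (slice E X) t g" for t u v
  proof -
    from u obtain a where a: "u = (t, a, f)" "t \<in> hom E (Dom E t) X"
      "a \<in> hom E (Dom E t) (Dom E f)" "f \<cdot> a = t"
      by (rule slice_arrE)
    from v obtain b where b: "v = (t, b, g)" "b \<in> hom E (Dom E t) (Dom E g)" "g \<cdot> b = t"
      by (rule slice_arrE)
    note [simp] = homD(1,3)[OF a(2)] homD(1-3)[OF a(3)] homD(1-3)[OF b(2)]
    obtain h where h: "h \<in> hom E (Dom E t) (Dom E p)" "p \<cdot> h = a" "q \<cdot> h = b"
      using pullback_lift[OF assms(1), of a b] a b by auto
    note [simp] = homD[OF h(1)]
    show ?thesis
    proof (rule ex1I[of _ "(t, h, f \<cdot> p)"])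
      show "(t, h, f \<cdot> p) \<in> hom (slice E X) t (f \<cdot> p) \<and>
        (f \<cdot> p, p, f) \<odot>\<^bsub>slice E X\<^esub> (t, h, f \<cdot> p) = u \<and>
        (f \<cdot> p, q, g) \<odot>\<^bsub>slice E X\<^esub> (t, h, f \<cdot> p) = v"
        using h a b by (simp add: hom_slice comp_slice hom_iff)
    next
      fix k
      assume k: "k \<in> hom (slice E X) t (f \<cdot> p) \<and> (f \<cdot> p, p, f) \<odot>\<^bsub>slice E X\<^esub> k = u \<and>
        (f \<cdot> p, q, g) \<odot>\<^bsub>slice E X\<^esub> k = v"
      then obtain j where j: "k = (t, j, f \<cdot> p)" "j \<in> hom E (Dom E t) (Dom E (f \<cdot> p))"
        by (blast elim: slice_arrE)
      note [simp] = homD(1-3)[OF j(2)]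
      have "p \<cdot> j = a" "q \<cdot> j = b"
        using k a(1) b(1) by (simp_all add: j(1) comp_slice)
      then have "j = h"
        using h(2,3) by - (rule pullback_unique[OF assms(1)]; simp_all)
      then show "k = (t, h, f \<cdot> p)" using j by simp
    qed
  qed
  moreover have "f \<cdot> p \<in> Obj (slice E X)" "(f \<cdot> p, p, f) \<in> hom (slice E X) (f \<cdot> p) f"
    "(f \<cdot> p, q, g) \<in> hom (slice E X) (f \<cdot> p) g"
    using pb(9) by (simp_all add: Obj_slice hom_slice hom_iff)
  ultimately show ?thesis
    by (simp add: is_product_def)
qed

lemma pullback_exists:
  assumes "f \<in> hom E X Z" "g \<in> hom E Y Z"
  obtains P p q where "p \<in> hom E P X" "q \<in> hom E P Y" "f \<cdot> p = g \<cdot> q" "is_pullback E p q f g"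
proof -
  have "f \<in> Obj (slice E Z)" "g \<in> Obj (slice E Z)"
    using assms by (simp_all add: Obj_slice hom_iff)
  then obtain d \<pi> \<rho> where "is_product (slice E Z) d \<pi> \<rho> f g"
    using slice_cartesian_closed[of Z] homD[OF assms(1)] unfolding cartesian_closed_def by blast
  then obtain p q where pb: "is_pullback E p q f g"
    by (rule pullback_of_slice_product)
  show thesis
    by (rule pullback_homs[OF pb assms]) (rule that[OF _ _ _ pb])
qed

text \<open>
  Cocompleteness is about diagrams indexed by categories with arrows in the type of the cardinal;
  finite index categories can be encoded there because that type is infinite.
\<close>

lemma infinite_index_type: "infinite (UNIV :: 'u set)"
proof
  assume "finite (UNIV :: 'u set)"
  then have "finite (Field \<kappa>)" by (rule finite_subset[rotated]) simp
  then have "|Field \<kappa>| <o natLeq" by (simp add: finite_iff_ordLess_natLeq)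
  moreover have "natLeq <o \<kappa>" "|Field \<kappa>| =o \<kappa>"
    using inaccessible by (auto simp: inaccessible_def card_of_Field_ordIso)
  ultimately show False
    by (metis ordIso_ordLess_trans ordIso_symmetric ordLess_irreflexive ordLess_transitive)
qed

lemma finite_small:
  fixes S :: "'u set"
  assumes "finite S"
  shows "small \<kappa> S"
  using assms inaccessible
  by (metis finite_iff_ordLess_natLeq inaccessible_def ordLess_transitive)

end

text \<open>
  The span category \<open>l \<leftarrow> x \<rightarrow> r\<close>. Its objects double as their identity arrows, and of two
  composable arrows at least one is an identity, which explains the composition.
\<close>

definition span_cat :: "'u \<Rightarrow> 'u \<Rightarrow> 'u \<Rightarrow> 'u \<Rightarrow> 'u \<Rightarrow> ('u, 'u) cat" where
  "span_cat x l r a b =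
     \<lparr>Obj = {x, l, r}, Arr = {x, l, r, a, b},
      Dom = (\<lambda>z. if z = a \<or> z = b then x else z),
      Cod = (\<lambda>z. if z = a then l else if z = b then r else z),
      Ident = (\<lambda>z. z), Comp = (\<lambda>g f. if f = a \<or> f = b then f else g)\<rparr>"

lemma hom_span_cat:
  assumes "distinct [x, l, r, a, b]"
  shows "z \<in> hom (span_cat x l r a b) i k \<longleftrightarrow>
     (z = x \<and> i = x \<and> k = x) \<or> (z = l \<and> i = l \<and> k = l) \<or> (z = r \<and> i = r \<and> k = r) \<or>
     (z = a \<and> i = x \<and> k = l) \<or> (z = b \<and> i = x \<and> k = r)"
  using assms by (auto simp: hom_def span_cat_def)

lemma category_span_cat:
  assumes "distinct [x, l, r, a, b]"
  shows "category (span_cat x l r a b)"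
proof -
  have [simp]: "Obj (span_cat x l r a b) = {x, l, r}" "Arr (span_cat x l r a b) = {x, l, r, a, b}"
    "Ident (span_cat x l r a b) i = i"
    "g \<odot>\<^bsub>span_cat x l r a b\<^esub> f = (if f = a \<or> f = b then f else g)"
    "Dom (span_cat x l r a b) f = (if f = a \<or> f = b then x else f)"
    "Cod (span_cat x l r a b) f = (if f = a then l else if f = b then r else f)" for i f g
    by (simp_all add: span_cat_def)
  have ne: "x \<noteq> l" "x \<noteq> r" "x \<noteq> a" "x \<noteq> b" "l \<noteq> x" "l \<noteq> r" "l \<noteq> a" "l \<noteq> b"
    "r \<noteq> x" "r \<noteq> l" "r \<noteq> a" "r \<noteq> b" "a \<noteq> b" "b \<noteq> a" "a \<noteq> x" "a \<noteq> l" "a \<noteq> r" "b \<noteq> x" "b \<noteq> l" "b \<noteq> r"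
    using assms by auto
  show ?thesis
    unfolding category_def
  proof (intro conjI allI ballI)
    fix i k j f g
    assume "f \<in> hom (span_cat x l r a b) i k" "g \<in> hom (span_cat x l r a b) k j"
    then show "g \<odot>\<^bsub>span_cat x l r a b\<^esub> f \<in> hom (span_cat x l r a b) i j"
      unfolding hom_span_cat[OF assms] by (elim disjE) (simp_all add: ne)
  qed (use ne in \<open>auto simp: hom_span_cat[OF assms]\<close>)
qed

context suitable_E
begin

lemma pushout_exists:
  assumes f: "f \<in> hom E Z X" and g: "g \<in> hom E Z Y"
  obtains P p q where "p \<in> hom E X P" "q \<in> hom E Y P" "p \<cdot> f = q \<cdot> g" "is_pushout E f g p q"
proof -
  note [simp] = homD[OF f] homD[OF g]
  obtain S :: "'u set" where S: "finite S" "card S = 5"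
    using infinite_arbitrarily_large[OF infinite_index_type] by blast
  obtain xs where xs: "set xs = S" "distinct xs"
    using finite_distinct_list[OF S(1)] by blast
  have "length xs = Suc (Suc (Suc (Suc (Suc 0))))"
    using distinct_card[OF xs(2)] xs(1) S(2) by simp
  then obtain x l r a b :: 'u where "xs = [x, l, r, a, b]"
    unfolding length_Suc_conv length_0_conv by blast
  with xs(2) have dist: "distinct [x, l, r, a, b]"
    by simp
  define J where "J = span_cat x l r a b"
  define D where "D = \<lparr>on_obj = (\<lambda>i. if i = l then X else if i = r then Y else Z),
    on_arr = (\<lambda>z. if z = a then f else if z = b then g else
      Ident E (if z = l then X else if z = r then Y else Z))\<rparr>"
  have homJ: "z \<in> hom J i k \<longleftrightarrow>
     (z = x \<and> i = x \<and> k = x) \<or> (z = l \<and> i = l \<and> k = l) \<or> (z = r \<and> i = r \<and> k = r) \<or>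
     (z = a \<and> i = x \<and> k = l) \<or> (z = b \<and> i = x \<and> k = r)" for z i k
    unfolding J_def by (rule hom_span_cat[OF dist])
  have ObjJ: "Obj J = {x, l, r}" and ArrJ: "Arr J = {x, l, r, a, b}"
    and IdJ: "Ident J i = i" and CompJ: "u \<odot>\<^bsub>J\<^esub> v = (if v = a \<or> v = b then v else u)" for i u v
    by (simp_all add: J_def span_cat_def)
  have Do: "on_obj D x = Z" "on_obj D l = X" "on_obj D r = Y"
    and Da: "on_arr D a = f" "on_arr D b = g" "on_arr D x = Ident E Z" "on_arr D l = Ident E X"
    "on_arr D r = Ident E Y"
    using dist by (auto simp: D_def)
  have catJ: "category J"
    unfolding J_def by (rule category_span_cat[OF dist])
  have fD: "is_functor J E D"
    unfolding is_functor_def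
  proof (intro conjI allI ballI)
    fix i j k u v
    assume "u \<in> hom J i j" "v \<in> hom J j k"
    then show "on_arr D (v \<odot>\<^bsub>J\<^esub> u) = on_arr D v \<cdot> on_arr D u"
      unfolding homJ using dist by (elim disjE) (auto simp: CompJ Da)
  qed (auto simp: catJ category_E ObjJ IdJ Do Da hom_iff homJ)
  have "small_category \<kappa> J"
    using catJ by (simp add: small_category_def ObjJ ArrJ finite_small)
  moreover have "cocomplete \<kappa> E"
    using suitable by (simp add: suitable_category_def locally_presentable_def)
  ultimately obtain P c where colim: "is_colimit J E D P c"
    using fD unfolding cocomplete_def by blast
  have cocone_iff: "is_cocone J E D W c' \<longleftrightarrow> W \<in> Obj E \<and> c' x \<in> hom E Z W \<and> c' l \<in> hom E X W \<and>
      c' r \<in> hom E Y W \<and> c' l \<cdot> f = c' x \<and> c' r \<cdot> g = c' x" for W c'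
  proof -
    have "(\<forall>i k. \<forall>z \<in> hom J i k. c' k \<cdot> on_arr D z = c' i) \<longleftrightarrow>
        c' l \<cdot> f = c' x \<and> c' r \<cdot> g = c' x"
      if "c' x \<in> hom E Z W" "c' l \<in> hom E X W" "c' r \<in> hom E Y W"
    proof (intro iffI conjI allI ballI)
      assume *: "\<forall>i k. \<forall>z \<in> hom J i k. c' k \<cdot> on_arr D z = c' i"
      have "a \<in> hom J x l" "b \<in> hom J x r" by (simp_all add: homJ)
      with * show "c' l \<cdot> f = c' x" "c' r \<cdot> g = c' x"
        unfolding Da[symmetric] by blast+
    next
      fix i k z
      assume "c' l \<cdot> f = c' x \<and> c' r \<cdot> g = c' x" "z \<in> hom J i k"
      then show "c' k \<cdot> on_arr D z = c' i"
        unfolding homJ using homD(1-3)[OF that(1)] homD(1-3)[OF that(2)] homD(1-3)[OF that(3)]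
        by (elim disjE) (simp_all add: Da)
    qed
    then show ?thesis
      unfolding is_cocone_def using fD by (auto simp: ObjJ Do)
  qed
  have c: "c x \<in> hom E Z P" "c l \<in> hom E X P" "c r \<in> hom E Y P" "c l \<cdot> f = c x" "c r \<cdot> g = c x"
    using colim by (auto simp: is_colimit_def cocone_iff)
  have univ: "\<exists>!h. h \<in> hom E P W \<and> h \<cdot> c l = u \<and> h \<cdot> c r = v"
    if u: "u \<in> hom E X W" and v: "v \<in> hom E Y W" and uv: "u \<cdot> f = v \<cdot> g" for W u v
  proof -
    define c' where "c' = (\<lambda>i. if i = l then u else if i = r then v else u \<cdot> f)"
    have c': "c' x = u \<cdot> f" "c' l = u" "c' r = v"
      using dist by (auto simp: c'_def)
    have "is_cocone J E D W c'"
      using u v uv by (simp add: cocone_iff c' hom_iff) (auto simp: hom_iff)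
    then have "\<exists>!h. h \<in> hom E P W \<and> (\<forall>i \<in> Obj J. h \<cdot> c i = c' i)"
      using colim by (simp add: is_colimit_def)
    moreover have "(\<forall>i \<in> Obj J. h \<cdot> c i = c' i) \<longleftrightarrow> h \<cdot> c l = u \<and> h \<cdot> c r = v"
      if h: "h \<in> hom E P W" for h
    proof -
      have "h \<cdot> c x = (h \<cdot> c l) \<cdot> f"
        using homD(1-3)[OF h] homD(1-3)[OF c(2)] by (simp add: c(4))
      then show ?thesis
        by (auto simp: ObjJ c')
    qed
    ultimately show ?thesis by (simp cong: conj_cong)
  qed
  have "is_pushout E f g (c l) (c r)"
    using c(4,5) homD[OF c(2)] homD[OF c(3)] univ by (simp add: is_pushout_def)
  with c show thesis by (intro that) auto
qed


end


section \<open>Pushforward along a monomorphism\<close>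

context suitable_E
begin

text \<open>
  The pushforward of \<open>f\<close> along \<open>x\<close> is the exponential of \<open>x \<circ> f\<close> by \<open>x\<close> in the slice over \<open>Y1\<close>:
  since \<open>x\<close> is subterminal there, an arrow from \<open>D' = D \<times>\<^bsub>Y1\<^esub> X1\<close> to \<open>x \<circ> f\<close> over \<open>Y1\<close> is the same as
  a factorization through \<open>f\<close> of the projection \<open>D' \<rightarrow> X1\<close>. The last two clauses are the existence
  and uniqueness of transposes, phrased without reference to evaluation.
\<close>

lemma pushforward_along_monic:
  assumes x: "monic E x" "x \<in> hom E X1 Y1" and f: "f \<in> hom E X0 X1"
  obtains Y0 g x0 where "g \<in> hom E Y0 Y1" "x0 \<in> hom E X0 Y0" "is_pullback E x0 f g x"
    and "\<And>D D' i c y a. y \<in> hom E D Y1 \<Longrightarrow> is_pullback E i c y x \<Longrightarrow> i \<in> hom E D' D \<Longrightarrow>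
      a \<in> hom E D' X0 \<Longrightarrow> f \<cdot> a = c \<Longrightarrow> \<exists>h \<in> hom E D Y0. g \<cdot> h = y \<and> h \<cdot> i = x0 \<cdot> a"
    and "\<And>D i c h h'. h \<in> hom E D Y0 \<Longrightarrow> h' \<in> hom E D Y0 \<Longrightarrow> g \<cdot> h = g \<cdot> h' \<Longrightarrow>
      is_pullback E i c (g \<cdot> h) x \<Longrightarrow> h \<cdot> i = h' \<cdot> i \<Longrightarrow> h = h'"
proof -
  note [simp] = homD[OF x(2)] homD[OF f]
  let ?S = "slice E Y1"
  have cc: "cartesian_closed ?S"
    by (rule slice_cartesian_closed) simp
  have "x \<in> Obj ?S" "x \<cdot> f \<in> Obj ?S"
    by (simp_all add: Obj_slice)
  then obtain g P \<pi> \<rho> ev where ex: "is_exponential ?S g P \<pi> \<rho> ev x (x \<cdot> f)"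
    using cc unfolding cartesian_closed_def by blast
  then have "is_product ?S P \<pi> \<rho> g x"
    by (simp add: is_exponential_def)
  then obtain p q where \<pi>: "\<pi> = (P, p, g)" and \<rho>: "\<rho> = (P, q, x)" and pb: "is_pullback E p q g x"
    and P: "P = g \<cdot> p"
    by (rule pullback_of_slice_product)
  have "ev \<in> hom ?S P (x \<cdot> f)"
    using ex by (simp add: is_exponential_def)
  then obtain e where ev: "ev = (P, e, x \<cdot> f)" and e': "e \<in> hom E (Dom E P) (Dom E (x \<cdot> f))"
    and xfe: "(x \<cdot> f) \<cdot> e = P"
    by (rule slice_arrE)
  obtain Y0 K where g: "g \<in> hom E Y0 Y1" and p: "p \<in> hom E K Y0" and q: "q \<in> hom E K X1"
    and gp: "g \<cdot> p = x \<cdot> q"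
    using pullbackD[OF pb] by (auto simp: hom_iff)
  note [simp] = homD[OF g] homD[OF p] homD[OF q]
  have e: "e \<in> hom E K X0"
    using e' by (simp add: P)
  note [simp] = homD[OF e]
  have fe: "f \<cdot> e = q"
    using monicD[OF x(1), of "f \<cdot> e" q] xfe gp P by simp
  \<comment> \<open>The exponential transposition, spelled out in the underlying category.\<close>
  have transpose: "\<exists>!h. h \<in> hom E D Y0 \<and> g \<cdot> h = y \<and>
      (\<exists>u \<in> hom E D' K. p \<cdot> u = h \<cdot> i \<and> q \<cdot> u = c \<and> e \<cdot> u = a)"
    if y: "y \<in> hom E D Y1" and pbi: "is_pullback E i c y x" and i: "i \<in> hom E D' D"
      and a: "a \<in> hom E D' X0" and fa: "f \<cdot> a = c" for D D' i c y a
  proof -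
    note [simp] = homD[OF y] homD[OF i] homD[OF a]
    have c: "c \<in> hom E D' X1" using pullbackD[OF pbi] by (simp add: hom_iff)
    note [simp] = homD[OF c]
    let ?Q = "y \<cdot> i"
    have "is_product ?S ?Q (?Q, i, y) (?Q, c, x) y x"
      by (rule slice_product_of_pullback[OF pbi]) simp
    moreover have "(?Q, a, x \<cdot> f) \<in> hom ?S ?Q (x \<cdot> f)"
      using pullbackD(9)[OF pbi] fa by (simp add: hom_slice hom_iff)
    ultimately have uni: "\<exists>!k. k \<in> hom ?S y g \<and> (\<exists>u \<in> hom ?S ?Q P.
        \<pi> \<odot>\<^bsub>?S\<^esub> u = k \<odot>\<^bsub>?S\<^esub> (?Q, i, y) \<and> \<rho> \<odot>\<^bsub>?S\<^esub> u = (?Q, c, x) \<and> ev \<odot>\<^bsub>?S\<^esub> u = (?Q, a, x \<cdot> f))"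
        (is "\<exists>!k. ?name k")
      using ex unfolding is_exponential_def by blast
    define mediates where "mediates k \<longleftrightarrow> ?name k" for k
    note uni = uni[folded mediates_def]
    have iff: "mediates (y, h, g) \<longleftrightarrow> h \<in> hom E D Y0 \<and> g \<cdot> h = y \<and>
      (\<exists>u \<in> hom E D' K. p \<cdot> u = h \<cdot> i \<and> q \<cdot> u = c \<and> e \<cdot> u = a)" (is "?L \<longleftrightarrow> ?R") for h
    proof
      assume ?L
      then obtain u where h: "h \<in> hom E D Y0" "g \<cdot> h = y" and "u \<in> hom ?S ?Q P"
        and u: "\<pi> \<odot>\<^bsub>?S\<^esub> u = (y, h, g) \<odot>\<^bsub>?S\<^esub> (?Q, i, y)" "\<rho> \<odot>\<^bsub>?S\<^esub> u = (?Q, c, x)"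
          "ev \<odot>\<^bsub>?S\<^esub> u = (?Q, a, x \<cdot> f)"
        by (auto simp: mediates_def hom_slice)
      then obtain u' where "u = (?Q, u', P)" "u' \<in> hom E (Dom E ?Q) (Dom E P)"
        by (blast elim: slice_arrE)
      then show ?R
        using h u by (auto simp: \<pi> \<rho> ev comp_slice P)
    next
      assume ?R
      then obtain u where h: "h \<in> hom E D Y0" "g \<cdot> h = y" and u: "u \<in> hom E D' K"
        and eq: "p \<cdot> u = h \<cdot> i" "q \<cdot> u = c" "e \<cdot> u = a"
        by blast
      note [simp] = homD[OF h(1)] homD[OF u]
      have "(?Q, u, P) \<in> hom ?S ?Q P"
        using comp_eq_assoc[OF h(2), of i] eq(1) by (simp add: P hom_slice hom_iff)
      moreover have "(y, h, g) \<in> hom ?S y g"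
        using h by (simp add: hom_slice hom_iff)
      ultimately show ?L
        unfolding mediates_def
        using eq by (intro conjI bexI[of _ "(?Q, u, P)"]) (simp_all add: \<pi> \<rho> ev comp_slice)
    qed
    from uni obtain k where k: "mediates k" and k_unique: "\<And>k'. mediates k' \<Longrightarrow> k' = k"
      by blast
    from k have "k \<in> hom ?S y g"
      by (simp add: mediates_def)
    then obtain h where h: "k = (y, h, g)"
      by (rule slice_arrE)
    show ?thesis
    proof (rule ex1I[of _ h])
      show "h \<in> hom E D Y0 \<and> g \<cdot> h = y \<and> (\<exists>u \<in> hom E D' K. p \<cdot> u = h \<cdot> i \<and> q \<cdot> u = c \<and> e \<cdot> u = a)"
        using k unfolding h iff .
    next
      fix h'
      assume "h' \<in> hom E D Y0 \<and> g \<cdot> h' = y \<and>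
        (\<exists>u \<in> hom E D' K. p \<cdot> u = h' \<cdot> i \<and> q \<cdot> u = c \<and> e \<cdot> u = a)"
      then have "mediates (y, h', g)"
        by (simp only: iff)
      from k_unique[OF this] show "h' = h"
        by (simp add: h)
    qed
  qed
  have self: "is_pullback E (Ident E X0) f (x \<cdot> f) x"
    by (rule monic_pullback_self[OF x f])
  have xf: "x \<cdot> f \<in> hom E X0 Y1" and idX: "Ident E X0 \<in> hom E X0 X0"
    and fid: "f \<cdot> Ident E X0 = f"
    by (simp_all add: hom_iff)
  obtain x0 u0 where x0: "x0 \<in> hom E X0 Y0" "g \<cdot> x0 = x \<cdot> f" and u0: "u0 \<in> hom E X0 K"
    and pu0': "p \<cdot> u0 = x0 \<cdot> Ident E X0" and qu0: "q \<cdot> u0 = f" and eu0: "e \<cdot> u0 = Ident E X0"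
    using transpose[OF xf self idX idX fid] by blast
  note [simp] = homD[OF x0(1)] homD[OF u0]
  have pu0: "p \<cdot> u0 = x0"
    using pu0' by simp
  \<comment> \<open>Evaluation identifies the restriction of the exponential along the monomorphism with \<open>X0\<close>.\<close>
  have x0e: "x0 \<cdot> e = p"
  proof -
    have pbq: "is_pullback E (Ident E K) q (x \<cdot> q) x"
      by (rule monic_pullback_self[OF x q])
    have xq: "x \<cdot> q \<in> hom E K Y1" and idK: "Ident E K \<in> hom E K K"
      by (simp_all add: hom_iff)
    have "g \<cdot> x0 \<cdot> e = x \<cdot> q"
      using comp_eq_assoc[OF x0(2), of e] fe by simp
    moreover have "p \<cdot> u0 \<cdot> e = x0 \<cdot> e" "q \<cdot> u0 \<cdot> e = q" "e \<cdot> u0 \<cdot> e = e"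
      using comp_eq_assoc[OF pu0, of e] comp_eq_assoc[OF qu0, of e] comp_eq_assoc[OF eu0, of e] fe
      by simp_all
    ultimately have "x0 \<cdot> e \<in> hom E K Y0 \<and> g \<cdot> x0 \<cdot> e = x \<cdot> q \<and> (\<exists>u \<in> hom E K K.
        p \<cdot> u = (x0 \<cdot> e) \<cdot> Ident E K \<and> q \<cdot> u = q \<and> e \<cdot> u = e)"
      by (intro conjI bexI[of _ "u0 \<cdot> e"]) (simp_all add: hom_iff)
    moreover have "p \<in> hom E K Y0 \<and> g \<cdot> p = x \<cdot> q \<and> (\<exists>u \<in> hom E K K.
        p \<cdot> u = p \<cdot> Ident E K \<and> q \<cdot> u = q \<and> e \<cdot> u = e)"
      using p gp by (intro conjI bexI[of _ "Ident E K"]) (simp_all add: hom_iff)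
    ultimately show ?thesis
      using transpose[OF xq pbq idK e fe] by blast
  qed
  have pb0: "is_pullback E x0 f g x"
  proof (rule pullbackI[OF g x(2) x0(1) f x0(2)])
    fix W u v
    assume u: "u \<in> hom E W Y0" and v: "v \<in> hom E W X1" and uv: "g \<cdot> u = x \<cdot> v"
    note [simp] = homD[OF u] homD[OF v]
    obtain z where z: "z \<in> hom E W K" "p \<cdot> z = u" "q \<cdot> z = v"
      using pullback_lift[OF pb, of u v] uv by auto
    then show "\<exists>h \<in> hom E W X0. x0 \<cdot> h = u \<and> f \<cdot> h = v"
      using homD[OF z(1)] comp_eq_assoc[OF x0e, of z] comp_eq_assoc[OF fe, of z]
      by (intro bexI[of _ "e \<cdot> z"]) (simp_all add: hom_iff)
  next
    fix W h h'
    assume h: "h \<in> hom E W X0" "h' \<in> hom E W X0" and eq: "x0 \<cdot> h = x0 \<cdot> h'"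
    note [simp] = homD[OF h(1)] homD[OF h(2)]
    have "p \<cdot> u0 \<cdot> h = p \<cdot> u0 \<cdot> h'"
      using comp_eq_assoc[OF pu0, of h] comp_eq_assoc[OF pu0, of h'] eq by simp
    then have "u0 \<cdot> h = u0 \<cdot> h'"
      using monicD[OF pullback_monic[OF pb x(1)], of "u0 \<cdot> h" "u0 \<cdot> h'"] by simp
    then have "e \<cdot> u0 \<cdot> h = e \<cdot> u0 \<cdot> h'"
      by simp
    then show "h = h'"
      using comp_eq_assoc[OF eu0, of h] comp_eq_assoc[OF eu0, of h'] by simp
  qed
  show thesis
  proof (rule that[OF g x0(1) pb0])
    fix D D' i c y a
    assume as: "y \<in> hom E D Y1" "is_pullback E i c y x" "i \<in> hom E D' D" "a \<in> hom E D' X0" "f \<cdot> a = c"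
    from transpose[OF as] obtain h u where h: "h \<in> hom E D Y0" "g \<cdot> h = y" and u: "u \<in> hom E D' K"
      and eq: "p \<cdot> u = h \<cdot> i" "e \<cdot> u = a"
      by blast
    have "h \<cdot> i = x0 \<cdot> a"
      using comp_eq_assoc[OF x0e, of u] homD[OF u] eq by simp
    with h show "\<exists>h \<in> hom E D Y0. g \<cdot> h = y \<and> h \<cdot> i = x0 \<cdot> a"
      by blast
  next
    fix D i c h h'
    assume h: "h \<in> hom E D Y0" "h' \<in> hom E D Y0" and gh: "g \<cdot> h = g \<cdot> h'"
      and pbi: "is_pullback E i c (g \<cdot> h) x" and hi: "h \<cdot> i = h' \<cdot> i"
    note [simp] = homD[OF h(1)] homD[OF h(2)]
    have gh_hom: "g \<cdot> h \<in> hom E D Y1" by (simp add: hom_iff)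
    obtain D' where i: "i \<in> hom E D' D" and c: "c \<in> hom E D' X1" and ghi: "(g \<cdot> h) \<cdot> i = x \<cdot> c"
      by (rule pullback_homs[OF pbi gh_hom x(2)])
    note [simp] = homD[OF i] homD[OF c]
    obtain u where u: "u \<in> hom E D' K" "p \<cdot> u = h \<cdot> i" "q \<cdot> u = c"
      using pullback_lift[OF pb, of "h \<cdot> i" c] ghi by auto
    note [simp] = homD[OF u(1)]
    have eu: "e \<cdot> u \<in> hom E D' X0" and feu: "f \<cdot> e \<cdot> u = c"
      using comp_eq_assoc[OF fe, of u] u(3) by (simp_all add: hom_iff)
    show "h = h'"
      using transpose[OF gh_hom pbi i eu feu] h gh u hi by metis
  qed
qed

end


section \<open>Unions of adhesive subobjects\<close>

context suitable_E
begin

text \<open>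
  An adhesive arrow is a pullback of its cokernel pair, in which both projections are the arrow
  itself; uniqueness of mediating arrows then says that it can be cancelled.
\<close>

lemma adhesive_monic:
  assumes "adhesive E m" "m \<in> Arr E"
  shows "monic E m"
proof -
  obtain P p q where "is_pushout E m m p q"
    using pushout_exists[OF homI[OF assms(2)] homI[OF assms(2)]] by blast
  then have pb: "is_pullback E m m p q"
    by (rule adhesive_pushout(2)[OF assms(1)])
  show ?thesis
    unfolding monic_def
  proof (intro conjI assms(2) allI ballI impI)
    fix W f g
    assume fg: "f \<in> hom E W (Dom E m)" "g \<in> hom E W (Dom E m)" and "m \<cdot> f = m \<cdot> g"
    then show "f = g"
      using pullback_unique[OF pb, of f g] homD[OF fg(1)] homD[OF fg(2)] by simp
  qed
qed

text \<open>
  Stability says that the two coprojections of a stable pushout cover it: arrows out of any object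
  over the pushout can be compared on the part lying over either coprojection.
\<close>

lemma stable_pushout_cover:
  assumes po: "is_pushout E m f g n" and stable: "stable_pushout E m f g n"
    and k: "k \<in> hom E W (Cod E g)"
    and \<phi>: "\<phi> \<in> hom E W Z" and \<psi>: "\<psi> \<in> hom E W Z"
    and on_g: "\<And>V t y. t \<in> hom E V W \<Longrightarrow> y \<in> hom E V (Dom E g) \<Longrightarrow> k \<cdot> t = g \<cdot> y \<Longrightarrow> \<phi> \<cdot> t = \<psi> \<cdot> t"
    and on_n: "\<And>V t y. t \<in> hom E V W \<Longrightarrow> y \<in> hom E V (Dom E n) \<Longrightarrow> k \<cdot> t = n \<cdot> y \<Longrightarrow> \<phi> \<cdot> t = \<psi> \<cdot> t"
  shows "\<phi> = \<psi>"
proof -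
  obtain M N X D where m: "m \<in> hom E M X" and f: "f \<in> hom E M N"
    and g: "g \<in> hom E X D" and n: "n \<in> hom E N D" and gm: "g \<cdot> m = n \<cdot> f"
    using pushoutD[OF po] by (auto simp: hom_iff)
  note [simp] = homD[OF m] homD[OF f] homD[OF g] homD[OF n]
  have k: "k \<in> hom E W D" using k by simp
  note [simp] = homD[OF k]
  obtain V1 g' b where g': "g' \<in> hom E V1 W" and b: "b \<in> hom E V1 X" and
    kg': "k \<cdot> g' = g \<cdot> b" and pb1: "is_pullback E g' b k g"
    using pullback_exists[OF k g] by blast
  obtain V2 n' c where n': "n' \<in> hom E V2 W" and c: "c \<in> hom E V2 N" and
    kn': "k \<cdot> n' = n \<cdot> c" and pb2: "is_pullback E n' c k n"
    using pullback_exists[OF k n] by blast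
  have gm_hom: "g \<cdot> m \<in> hom E M D"
    by (simp add: hom_iff)
  obtain V3 w a where w: "w \<in> hom E V3 W" and a: "a \<in> hom E V3 M" and
    kw: "k \<cdot> w = (g \<cdot> m) \<cdot> a" and pb3: "is_pullback E w a k (g \<cdot> m)"
    using pullback_exists[OF k gm_hom] by blast
  note [simp] = homD[OF g'] homD[OF b] homD[OF n'] homD[OF c] homD[OF w] homD[OF a]
  have nfa: "g \<cdot> m \<cdot> a = n \<cdot> f \<cdot> a"
    using comp_eq_assoc[OF gm, of a] by simp
  obtain m' where m': "m' \<in> hom E V3 V1" "g' \<cdot> m' = w" "b \<cdot> m' = m \<cdot> a"
    using pullback_lift[OF pb1, of w "m \<cdot> a"] kw by auto
  obtain f' where f': "f' \<in> hom E V3 V2" "n' \<cdot> f' = w" "c \<cdot> f' = f \<cdot> a"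
    using pullback_lift[OF pb2, of w "f \<cdot> a"] kw nfa by auto
  have "is_pushout E m' f' g' n'"
    using pb1 pb2 pb3 m' f'
    by (intro stable[unfolded stable_pushout_def, rule_format, of g' b k n' c m' a f']) simp
  moreover have "\<phi> \<cdot> g' = \<psi> \<cdot> g'"
    using on_g[OF g', of b] b kg' by simp
  moreover have "\<phi> \<cdot> n' = \<psi> \<cdot> n'"
    using on_n[OF n', of c] c kn' by simp
  ultimately show ?thesis
    using pushout_unique[of m' f' g' n' \<phi> \<psi>] homD[OF \<phi>] homD[OF \<psi>] by simp
qed

text \<open>
  The union of two monomorphisms is computed by gluing along their intersection as soon as the
  gluing is stable. To cancel the comparison arrow \<open>s\<close>, cover a test object by its parts over the
  two pieces, once for each of the two arrows compared. Where both land in the same piece, that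
  piece is monic; where they land in different pieces, both come from the intersection.
\<close>

lemma stable_pushout_is_union:
  assumes m1: "monic E m1" and m2: "monic E m2"
    and pb: "is_pullback E r1 r2 m1 m2" and po: "is_pushout E r1 r2 j1 j2"
    and stable: "stable_pushout E r1 r2 j1 j2"
    and s: "s \<in> hom E (Cod E j1) (Cod E m1)" and sj: "s \<cdot> j1 = m1" "s \<cdot> j2 = m2"
  shows "is_union E m1 m2 s"
proof -
  obtain P Q R S D where ty: "m1 \<in> hom E P D" "m2 \<in> hom E Q D" "r1 \<in> hom E R P" "r2 \<in> hom E R Q"
    "j1 \<in> hom E P S" "j2 \<in> hom E Q S" "s \<in> hom E S D"
    using pullbackD[OF pb] pushoutD[OF po] s by (auto simp: hom_iff)
  note [simp] = homD[OF ty(1)] homD[OF ty(2)] homD[OF ty(3)] homD[OF ty(4)] homD[OF ty(5)]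
    homD[OF ty(6)] homD[OF ty(7)]
  note sj' = comp_eq_assoc[OF sj(1)] comp_eq_assoc[OF sj(2)]
  have j_eq: "j1 \<cdot> r1 \<cdot> z = j2 \<cdot> r2 \<cdot> z" if "z \<in> Arr E" "Cod E z = R" for z
    using comp_eq_assoc[OF pushoutD(9)[OF po], of z] that by simp
  have meet: "j1 \<cdot> y = j2 \<cdot> y'"
    if y: "y \<in> hom E V P" and y': "y' \<in> hom E V Q" and eq: "m1 \<cdot> y = m2 \<cdot> y'" for V y y'
  proof -
    obtain z where z: "z \<in> hom E V R" "r1 \<cdot> z = y" "r2 \<cdot> z = y'"
      using pullback_lift[OF pb, of y y'] homD[OF y] homD[OF y'] eq by auto
    then show ?thesis
      using j_eq[of z] homD[OF z(1)] by simp
  qed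
  have cancel1: "y = y'" if "y \<in> hom E V P" "y' \<in> hom E V P" "m1 \<cdot> y = m1 \<cdot> y'" for V y y'
    using monicD[OF m1, of y y'] homD[OF that(1)] homD[OF that(2)] that(3) by simp
  have cancel2: "y = y'" if "y \<in> hom E V Q" "y' \<in> hom E V Q" "m2 \<cdot> y = m2 \<cdot> y'" for V y y'
    using monicD[OF m2, of y y'] homD[OF that(1)] homD[OF that(2)] that(3) by simp
  have same: "j \<cdot> y = j' \<cdot> y'"
    if "j \<in> {j1, j2}" "j' \<in> {j1, j2}" and y: "y \<in> hom E V (Dom E j)" "y' \<in> hom E V (Dom E j')"
      and eq: "s \<cdot> j \<cdot> y = s \<cdot> j' \<cdot> y'" for V j j' y y'
  proof -
    note [simp] = homD(1,2)[OF y(1)] homD(1,2)[OF y(2)]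
    consider "j = j1" "j' = j1" | "j = j1" "j' = j2" | "j = j2" "j' = j1" | "j = j2" "j' = j2"
      using \<open>j \<in> {j1, j2}\<close> \<open>j' \<in> {j1, j2}\<close> by auto
    then show ?thesis
    proof cases
      case 1
      then show ?thesis
        using cancel1[of y V y'] y eq homD(3)[OF y(1)] homD(3)[OF y(2)] by (simp add: sj')
    next
      case 2
      then show ?thesis
        using meet[of y V y'] y eq homD(3)[OF y(1)] homD(3)[OF y(2)] by (simp add: sj')
    next
      case 3
      then show ?thesis
        using meet[of y' V y] y eq homD(3)[OF y(1)] homD(3)[OF y(2)] by (simp add: sj')
    next
      case 4
      then show ?thesis
        using cancel2[of y V y'] y eq homD(3)[OF y(1)] homD(3)[OF y(2)] by (simp add: sj')
    qed
  qed
  have [simp]: "Cod E j = S" "j \<in> Arr E" if "j \<in> {j1, j2}" for j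
    using that by auto
  have s_monic: "monic E s"
    unfolding monic_def
  proof (intro conjI allI ballI impI)
    fix W \<phi> \<psi>
    assume "\<phi> \<in> hom E W (Dom E s)" "\<psi> \<in> hom E W (Dom E s)" and eq: "s \<cdot> \<phi> = s \<cdot> \<psi>"
    then have \<phi>: "\<phi> \<in> hom E W S" and \<psi>: "\<psi> \<in> hom E W S" by simp_all
    note [simp] = homD[OF \<phi>] homD[OF \<psi>]
    have piece: "\<phi> \<cdot> t = \<psi> \<cdot> t"
      if j: "j \<in> {j1, j2}" and t: "t \<in> hom E V W" and y: "y \<in> hom E V (Dom E j)"
        and jy: "\<phi> \<cdot> t = j \<cdot> y" for j V t y
    proof -
      note [simp] = homD[OF t] homD(1-3)[OF y]
      have sub: "(\<phi> \<cdot> t) \<cdot> t' = (\<psi> \<cdot> t) \<cdot> t'"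
        if j': "j' \<in> {j1, j2}" and t': "t' \<in> hom E U V" and y': "y' \<in> hom E U (Dom E j')"
          and jy': "(\<psi> \<cdot> t) \<cdot> t' = j' \<cdot> y'" for j' U t' y'
      proof -
        note [simp] = homD[OF t']
        have *: "(\<phi> \<cdot> t) \<cdot> t' = j \<cdot> y \<cdot> t'"
          using j by (simp only: jy) simp
        have "s \<cdot> \<phi> \<cdot> t \<cdot> t' = s \<cdot> \<psi> \<cdot> t \<cdot> t'"
          using comp_assoc[of "t \<cdot> t'" \<phi> s] comp_assoc[of "t \<cdot> t'" \<psi> s] eq by simp
        then have "s \<cdot> j \<cdot> y \<cdot> t' = s \<cdot> j' \<cdot> y'"
          unfolding *[symmetric] jy'[symmetric] by simp
        then have "j \<cdot> y \<cdot> t' = j' \<cdot> y'"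
          by - (rule same[OF j j' _ y'], simp_all add: hom_iff)
        then show ?thesis
          using * jy' by simp
      qed
      show ?thesis
        by (rule stable_pushout_cover[OF po stable, of "\<psi> \<cdot> t" V _ S])
          (use sub[of j1] sub[of j2] in \<open>simp_all add: hom_iff\<close>)
    qed
    show "\<phi> = \<psi>"
      by (rule stable_pushout_cover[OF po stable, of \<phi> W _ S])
        (use piece[of j1] piece[of j2] in \<open>simp_all add: hom_iff\<close>)
  qed simp
  have "factors_through E s v"
    if v: "monic E v" "Cod E v = D" and h: "factors_through E m1 v" "factors_through E m2 v" for v
  proof -
    obtain h1 h2 where h1: "h1 \<in> hom E P (Dom E v)" "v \<cdot> h1 = m1"
      and h2: "h2 \<in> hom E Q (Dom E v)" "v \<cdot> h2 = m2"
      using h by (auto simp: factors_through_def)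
    have [simp]: "v \<in> Arr E" using v(1) by (simp add: monic_def)
    note [simp] = homD(1-3)[OF h1(1)] homD(1-3)[OF h2(1)] v(2)
    have "v \<cdot> h1 \<cdot> r1 = v \<cdot> h2 \<cdot> r2"
      using comp_eq_assoc[OF h1(2), of r1] comp_eq_assoc[OF h2(2), of r2] pullbackD(9)[OF pb]
      by simp
    then have "h1 \<cdot> r1 = h2 \<cdot> r2"
      using monicD[OF v(1), of "h1 \<cdot> r1" "h2 \<cdot> r2"] by simp
    then obtain h where h: "h \<in> hom E S (Dom E v)" "h \<cdot> j1 = h1" "h \<cdot> j2 = h2"
      using pushout_desc[OF po, of h1 h2] by auto
    note [simp] = homD(1-3)[OF h(1)]
    have "s = v \<cdot> h"
      using pushout_unique[OF po, of s "v \<cdot> h"] h(2,3) h1(2) h2(2) sj by simp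
    then show ?thesis
      using h(1) by (auto simp: factors_through_def)
  qed
  then show ?thesis
    unfolding is_union_def using m1 m2 s_monic ty sj by (auto simp: factors_through_def)
qed

end


section \<open>Functorial cylinders\<close>

locale cylinder_E = category_E E
  for E :: "('o, 'a) cat" +
  fixes I :: "('o, 'a) cylinder"
  assumes cylinder: "suitable_cylinder E I"
begin

(* Keeps the endpoint index 1 in the form in which the rules about endpoints mention it. *)
declare One_nat_def [simp del]

abbreviation cyl_obj ("I\<^sub>o") where "I\<^sub>o \<equiv> on_obj (cyl I)"
abbreviation cyl_arr ("I\<^sub>a") where "I\<^sub>a \<equiv> on_arr (cyl I)"
abbreviation path_obj ("P\<^sub>o") where "P\<^sub>o \<equiv> on_obj (path I)"
abbreviation path_arr ("P\<^sub>a") where "P\<^sub>a \<equiv> on_arr (path I)"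
abbreviation \<delta> where "\<delta> \<equiv> delta I"
abbreviation \<epsilon> where "\<epsilon> \<equiv> contr I"
abbreviation \<gamma> where "\<gamma> \<equiv> conn I"

lemma adjunction: "adjunction E E (cyl I) (path I) (adj_unit I) (adj_counit I)"
  using cylinder by (simp add: suitable_cylinder_def Let_def)

lemma endpoint_set: "k \<in> {0, 1} \<longleftrightarrow> k \<le> (1 :: nat)"
  by auto

lemma
  assumes "f \<in> Arr E"
  shows I_Arr [simp]: "I\<^sub>a f \<in> Arr E"
    and Dom_I [simp]: "Dom E (I\<^sub>a f) = I\<^sub>o (Dom E f)"
    and Cod_I [simp]: "Cod E (I\<^sub>a f) = I\<^sub>o (Cod E f)"
    and P_Arr [simp]: "P\<^sub>a f \<in> Arr E"
    and Dom_P [simp]: "Dom E (P\<^sub>a f) = P\<^sub>o (Dom E f)"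
    and Cod_P [simp]: "Cod E (P\<^sub>a f) = P\<^sub>o (Cod E f)"
  using adjunction homI[OF assms] unfolding adjunction_def is_functor_def
  by (auto simp: hom_iff)

lemma
  assumes "X \<in> Obj E"
  shows I_Obj [simp]: "I\<^sub>o X \<in> Obj E" and P_Obj [simp]: "P\<^sub>o X \<in> Obj E"
  using adjunction assms unfolding adjunction_def is_functor_def by auto

lemma
  assumes "f \<in> Arr E" "g \<in> Arr E" "Cod E f = Dom E g"
  shows I_comp [simp]: "I\<^sub>a (g \<cdot> f) = I\<^sub>a g \<cdot> I\<^sub>a f"
    and P_comp [simp]: "P\<^sub>a (g \<cdot> f) = P\<^sub>a g \<cdot> P\<^sub>a f"
proof -
  have "f \<in> hom E (Dom E f) (Cod E f)" "g \<in> hom E (Cod E f) (Cod E g)"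
    using assms by (simp_all add: hom_iff)
  then show "I\<^sub>a (g \<cdot> f) = I\<^sub>a g \<cdot> I\<^sub>a f" "P\<^sub>a (g \<cdot> f) = P\<^sub>a g \<cdot> P\<^sub>a f"
    using adjunction unfolding adjunction_def is_functor_def by blast+
qed

lemma nat_transD:
  assumes "nat_trans E E F G \<tau>"
  shows "X \<in> Obj E \<Longrightarrow> \<tau> X \<in> hom E (on_obj F X) (on_obj G X)"
    and "f \<in> Arr E \<Longrightarrow> \<tau> (Cod E f) \<cdot> on_arr F f = on_arr G f \<cdot> \<tau> (Dom E f)"
  using assms homI[of f] unfolding nat_trans_def by blast+

lemmas fctr_simps = id_fctr_def comp_fctr_def

lemma nat_\<epsilon>: "nat_trans E E (cyl I) id_fctr \<epsilon>"
  and nat_\<delta>: "k \<le> 1 \<Longrightarrow> nat_trans E E id_fctr (cyl I) (\<delta> k)"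
  and nat_\<gamma>: "k \<le> 1 \<Longrightarrow> nat_trans E E (comp_fctr (cyl I) (cyl I)) (cyl I) (\<gamma> k)"
  using cylinder unfolding endpoint_set[symmetric]
  by (simp_all only: suitable_cylinder_def Let_def)

lemma nat_unit: "nat_trans E E id_fctr (comp_fctr (path I) (cyl I)) (adj_unit I)"
  and nat_counit: "nat_trans E E (comp_fctr (cyl I) (path I)) id_fctr (adj_counit I)"
  using adjunction by (simp_all add: adjunction_def)

lemma
  assumes "X \<in> Obj E"
  shows \<epsilon>_Arr [simp]: "\<epsilon> X \<in> Arr E" and Dom_\<epsilon> [simp]: "Dom E (\<epsilon> X) = I\<^sub>o X"
    and Cod_\<epsilon> [simp]: "Cod E (\<epsilon> X) = X"
    and unit_Arr [simp]: "adj_unit I X \<in> Arr E" and Dom_unit [simp]: "Dom E (adj_unit I X) = X"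
    and Cod_unit [simp]: "Cod E (adj_unit I X) = P\<^sub>o (I\<^sub>o X)"
    and counit_Arr [simp]: "adj_counit I X \<in> Arr E"
    and Dom_counit [simp]: "Dom E (adj_counit I X) = I\<^sub>o (P\<^sub>o X)"
    and Cod_counit [simp]: "Cod E (adj_counit I X) = X"
  using nat_transD(1)[OF nat_\<epsilon> assms] nat_transD(1)[OF nat_unit assms]
    nat_transD(1)[OF nat_counit assms]
  by (simp_all add: hom_iff fctr_simps)

lemma
  assumes "k \<le> 1" "X \<in> Obj E"
  shows \<delta>_Arr [simp]: "\<delta> k X \<in> Arr E" and Dom_\<delta> [simp]: "Dom E (\<delta> k X) = X"
    and Cod_\<delta> [simp]: "Cod E (\<delta> k X) = I\<^sub>o X"
    and \<gamma>_Arr [simp]: "\<gamma> k X \<in> Arr E" and Dom_\<gamma> [simp]: "Dom E (\<gamma> k X) = I\<^sub>o (I\<^sub>o X)"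
    and Cod_\<gamma> [simp]: "Cod E (\<gamma> k X) = I\<^sub>o X"
  using nat_transD(1)[OF nat_\<delta>[OF assms(1)] assms(2)] nat_transD(1)[OF nat_\<gamma>[OF assms(1)] assms(2)]
  by (simp_all add: hom_iff fctr_simps)

lemma \<delta>_natural [simp]:
  assumes "k \<le> 1" "f \<in> Arr E" "Dom E f = X"
  shows "I\<^sub>a f \<cdot> \<delta> k X = \<delta> k (Cod E f) \<cdot> f"
  using nat_transD(2)[OF nat_\<delta>[OF assms(1)] assms(2)] assms(3) by (simp add: fctr_simps)

lemma \<epsilon>_natural [simp]:
  assumes "f \<in> Arr E" "Cod E f = Y"
  shows "\<epsilon> Y \<cdot> I\<^sub>a f = f \<cdot> \<epsilon> (Dom E f)"
  using nat_transD(2)[OF nat_\<epsilon> assms(1)] assms(2) by (simp add: fctr_simps)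

lemma \<gamma>_natural [simp]:
  assumes "k \<le> 1" "f \<in> Arr E" "Cod E f = Y"
  shows "\<gamma> k Y \<cdot> I\<^sub>a (I\<^sub>a f) = I\<^sub>a f \<cdot> \<gamma> k (Dom E f)"
  using nat_transD(2)[OF nat_\<gamma>[OF assms(1)] assms(2)] assms(3) by (simp add: fctr_simps)

lemma unit_natural:
  assumes "f \<in> Arr E"
  shows "adj_unit I (Cod E f) \<cdot> f = P\<^sub>a (I\<^sub>a f) \<cdot> adj_unit I (Dom E f)"
  using nat_transD(2)[OF nat_unit assms] by (simp add: fctr_simps)

lemma counit_natural:
  assumes "f \<in> Arr E"
  shows "adj_counit I (Cod E f) \<cdot> I\<^sub>a (P\<^sub>a f) = f \<cdot> adj_counit I (Dom E f)"
  using nat_transD(2)[OF nat_counit assms] by (simp add: fctr_simps)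

lemma
  assumes "k \<le> 1" "X \<in> Obj E"
  shows \<epsilon>_\<delta> [simp]: "\<epsilon> X \<cdot> \<delta> k X = Ident E X"
    and \<gamma>_\<delta> [simp]: "\<gamma> k X \<cdot> \<delta> k (I\<^sub>o X) = \<delta> k X \<cdot> \<epsilon> X"
    and \<gamma>_I_\<delta> [simp]: "\<gamma> k X \<cdot> I\<^sub>a (\<delta> k X) = \<delta> k X \<cdot> \<epsilon> X"
    and \<gamma>_\<delta>_opposite [simp]: "\<gamma> k X \<cdot> \<delta> (1 - k) (I\<^sub>o X) = Ident E (I\<^sub>o X)"
  using cylinder assms unfolding endpoint_set[symmetric]
  by (simp_all only: suitable_cylinder_def Let_def)

lemma \<delta>_natural_assoc [simp]:
  assumes "k \<le> 1" "f \<in> Arr E" "Dom E f = X" "z \<in> Arr E" "Cod E z = X"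
  shows "I\<^sub>a f \<cdot> \<delta> k X \<cdot> z = \<delta> k (Cod E f) \<cdot> f \<cdot> z"
proof -
  have "X \<in> Obj E" using assms by auto
  then show ?thesis
    using comp_eq_assoc[OF \<delta>_natural[OF assms(1-3)], of z] assms by simp
qed

lemma \<epsilon>_natural_assoc [simp]:
  assumes "f \<in> Arr E" "Cod E f = Y" "z \<in> Arr E" "Cod E z = I\<^sub>o (Dom E f)"
  shows "\<epsilon> Y \<cdot> I\<^sub>a f \<cdot> z = f \<cdot> \<epsilon> (Dom E f) \<cdot> z"
proof -
  have "Y \<in> Obj E" using assms by auto
  then show ?thesis
    using comp_eq_assoc[OF \<epsilon>_natural[OF assms(1,2)], of z] assms by simp
qed

lemma \<epsilon>_\<delta>_assoc [simp]:
  assumes "k \<le> 1" "z \<in> Arr E" "Cod E z = X"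
  shows "\<epsilon> X \<cdot> \<delta> k X \<cdot> z = z"
proof -
  have X: "X \<in> Obj E" using assms by auto
  show ?thesis
    using comp_eq_assoc[OF \<epsilon>_\<delta>[OF assms(1) X], of z] assms X by simp
qed

text \<open>The bijection between arrows \<open>I \<otimes> W \<rightarrow> Y\<close> and arrows \<open>W \<rightarrow> P Y\<close>.\<close>

definition curry_path :: "'o \<Rightarrow> 'a \<Rightarrow> 'a" where
  "curry_path W \<omega> = P\<^sub>a \<omega> \<cdot> adj_unit I W"

definition uncurry_path :: "'o \<Rightarrow> 'a \<Rightarrow> 'a" where
  "uncurry_path Y \<phi> = adj_counit I Y \<cdot> I\<^sub>a \<phi>"

lemma curry_path_hom:
  assumes "\<omega> \<in> hom E (I\<^sub>o W) Y" "W \<in> Obj E"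
  shows "curry_path W \<omega> \<in> hom E W (P\<^sub>o Y)"
  using assms by (simp add: curry_path_def hom_iff)

lemma uncurry_path_hom:
  assumes "\<phi> \<in> hom E W (P\<^sub>o Y)" "Y \<in> Obj E"
  shows "uncurry_path Y \<phi> \<in> hom E (I\<^sub>o W) Y"
  using assms by (simp add: uncurry_path_def hom_iff)

lemma curry_uncurry_path:
  assumes "\<phi> \<in> hom E W (P\<^sub>o Y)" "Y \<in> Obj E"
  shows "curry_path W (uncurry_path Y \<phi>) = \<phi>"
proof -
  note [simp] = homD[OF assms(1)] assms(2)
  have "P\<^sub>a (adj_counit I Y) \<cdot> adj_unit I (P\<^sub>o Y) = Ident E (P\<^sub>o Y)"
    using adjunction by (simp add: adjunction_def)
  from comp_eq_assoc[OF this, of \<phi>]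
  have "P\<^sub>a (adj_counit I Y) \<cdot> P\<^sub>a (I\<^sub>a \<phi>) \<cdot> adj_unit I W = \<phi>"
    using unit_natural[of \<phi>] by simp
  then show ?thesis
    by (simp add: curry_path_def uncurry_path_def)
qed

lemma uncurry_curry_path:
  assumes "\<omega> \<in> hom E (I\<^sub>o W) Y" "W \<in> Obj E"
  shows "uncurry_path Y (curry_path W \<omega>) = \<omega>"
proof -
  note [simp] = homD[OF assms(1)] assms(2)
  have unit: "adj_counit I (I\<^sub>o W) \<cdot> I\<^sub>a (adj_unit I W) = Ident E (I\<^sub>o W)"
    using adjunction by (simp add: adjunction_def)
  have "adj_counit I Y \<cdot> I\<^sub>a (P\<^sub>a \<omega>) = \<omega> \<cdot> adj_counit I (I\<^sub>o W)"
    using counit_natural[of \<omega>] by simp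
  from comp_eq_assoc[OF this, of "I\<^sub>a (adj_unit I W)"]
  show ?thesis
    by (simp add: curry_path_def uncurry_path_def unit)
qed

lemma curry_path_natural:
  assumes "\<omega> \<in> hom E (I\<^sub>o W) Y" "a \<in> hom E V W"
  shows "curry_path V (\<omega> \<cdot> I\<^sub>a a) = curry_path W \<omega> \<cdot> a"
proof -
  note [simp] = homD[OF assms(1)] homD[OF assms(2)]
  show ?thesis
    using unit_natural[of a] by (simp add: curry_path_def)
qed

lemma uncurry_path_natural:
  assumes "\<phi> \<in> hom E W (P\<^sub>o Y)" "a \<in> hom E V W" "Y \<in> Obj E"
  shows "uncurry_path Y (\<phi> \<cdot> a) = uncurry_path Y \<phi> \<cdot> I\<^sub>a a"
proof -
  note [simp] = homD[OF assms(1)] homD[OF assms(2)] assms(3)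
  show ?thesis
    by (simp add: uncurry_path_def)
qed

lemma uncurry_path_post:
  assumes "\<phi> \<in> hom E W (P\<^sub>o X)" "q \<in> hom E X Y"
  shows "uncurry_path Y (P\<^sub>a q \<cdot> \<phi>) = q \<cdot> uncurry_path X \<phi>"
proof -
  note [simp] = homD[OF assms(1)] homD[OF assms(2)]
  have "adj_counit I Y \<cdot> I\<^sub>a (P\<^sub>a q) = q \<cdot> adj_counit I X"
    using counit_natural[of q] by simp
  from comp_eq_assoc[OF this, of "I\<^sub>a \<phi>"] show ?thesis
    by (simp add: uncurry_path_def)
qed

lemma path_d_hom: "k \<le> 1 \<Longrightarrow> X \<in> Obj E \<Longrightarrow> path_d E I k X \<in> hom E (P\<^sub>o X) X"
  by (simp add: path_d_def hom_iff)

lemma path_d_comp: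
  assumes "\<phi> \<in> hom E W (P\<^sub>o X)" "k \<le> 1" "X \<in> Obj E"
  shows "path_d E I k X \<cdot> \<phi> = uncurry_path X \<phi> \<cdot> \<delta> k W"
proof -
  note [simp] = homD[OF assms(1)] assms(2,3)
  show ?thesis
    by (simp add: path_d_def uncurry_path_def)
qed

lemma path_r_hom: "X \<in> Obj E \<Longrightarrow> path_r E I X \<in> hom E X (P\<^sub>o X)"
  by (simp add: path_r_def hom_iff)

lemma uncurry_path_r:
  assumes "\<beta> \<in> hom E W X"
  shows "uncurry_path X (path_r E I X \<cdot> \<beta>) = \<beta> \<cdot> \<epsilon> W"
proof -
  note [simp] = homD[OF assms]
  have "path_r E I X = curry_path X (\<epsilon> X)"
    by (simp add: path_r_def curry_path_def)
  then have "uncurry_path X (path_r E I X) = \<epsilon> X"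
    using uncurry_curry_path[of "\<epsilon> X" X X] by (simp add: hom_iff)
  then show ?thesis
    using uncurry_path_natural[OF path_r_hom assms] by simp
qed

text \<open>
  The cylinder functor is a left adjoint, so it preserves pushouts: transpose the cocone, descend,
  and transpose back.
\<close>

lemma cylinder_pushout:
  assumes po: "is_pushout E f g p q"
  shows "is_pushout E (I\<^sub>a f) (I\<^sub>a g) (I\<^sub>a p) (I\<^sub>a q)"
proof -
  obtain Z X Y S where f: "f \<in> hom E Z X" and g: "g \<in> hom E Z Y" and p: "p \<in> hom E X S"
    and q: "q \<in> hom E Y S" and eq: "p \<cdot> f = q \<cdot> g"
    using pushoutD[OF po] by (auto simp: hom_iff)
  note [simp] = homD[OF f] homD[OF g] homD[OF p] homD[OF q]
  show ?thesis
  proof (rule pushoutI)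
    show "I\<^sub>a f \<in> hom E (I\<^sub>o Z) (I\<^sub>o X)" "I\<^sub>a g \<in> hom E (I\<^sub>o Z) (I\<^sub>o Y)"
      "I\<^sub>a p \<in> hom E (I\<^sub>o X) (I\<^sub>o S)" "I\<^sub>a q \<in> hom E (I\<^sub>o Y) (I\<^sub>o S)"
      by (simp_all add: hom_iff)
    show "I\<^sub>a p \<cdot> I\<^sub>a f = I\<^sub>a q \<cdot> I\<^sub>a g"
      using arg_cong[OF eq, of I\<^sub>a] by simp
  next
    fix W u v
    assume u: "u \<in> hom E (I\<^sub>o X) W" and v: "v \<in> hom E (I\<^sub>o Y) W" and uv: "u \<cdot> I\<^sub>a f = v \<cdot> I\<^sub>a g"
    note [simp] = homD[OF u] homD[OF v]
    have cu: "curry_path X u \<in> hom E X (P\<^sub>o W)" and cv: "curry_path Y v \<in> hom E Y (P\<^sub>o W)"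
      using u v by (simp_all add: curry_path_hom)
    have "curry_path X u \<cdot> f = curry_path Y v \<cdot> g"
      using curry_path_natural[OF u f] curry_path_natural[OF v g] uv by simp
    then obtain h where h: "h \<in> hom E S (P\<^sub>o W)" "h \<cdot> p = curry_path X u" "h \<cdot> q = curry_path Y v"
      using pushout_desc[OF po, of "curry_path X u" "curry_path Y v"] homD[OF cu] homD[OF cv]
      by auto
    have "uncurry_path W h \<cdot> I\<^sub>a p = u" "uncurry_path W h \<cdot> I\<^sub>a q = v"
      using uncurry_path_natural[OF h(1) p] uncurry_path_natural[OF h(1) q]
        uncurry_curry_path[OF u] uncurry_curry_path[OF v] by (simp_all add: h(2,3))
    then show "\<exists>h \<in> hom E (I\<^sub>o S) W. h \<cdot> I\<^sub>a p = u \<and> h \<cdot> I\<^sub>a q = v"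
      using uncurry_path_hom[OF h(1)] by auto
  next
    fix W h h'
    assume h: "h \<in> hom E (I\<^sub>o S) W" and h': "h' \<in> hom E (I\<^sub>o S) W"
      and eqs: "h \<cdot> I\<^sub>a p = h' \<cdot> I\<^sub>a p" "h \<cdot> I\<^sub>a q = h' \<cdot> I\<^sub>a q"
    have c: "curry_path S h \<in> hom E S (P\<^sub>o W)" "curry_path S h' \<in> hom E S (P\<^sub>o W)"
      using h h' by (simp_all add: curry_path_hom)
    have "curry_path S h \<cdot> p = curry_path S h' \<cdot> p" "curry_path S h \<cdot> q = curry_path S h' \<cdot> q"
      using eqs curry_path_natural[OF h p] curry_path_natural[OF h' p] curry_path_natural[OF h q]
        curry_path_natural[OF h' q] by simp_all
    then have "curry_path S h = curry_path S h'"
      using pushout_unique[OF po, of "curry_path S h" "curry_path S h'"] homD[OF c(1)] homD[OF c(2)]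
      by simp
    then have "uncurry_path W (curry_path S h) = uncurry_path W (curry_path S h')"
      by simp
    then show "h = h'"
      by (simp add: uncurry_curry_path[OF h] uncurry_curry_path[OF h'])
  qed
qed

end


section \<open>Fibrations and equivalences by lifting conditions\<close>

locale suitable_model = suitable_E E \<kappa> + cylinder_E E I
  for E :: "('o, 'a) cat" and \<kappa> :: "'u rel" and I :: "('o, 'a) cylinder" +
  fixes Cof TFib :: "'a set"
  assumes wfs: "suitable_wfs \<kappa> E I Cof TFib"
begin

lemma Cof_Arr [simp]: "m \<in> Cof \<Longrightarrow> m \<in> Arr E"
  using wfs unfolding suitable_wfs_def weak_factorization_system_def llp_def by blast

lemma Cof_adhesive: "m \<in> Cof \<Longrightarrow> adhesive E m"
  using wfs unfolding suitable_wfs_def by blast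

lemma TFib_iff: "p \<in> TFib \<longleftrightarrow> p \<in> Arr E \<and> (\<forall>n \<in> Cof. has_lifts E n p)"
  using wfs unfolding suitable_wfs_def weak_factorization_system_def rlp_def by blast

lemma Cof_monic: "m \<in> Cof \<Longrightarrow> monic E m"
  by (intro adhesive_monic Cof_adhesive Cof_Arr)

lemma Cof_pullback: "m \<in> Cof \<Longrightarrow> is_pullback E s m' m t \<Longrightarrow> m' \<in> Cof"
  using wfs unfolding suitable_wfs_def by blast

lemma Cof_I: "m \<in> Cof \<Longrightarrow> I\<^sub>a m \<in> Cof"
  using wfs unfolding suitable_wfs_def by blast

lemma Cof_\<delta>: "k \<le> 1 \<Longrightarrow> X \<in> Obj E \<Longrightarrow> \<delta> k X \<in> Cof"
  using wfs endpoint_set[of k] unfolding suitable_wfs_def by blast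

text \<open>
  The pushout of two cofibrations over their intersection is their union as subobjects, since
  cofibrations are adhesive; so it is again a cofibration into the common codomain.
\<close>

lemma Cof_union:
  assumes "m1 \<in> Cof" "m2 \<in> Cof" "is_pullback E r1 r2 m1 m2" "is_pushout E r1 r2 j1 j2"
    and "s \<in> hom E (Cod E j1) (Cod E m1)" "s \<cdot> j1 = m1" "s \<cdot> j2 = m2"
  shows "s \<in> Cof"
proof -
  have "r1 \<in> Cof"
    using Cof_pullback[OF assms(2) pullback_sym[OF assms(3)]] .
  then have "stable_pushout E r1 r2 j1 j2"
    by (intro adhesive_pushout(1)[OF _ assms(4)] Cof_adhesive)
  then have "is_union E m1 m2 s"
    by (intro stable_pushout_is_union[OF Cof_monic Cof_monic assms(3,4) _ assms(5-7)] assms(1,2))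
  then show ?thesis
    using wfs assms(1,2) unfolding suitable_wfs_def by blast
qed

text \<open>
  The two legs \<open>\<delta>\<^sub>k\<close> and \<open>I \<otimes> n\<close> meet exactly in the domain of \<open>n\<close>, because \<open>\<epsilon>\<close> retracts both
  copies of \<open>\<delta>\<^sub>k\<close>; hence the pushout product is their union.
\<close>

lemma Cof_pushout_product:
  assumes n: "n \<in> Cof" "n \<in> hom E C D" and k: "k \<le> 1" and po: "is_pushout E n (\<delta> k C) i j"
    and u: "u \<in> hom E (Cod E i) (I\<^sub>o D)" "u \<cdot> i = \<delta> k D" "u \<cdot> j = I\<^sub>a n"
  shows "u \<in> Cof"
proof -
  note [simp] = homD[OF n(2)] k
  have "is_pullback E n (\<delta> k C) (\<delta> k D) (I\<^sub>a n)"
  proof (rule pullbackI[OF _ _ n(2)])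
    show "\<delta> k D \<in> hom E D (I\<^sub>o D)" "I\<^sub>a n \<in> hom E (I\<^sub>o C) (I\<^sub>o D)" "\<delta> k C \<in> hom E C (I\<^sub>o C)"
      "\<delta> k D \<cdot> n = I\<^sub>a n \<cdot> \<delta> k C"
      by (simp_all add: hom_iff)
  next
    fix W x y
    assume x: "x \<in> hom E W D" and y: "y \<in> hom E W (I\<^sub>o C)" and eq: "\<delta> k D \<cdot> x = I\<^sub>a n \<cdot> y"
    note [simp] = homD[OF x] homD[OF y]
    have x_eq: "x = n \<cdot> \<epsilon> C \<cdot> y"
      using arg_cong[OF eq, of "\<lambda>z. \<epsilon> D \<cdot> z"] by simp
    have "\<delta> k C \<cdot> \<epsilon> C \<cdot> y = y"
      using monicD[OF Cof_monic[OF Cof_I[OF n(1)]], of "\<delta> k C \<cdot> \<epsilon> C \<cdot> y" y] eq x_eq by simp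
    then show "\<exists>h \<in> hom E W C. n \<cdot> h = x \<and> \<delta> k C \<cdot> h = y"
      using x_eq by (intro bexI[of _ "\<epsilon> C \<cdot> y"]) (simp_all add: hom_iff)
  next
    fix W h h'
    assume h: "h \<in> hom E W C" "h' \<in> hom E W C" and eq: "\<delta> k C \<cdot> h = \<delta> k C \<cdot> h'"
    show "h = h'"
      using arg_cong[OF eq, of "\<lambda>z. \<epsilon> C \<cdot> z"] homD[OF h(1)] homD[OF h(2)] by simp
  qed
  moreover have "u \<in> hom E (Cod E i) (Cod E (\<delta> k D))"
    using u(1) by simp
  ultimately show ?thesis
    using Cof_union[OF Cof_\<delta> Cof_I[OF n(1)] _ po _ u(2,3)] by simp
qed

lemma delta_pushout_products_iff:
  "u \<in> delta_pushout_products E I Cof \<longleftrightarrow> (\<exists>k n i j. k \<le> 1 \<and> n \<in> Cof \<and>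
     is_pushout E n (\<delta> k (Dom E n)) i j \<and> u \<in> hom E (Cod E i) (I\<^sub>o (Cod E n)) \<and>
     u \<cdot> i = \<delta> k (Cod E n) \<and> u \<cdot> j = I\<^sub>a n)"
  unfolding delta_pushout_products_def Bex_def endpoint_set by blast

text \<open>
  The lifting property against all pushout products of \<open>\<delta>\<^sub>k\<close> with cofibrations, with an arrow out of the
  pushout \<open>D +\<^sub>C (I \<otimes> C)\<close> given by its two components: a base \<open>a\<close> and walls \<open>w\<close> of an open box over \<open>v\<close>.
\<close>

definition has_fillers :: "'a \<Rightarrow> bool" where
  "has_fillers q \<longleftrightarrow> (\<forall>k C D n a w v. k \<le> 1 \<and> n \<in> Cof \<and> n \<in> hom E C D \<and>
     a \<in> hom E D (Dom E q) \<and> w \<in> hom E (I\<^sub>o C) (Dom E q) \<and> v \<in> hom E (I\<^sub>o D) (Cod E q) \<and>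
     a \<cdot> n = w \<cdot> \<delta> k C \<and> q \<cdot> a = v \<cdot> \<delta> k D \<and> q \<cdot> w = v \<cdot> I\<^sub>a n \<longrightarrow>
     (\<exists>h \<in> hom E (I\<^sub>o D) (Dom E q). h \<cdot> \<delta> k D = a \<and> h \<cdot> I\<^sub>a n = w \<and> q \<cdot> h = v))"

lemma pushout_product_exists:
  assumes n: "n \<in> hom E C D" and k: "k \<le> 1"
  obtains T i j u where "i \<in> hom E D T" "j \<in> hom E (I\<^sub>o C) T" "i \<cdot> n = j \<cdot> \<delta> k C"
    "is_pushout E n (\<delta> k C) i j" "u \<in> hom E T (I\<^sub>o D)" "u \<cdot> i = \<delta> k D" "u \<cdot> j = I\<^sub>a n"
proof -
  note [simp] = homD[OF n] k
  have "\<delta> k C \<in> hom E C (I\<^sub>o C)" by (simp add: hom_iff)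
  then obtain T i j where ij: "i \<in> hom E D T" "j \<in> hom E (I\<^sub>o C) T" "i \<cdot> n = j \<cdot> \<delta> k C"
    and po: "is_pushout E n (\<delta> k C) i j"
    using pushout_exists[OF n] by blast
  obtain u where "u \<in> hom E T (I\<^sub>o D)" "u \<cdot> i = \<delta> k D" "u \<cdot> j = I\<^sub>a n"
    using pushout_desc[OF po, of "\<delta> k D" "I\<^sub>a n"] homD[OF ij(1)] by auto
  with ij po show thesis by (rule that)
qed

lemma fibration_iff_fillers:
  assumes q: "q \<in> hom E Y B"
  shows "q \<in> fibrations E I Cof \<longleftrightarrow> has_fillers q"
proof
  note [simp] = homD[OF q]
  assume fib: "q \<in> fibrations E I Cof"
  show "has_fillers q"
    unfolding has_fillers_def
  proof (intro allI impI, elim conjE)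
    fix k C D n a w v
    assume k [simp]: "k \<le> 1" and n: "n \<in> Cof" "n \<in> hom E C D"
      and "a \<in> hom E D (Dom E q)" "w \<in> hom E (I\<^sub>o C) (Dom E q)" "v \<in> hom E (I\<^sub>o D) (Cod E q)"
      and eq: "a \<cdot> n = w \<cdot> \<delta> k C" "q \<cdot> a = v \<cdot> \<delta> k D" "q \<cdot> w = v \<cdot> I\<^sub>a n"
    then have a: "a \<in> hom E D Y" and w: "w \<in> hom E (I\<^sub>o C) Y" and v: "v \<in> hom E (I\<^sub>o D) B"
      by simp_all
    note [simp] = homD[OF n(2)] homD[OF a] homD[OF w] homD[OF v]
    obtain T i j u where i: "i \<in> hom E D T" and j: "j \<in> hom E (I\<^sub>o C) T"
      and po: "is_pushout E n (\<delta> k C) i j"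
      and u: "u \<in> hom E T (I\<^sub>o D)" "u \<cdot> i = \<delta> k D" "u \<cdot> j = I\<^sub>a n"
      by (rule pushout_product_exists[OF n(2) k])
    note [simp] = homD[OF i] homD[OF j] homD[OF u(1)]
    obtain x where x: "x \<in> hom E T Y" "x \<cdot> i = a" "x \<cdot> j = w"
      using pushout_desc[OF po, of a w] eq(1) by auto
    note [simp] = homD[OF x(1)]
    have "u \<in> delta_pushout_products E I Cof"
      unfolding delta_pushout_products_iff
      by (rule exI[of _ k], rule exI[of _ n], rule exI[of _ i], rule exI[of _ j])
        (simp add: n(1) po u)
    then have "has_lifts E u q"
      using fib by (simp add: fibrations_def rlp_def)
    moreover have "q \<cdot> x = v \<cdot> u"
      using pushout_unique[OF po, of "q \<cdot> x" "v \<cdot> u"] x(2,3) u(2,3) eq(2,3) by simp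
    ultimately obtain h where h: "h \<in> hom E (I\<^sub>o D) Y" "h \<cdot> u = x" "q \<cdot> h = v"
      using x(1) v unfolding has_lifts_def by auto
    note [simp] = homD[OF h(1)]
    have "h \<cdot> \<delta> k D = a" "h \<cdot> I\<^sub>a n = w"
      using comp_eq_assoc[OF h(2), of i] comp_eq_assoc[OF h(2), of j] x(2,3) u(2,3) by simp_all
    then show "\<exists>h \<in> hom E (I\<^sub>o D) (Dom E q). h \<cdot> \<delta> k D = a \<and> h \<cdot> I\<^sub>a n = w \<and> q \<cdot> h = v"
      using h by auto
  qed
next
  note [simp] = homD[OF q]
  assume fill: "has_fillers q"
  have "has_lifts E u q" if u_in: "u \<in> delta_pushout_products E I Cof" for u
  proof -
    obtain k n i j where k [simp]: "k \<le> 1" and n: "n \<in> Cof"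
      and po: "is_pushout E n (\<delta> k (Dom E n)) i j"
      and u: "u \<in> hom E (Cod E i) (I\<^sub>o (Cod E n))" "u \<cdot> i = \<delta> k (Cod E n)" "u \<cdot> j = I\<^sub>a n"
      using u_in unfolding delta_pushout_products_iff by blast
    obtain C D where n': "n \<in> hom E C D"
      using homI[OF Cof_Arr[OF n]] by blast
    note [simp] = homD[OF n']
    obtain T where i: "i \<in> hom E D T" and j: "j \<in> hom E (I\<^sub>o C) T" and ij: "i \<cdot> n = j \<cdot> \<delta> k C"
      using pushoutD[OF po] by (simp add: hom_iff)
    note [simp] = homD[OF i] homD[OF j] homD[OF u(1)]
    show ?thesis
      unfolding has_lifts_def
    proof (intro ballI impI)
      fix x v
      assume "x \<in> hom E (Dom E u) (Dom E q)" "v \<in> hom E (Cod E u) (Cod E q)"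
        and xv: "q \<cdot> x = v \<cdot> u"
      then have x: "x \<in> hom E T Y" and v: "v \<in> hom E (I\<^sub>o D) B" by simp_all
      note [simp] = homD[OF x] homD[OF v]
      have "(x \<cdot> i) \<cdot> n = (x \<cdot> j) \<cdot> \<delta> k C"
        using ij by simp
      moreover have "q \<cdot> x \<cdot> i = v \<cdot> \<delta> k D" "q \<cdot> x \<cdot> j = v \<cdot> I\<^sub>a n"
        using comp_eq_assoc[OF xv, of i] comp_eq_assoc[OF xv, of j] u(2,3) by simp_all
      moreover have "x \<cdot> i \<in> hom E D (Dom E q)" "x \<cdot> j \<in> hom E (I\<^sub>o C) (Dom E q)"
        "v \<in> hom E (I\<^sub>o D) (Cod E q)"
        by (simp_all add: hom_iff)
      ultimately obtain h where h: "h \<in> hom E (I\<^sub>o D) (Dom E q)" "h \<cdot> \<delta> k D = x \<cdot> i"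
        "h \<cdot> I\<^sub>a n = x \<cdot> j" "q \<cdot> h = v"
        using fill n n' k unfolding has_fillers_def by meson
      note [simp] = homD(1)[OF h(1)] homD(2,3)[OF h(1), simplified]
      have "h \<cdot> u = x"
        using pushout_unique[OF po, of "h \<cdot> u" x] h(2,3) u(2,3) by simp
      then show "\<exists>h \<in> hom E (Cod E u) (Dom E q). h \<cdot> u = x \<and> q \<cdot> h = v"
        using h by auto
    qed
  qed
  then show "q \<in> fibrations E I Cof"
    by (simp add: fibrations_def rlp_def)
qed

text \<open>
  Under the adjunction between \<open>I \<otimes> (-)\<close> and \<open>P\<close>, an arrow from \<open>W\<close> to the mapping path object of \<open>f\<close>
  over the base of \<open>p\<close> is an arrow \<open>u\<close> from \<open>W\<close> to the domain of \<open>f\<close> together with a homotopy that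
  starts at \<open>f \<circ> u\<close> and is constant after composition with \<open>p\<close>. In these terms, the following is the
  lifting property, against all cofibrations, of the arrow that takes a path to its end.
  The common value of the homotopy in the base is expressed through its end \<open>b\<close>.
\<close>

definition extends_homotopies :: "'a \<Rightarrow> 'a \<Rightarrow> bool" where
  "extends_homotopies p f \<longleftrightarrow> (\<forall>C D n u b \<omega>. n \<in> Cof \<and> n \<in> hom E C D \<and>
     u \<in> hom E C (Dom E f) \<and> b \<in> hom E D (Dom E p) \<and> \<omega> \<in> hom E (I\<^sub>o C) (Dom E p) \<and>
     p \<cdot> \<omega> = p \<cdot> b \<cdot> n \<cdot> \<epsilon> C \<and> \<omega> \<cdot> \<delta> 0 C = f \<cdot> u \<and> \<omega> \<cdot> \<delta> 1 C = b \<cdot> n \<longrightarrow>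
     (\<exists>h \<in> hom E D (Dom E f). \<exists>\<Omega> \<in> hom E (I\<^sub>o D) (Dom E p).
        p \<cdot> \<Omega> = p \<cdot> b \<cdot> \<epsilon> D \<and> \<Omega> \<cdot> \<delta> 0 D = f \<cdot> h \<and> \<Omega> \<cdot> \<delta> 1 D = b \<and>
        h \<cdot> n = u \<and> \<Omega> \<cdot> I\<^sub>a n = \<omega>))"

lemma TFib_mapping_path_iff:
  assumes p: "p \<in> hom E X1 A" and f: "f \<in> hom E X0 X1"
    and pb1: "is_pullback E s t (P\<^sub>a p) (path_r E I A)"
    and pb2: "is_pullback E v w f (path_d E I 0 X1 \<cdot> s)"
  shows "(path_d E I 1 X1 \<cdot> s) \<cdot> w \<in> TFib \<longleftrightarrow> extends_homotopies p f"
proof -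
  note [simp] = homD[OF p] homD[OF f]
  note d0 = path_d_hom[of 0 X1, simplified] and d1 = path_d_hom[of 1 X1, simplified]
    and r = path_r_hom[of A, simplified]
  note [simp] = homD[OF d0] homD[OF d1] homD[OF r]
  obtain S where s: "s \<in> hom E S (P\<^sub>o X1)" and t: "t \<in> hom E S A" and
    st: "P\<^sub>a p \<cdot> s = path_r E I A \<cdot> t"
    using pullback_homs[OF pb1 _ r] by (auto simp: hom_iff)
  note [simp] = homD[OF s] homD[OF t]
  have d0s: "path_d E I 0 X1 \<cdot> s \<in> hom E S X1"
    by (simp add: hom_iff)
  obtain M where v: "v \<in> hom E M X0" and w: "w \<in> hom E M S" and
    vw: "f \<cdot> v = (path_d E I 0 X1 \<cdot> s) \<cdot> w"
    using pullback_homs[OF pb2 f d0s] by blast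
  note [simp] = homD[OF v] homD[OF w]
  \<comment> \<open>The homotopy that corresponds to an arrow \<open>\<phi>\<close> into the mapping path object \<open>M\<close>.\<close>
  define pth where "pth \<phi> = uncurry_path X1 (s \<cdot> w \<cdot> \<phi>)" for \<phi>
  have pth_hom: "pth \<phi> \<in> hom E (I\<^sub>o W) X1" if "\<phi> \<in> hom E W M" for W \<phi>
    unfolding pth_def by (intro uncurry_path_hom) (use homD[OF that] in \<open>simp_all add: hom_iff\<close>)
  have swh: "s \<cdot> w \<cdot> \<phi> \<in> hom E W (P\<^sub>o X1)" if "\<phi> \<in> hom E W M" for W \<phi>
    using homD[OF that] by (simp add: hom_iff)
  have pth_0: "pth \<phi> \<cdot> \<delta> 0 W = f \<cdot> v \<cdot> \<phi>" if \<phi>: "\<phi> \<in> hom E W M" for W \<phi>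
    using path_d_comp[OF swh[OF \<phi>], of 0] comp_eq_assoc[OF vw, of \<phi>] homD[OF \<phi>]
    by (simp add: pth_def)
  have pth_1: "pth \<phi> \<cdot> \<delta> 1 W = ((path_d E I 1 X1 \<cdot> s) \<cdot> w) \<cdot> \<phi>" if \<phi>: "\<phi> \<in> hom E W M" for W \<phi>
    using path_d_comp[OF swh[OF \<phi>], of 1] homD[OF \<phi>] by (simp add: pth_def)
  have pth_t: "p \<cdot> pth \<phi> = t \<cdot> w \<cdot> \<phi> \<cdot> \<epsilon> W" if \<phi>: "\<phi> \<in> hom E W M" for W \<phi>
  proof -
    note [simp] = homD[OF \<phi>]
    have "p \<cdot> pth \<phi> = uncurry_path A (P\<^sub>a p \<cdot> s \<cdot> w \<cdot> \<phi>)"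
      unfolding pth_def using uncurry_path_post[OF swh[OF \<phi>] p] by simp
    also have "P\<^sub>a p \<cdot> s \<cdot> w \<cdot> \<phi> = path_r E I A \<cdot> t \<cdot> w \<cdot> \<phi>"
      using comp_eq_assoc[OF st, of "w \<cdot> \<phi>"] by simp
    also have "uncurry_path A (path_r E I A \<cdot> t \<cdot> w \<cdot> \<phi>) = (t \<cdot> w \<cdot> \<phi>) \<cdot> \<epsilon> W"
      by (intro uncurry_path_r) (simp add: hom_iff)
    finally show ?thesis by simp
  qed
  have t_eq: "t \<cdot> w \<cdot> \<phi> = p \<cdot> pth \<phi> \<cdot> \<delta> k W" if \<phi>: "\<phi> \<in> hom E W M" and [simp]: "k \<le> 1" for W \<phi> k
    using comp_eq_assoc[OF pth_t[OF \<phi>, symmetric], of "\<delta> k W"]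
      comp_eq_assoc[OF pth_t[OF \<phi>], of "\<delta> k W"] homD[OF \<phi>] homD[OF pth_hom[OF \<phi>]]
    by simp
  have pth_p: "p \<cdot> pth \<phi> = p \<cdot> pth \<phi> \<cdot> \<delta> 1 W \<cdot> \<epsilon> W" if \<phi>: "\<phi> \<in> hom E W M" for W \<phi>
    using pth_t[OF \<phi>] comp_eq_assoc[OF t_eq[OF \<phi>, of 1], of "\<epsilon> W"] homD[OF \<phi>]
      homD[OF pth_hom[OF \<phi>]] by simp
  have pth_comp: "pth (\<phi> \<cdot> n) = pth \<phi> \<cdot> I\<^sub>a n" if \<phi>: "\<phi> \<in> hom E W M" and n: "n \<in> hom E V W" for V W \<phi> n
    using uncurry_path_natural[OF swh[OF \<phi>] n] homD[OF \<phi>] homD[OF n] by (simp add: pth_def)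
  have make: "\<exists>\<phi> \<in> hom E W M. v \<cdot> \<phi> = a \<and> pth \<phi> = \<omega>"
    if a: "a \<in> hom E W X0" and \<omega>: "\<omega> \<in> hom E (I\<^sub>o W) X1" and \<beta>: "\<beta> \<in> hom E W A"
      and eq0: "\<omega> \<cdot> \<delta> 0 W = f \<cdot> a" and eq: "p \<cdot> \<omega> = \<beta> \<cdot> \<epsilon> W" for W a \<omega> \<beta>
  proof -
    note [simp] = homD[OF a] homD[OF \<omega>] homD[OF \<beta>]
    have c: "curry_path W \<omega> \<in> hom E W (P\<^sub>o X1)"
      by (intro curry_path_hom \<omega>) simp
    note [simp] = homD[OF c]
    have un: "uncurry_path X1 (curry_path W \<omega>) = \<omega>"
      by (intro uncurry_curry_path \<omega>) simp
    have "uncurry_path A (P\<^sub>a p \<cdot> curry_path W \<omega>) = uncurry_path A (path_r E I A \<cdot> \<beta>)"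
      using uncurry_path_post[OF c p] uncurry_path_r[OF \<beta>] eq un by simp
    then have "curry_path W (uncurry_path A (P\<^sub>a p \<cdot> curry_path W \<omega>)) =
        curry_path W (uncurry_path A (path_r E I A \<cdot> \<beta>))"
      by simp
    moreover have "P\<^sub>a p \<cdot> curry_path W \<omega> \<in> hom E W (P\<^sub>o A)" "path_r E I A \<cdot> \<beta> \<in> hom E W (P\<^sub>o A)"
      by (simp_all add: hom_iff)
    ultimately have "P\<^sub>a p \<cdot> curry_path W \<omega> = path_r E I A \<cdot> \<beta>"
      by (simp add: curry_uncurry_path)
    then obtain y where y: "y \<in> hom E W S" "s \<cdot> y = curry_path W \<omega>"
      using pullback_lift[OF pb1, of "curry_path W \<omega>" \<beta>] by auto
    note [simp] = homD[OF y(1)]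
    have "f \<cdot> a = (path_d E I 0 X1 \<cdot> s) \<cdot> y"
      using path_d_comp[OF c, of 0] un eq0 y(2) by simp
    then obtain \<phi> where \<phi>: "\<phi> \<in> hom E W M" "v \<cdot> \<phi> = a" "w \<cdot> \<phi> = y"
      using pullback_lift[OF pb2, of a y] by auto
    then show ?thesis
      using y un by (auto simp: pth_def)
  qed
  have same: "\<phi> = \<phi>'" if \<phi>: "\<phi> \<in> hom E W M" "\<phi>' \<in> hom E W M" and "v \<cdot> \<phi> = v \<cdot> \<phi>'" "pth \<phi> = pth \<phi>'"
    for W \<phi> \<phi>'
  proof -
    note [simp] = homD[OF \<phi>(1)] homD[OF \<phi>(2)]
    have "curry_path W (pth \<phi>) = curry_path W (pth \<phi>')"
      using that(4) by simp
    then have "s \<cdot> w \<cdot> \<phi> = s \<cdot> w \<cdot> \<phi>'"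
      unfolding pth_def by (simp add: curry_uncurry_path[OF swh[OF \<phi>(1)]]
          curry_uncurry_path[OF swh[OF \<phi>(2)]])
    moreover have "t \<cdot> w \<cdot> \<phi> = t \<cdot> w \<cdot> \<phi>'"
      using t_eq[OF \<phi>(1), of 0] t_eq[OF \<phi>(2), of 0] that(4) by simp
    ultimately have "w \<cdot> \<phi> = w \<cdot> \<phi>'"
      using pullback_unique[OF pb1, of "w \<cdot> \<phi>" "w \<cdot> \<phi>'"] by simp
    then show ?thesis
      using pullback_unique[OF pb2, of \<phi> \<phi>'] that(3) by simp
  qed
  define e where "e = (path_d E I 1 X1 \<cdot> s) \<cdot> w"
  have e: "e \<in> hom E M X1"
    by (simp add: e_def hom_iff)
  note [simp] = homD[OF e]
  note pth_1 = pth_1[folded e_def]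
  have "e \<in> TFib \<longleftrightarrow> extends_homotopies p f"
  proof
    assume tf: "e \<in> TFib"
    show "extends_homotopies p f"
      unfolding extends_homotopies_def
    proof (intro allI impI, elim conjE)
      fix C D n u b \<omega>
      assume n: "n \<in> Cof" "n \<in> hom E C D" and "u \<in> hom E C (Dom E f)" "b \<in> hom E D (Dom E p)"
        "\<omega> \<in> hom E (I\<^sub>o C) (Dom E p)"
        and eq: "p \<cdot> \<omega> = p \<cdot> b \<cdot> n \<cdot> \<epsilon> C" "\<omega> \<cdot> \<delta> 0 C = f \<cdot> u" "\<omega> \<cdot> \<delta> 1 C = b \<cdot> n"
      then have u: "u \<in> hom E C X0" and b: "b \<in> hom E D X1" and \<omega>: "\<omega> \<in> hom E (I\<^sub>o C) X1"
        by simp_all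
      note [simp] = homD[OF n(2)] homD[OF u] homD[OF b] homD[OF \<omega>]
      obtain x where x: "x \<in> hom E C M" "v \<cdot> x = u" "pth x = \<omega>"
        using make[OF u \<omega>, of "p \<cdot> b \<cdot> n"] eq by (auto simp: hom_iff)
      have "e \<cdot> x = b \<cdot> n"
        using pth_1[OF x(1)] x(3) eq(3) by simp
      moreover have "has_lifts E n e"
        using tf n(1) by (simp add: TFib_iff)
      ultimately obtain \<phi> where \<phi>: "\<phi> \<in> hom E D M" "\<phi> \<cdot> n = x" "e \<cdot> \<phi> = b"
        using x(1) b unfolding has_lifts_def by auto
      note [simp] = homD[OF \<phi>(1)]
      have "p \<cdot> pth \<phi> = p \<cdot> b \<cdot> \<epsilon> D"
        using pth_p[OF \<phi>(1)] comp_eq_assoc[OF pth_1[OF \<phi>(1)], of "\<epsilon> D"] \<phi>(3)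
          homD[OF pth_hom[OF \<phi>(1)]] by simp
      moreover have "pth \<phi> \<cdot> \<delta> 0 D = f \<cdot> v \<cdot> \<phi>" "pth \<phi> \<cdot> \<delta> 1 D = b"
        using pth_0[OF \<phi>(1)] pth_1[OF \<phi>(1)] \<phi>(3) by simp_all
      moreover have "(v \<cdot> \<phi>) \<cdot> n = u" "pth \<phi> \<cdot> I\<^sub>a n = \<omega>"
        using pth_comp[OF \<phi>(1) n(2)] \<phi>(2) x by simp_all
      moreover have "v \<cdot> \<phi> \<in> hom E D (Dom E f)" "pth \<phi> \<in> hom E (I\<^sub>o D) (Dom E p)"
        using pth_hom[OF \<phi>(1)] by (simp_all add: hom_iff)
      ultimately show "\<exists>h \<in> hom E D (Dom E f). \<exists>\<Omega> \<in> hom E (I\<^sub>o D) (Dom E p).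
        p \<cdot> \<Omega> = p \<cdot> b \<cdot> \<epsilon> D \<and> \<Omega> \<cdot> \<delta> 0 D = f \<cdot> h \<and> \<Omega> \<cdot> \<delta> 1 D = b \<and> h \<cdot> n = u \<and> \<Omega> \<cdot> I\<^sub>a n = \<omega>"
        by blast
    qed
  next
    assume ext: "extends_homotopies p f"
    have "has_lifts E n e" if n: "n \<in> Cof" for n
      unfolding has_lifts_def
    proof (intro ballI impI)
      fix x b
      assume x': "x \<in> hom E (Dom E n) (Dom E e)" and b': "b \<in> hom E (Cod E n) (Cod E e)"
        and xb: "e \<cdot> x = b \<cdot> n"
      obtain C D where n': "n \<in> hom E C D"
        using homI[OF Cof_Arr[OF n]] by blast
      note [simp] = homD[OF n']
      have x: "x \<in> hom E C M" and b: "b \<in> hom E D X1"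
        using x' b' by simp_all
      note [simp] = homD[OF x] homD[OF b] homD[OF pth_hom[OF x]]
      have "p \<cdot> pth x = p \<cdot> b \<cdot> n \<cdot> \<epsilon> C"
        using pth_p[OF x] comp_eq_assoc[OF pth_1[OF x], of "\<epsilon> C"] comp_eq_assoc[OF xb, of "\<epsilon> C"] by simp
      moreover have "pth x \<cdot> \<delta> 0 C = f \<cdot> v \<cdot> x" "pth x \<cdot> \<delta> 1 C = b \<cdot> n"
        using pth_0[OF x] pth_1[OF x] xb by simp_all
      moreover have "v \<cdot> x \<in> hom E C (Dom E f)" "b \<in> hom E D (Dom E p)"
        "pth x \<in> hom E (I\<^sub>o C) (Dom E p)"
        by (simp_all add: hom_iff)
      ultimately obtain h \<Omega> where "h \<in> hom E D (Dom E f)" "\<Omega> \<in> hom E (I\<^sub>o D) (Dom E p)"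
        and eq: "p \<cdot> \<Omega> = p \<cdot> b \<cdot> \<epsilon> D" "\<Omega> \<cdot> \<delta> 0 D = f \<cdot> h" "\<Omega> \<cdot> \<delta> 1 D = b" "h \<cdot> n = v \<cdot> x"
          "\<Omega> \<cdot> I\<^sub>a n = pth x"
        using ext n n' unfolding extends_homotopies_def by meson
      then have h: "h \<in> hom E D X0" and \<Omega>: "\<Omega> \<in> hom E (I\<^sub>o D) X1"
        by simp_all
      note [simp] = homD[OF h] homD[OF \<Omega>]
      obtain \<phi> where \<phi>: "\<phi> \<in> hom E D M" "v \<cdot> \<phi> = h" "pth \<phi> = \<Omega>"
        using make[OF h \<Omega>, of "p \<cdot> b"] eq by (auto simp: hom_iff)
      note [simp] = homD[OF \<phi>(1)]
      have "v \<cdot> \<phi> \<cdot> n = v \<cdot> x"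
        using comp_eq_assoc[OF \<phi>(2), of n] eq(4) by simp
      moreover have "pth (\<phi> \<cdot> n) = pth x"
        using pth_comp[OF \<phi>(1) n'] \<phi>(3) eq(5) by simp
      ultimately have "\<phi> \<cdot> n = x"
        by - (rule same[of _ C]; simp add: hom_iff)
      moreover have "e \<cdot> \<phi> = b"
        using pth_1[OF \<phi>(1)] \<phi>(3) eq(3) by simp
      ultimately show "\<exists>h \<in> hom E (Cod E n) (Dom E e). h \<cdot> n = x \<and> e \<cdot> h = b"
        using \<phi>(1) by auto
    qed
    then show "e \<in> TFib"
      by (simp add: TFib_iff)
  qed
  then show ?thesis
    by (simp add: e_def)
qed

lemma equivalence_over_iff:
  assumes p: "p \<in> hom E X1 A" and f: "f \<in> hom E X0 X1"
  shows "equivalence_over E I TFib (p \<cdot> f) p f \<longleftrightarrow> extends_homotopies p f"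
proof
  note [simp] = homD[OF p] homD[OF f]
  assume "equivalence_over E I TFib (p \<cdot> f) p f"
  then show "extends_homotopies p f"
    using TFib_mapping_path_iff[OF p f] by (auto simp: equivalence_over_def)
next
  note [simp] = homD[OF p] homD[OF f]
  assume ext: "extends_homotopies p f"
  note d0 = path_d_hom[of 0 X1, simplified] and r = path_r_hom[of A, simplified]
  note [simp] = homD[OF d0]
  have "P\<^sub>a p \<in> hom E (P\<^sub>o X1) (P\<^sub>o A)" by (simp add: hom_iff)
  then obtain S s t where s: "s \<in> hom E S (P\<^sub>o X1)" and pb1: "is_pullback E s t (P\<^sub>a p) (path_r E I A)"
    using pullback_exists[OF _ r] by blast
  have "path_d E I 0 X1 \<cdot> s \<in> hom E S X1"
    using homD[OF s] by (simp add: hom_iff)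
  then obtain v w where pb2: "is_pullback E v w f (path_d E I 0 X1 \<cdot> s)"
    using pullback_exists[OF f] by blast
  have "(path_d E I 1 X1 \<cdot> s) \<cdot> w \<in> TFib"
    using TFib_mapping_path_iff[OF p f pb1 pb2] ext by simp
  then show "equivalence_over E I TFib (p \<cdot> f) p f"
    unfolding equivalence_over_def using pb1 pb2 by (auto simp: hom_iff)
qed

end


section \<open>Extending equivalences along cofibrations\<close>

context suitable_model
begin

text \<open>
  The gluing argument that carries the theorem. The subobject \<open>S = C \<union> D\<^sub>A\<close> of \<open>D\<close> supports a homotopy
  \<open>\<sigma>\<close> into \<open>Y1\<close>, given on \<open>C\<close> and obtained from \<open>f\<close> on \<open>D\<^sub>A\<close>; filling it from its end \<open>b\<close> yields a new
  starting point, which is the image of an arrow into \<open>Y0\<close>. That this arrow restricts to \<open>u\<close> is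
  checked with the uniqueness of transposes: the two agree in \<open>Y1\<close> and on \<open>C\<^sub>A\<close>.
\<close>

lemma extends_homotopies_pushforward:
  assumes q: "q \<in> hom E Y1 B" "has_fillers q" and x: "x \<in> Cof" "x \<in> hom E X1 Y1"
    and pbx: "is_pullback E x p q m"
    and f: "f \<in> hom E X0 X1" "extends_homotopies p f"
    and g: "g \<in> hom E Y0 Y1" and x0: "x0 \<in> hom E X0 Y0" and pb0: "is_pullback E x0 f g x"
    and transpose: "\<And>D D' i c y a. y \<in> hom E D Y1 \<Longrightarrow> is_pullback E i c y x \<Longrightarrow> i \<in> hom E D' D \<Longrightarrow>
      a \<in> hom E D' X0 \<Longrightarrow> f \<cdot> a = c \<Longrightarrow> \<exists>h \<in> hom E D Y0. g \<cdot> h = y \<and> h \<cdot> i = x0 \<cdot> a"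
    and unique: "\<And>D i c h h'. h \<in> hom E D Y0 \<Longrightarrow> h' \<in> hom E D Y0 \<Longrightarrow> g \<cdot> h = g \<cdot> h' \<Longrightarrow>
      is_pullback E i c (g \<cdot> h) x \<Longrightarrow> h \<cdot> i = h' \<cdot> i \<Longrightarrow> h = h'"
  shows "extends_homotopies q g"
  unfolding extends_homotopies_def
proof (intro allI impI, elim conjE)
  note [simp] = homD[OF q(1)] homD[OF x(2)] homD[OF f(1)] homD[OF g] homD[OF x0]
  obtain A where p: "p \<in> hom E X1 A" and m: "m \<in> hom E A B" and qx: "q \<cdot> x = m \<cdot> p"
    using pullbackD[OF pbx] by (simp add: hom_iff)
  note [simp] = homD[OF p] homD[OF m]
  note x_monic = Cof_monic[OF x(1)]
  fix C D n u b \<omega>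
  assume n: "n \<in> Cof" "n \<in> hom E C D" and "u \<in> hom E C (Dom E g)" "b \<in> hom E D (Dom E q)"
    "\<omega> \<in> hom E (I\<^sub>o C) (Dom E q)" and q\<omega>: "q \<cdot> \<omega> = q \<cdot> b \<cdot> n \<cdot> \<epsilon> C"
    and \<omega>0: "\<omega> \<cdot> \<delta> 0 C = g \<cdot> u" and \<omega>1: "\<omega> \<cdot> \<delta> 1 C = b \<cdot> n"
  then have u: "u \<in> hom E C Y0" and b: "b \<in> hom E D Y1" and \<omega>: "\<omega> \<in> hom E (I\<^sub>o C) Y1"
    by simp_all
  note [simp] = homD[OF n(2)] homD[OF u] homD[OF b] homD[OF \<omega>]
  \<comment> \<open>The parts of \<open>D\<close>, \<open>C\<close> and the given data that lie over \<open>A\<close>.\<close>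
  obtain DA i bA where i: "i \<in> hom E DA D" and bA: "bA \<in> hom E DA X1" and bi: "b \<cdot> i = x \<cdot> bA"
    and pbD: "is_pullback E i bA b x"
    using pullback_exists[OF b x(2)] by blast
  obtain CA iC nA where iC: "iC \<in> hom E CA C" and nA: "nA \<in> hom E CA DA" and ni: "n \<cdot> iC = i \<cdot> nA"
    and pbC: "is_pullback E iC nA n i"
    using pullback_exists[OF n(2) i] by blast
  note [simp] = homD[OF i] homD[OF bA] homD[OF iC] homD[OF nA]
  have i_Cof: "i \<in> Cof" and nA_Cof: "nA \<in> Cof"
    using Cof_pullback[OF x(1) pullback_sym[OF pbD]] Cof_pullback[OF n(1) pbC] by simp_all
  have bni: "b \<cdot> n \<cdot> iC \<cdot> z = x \<cdot> bA \<cdot> nA \<cdot> z" if "z \<in> Arr E" "Cod E z = CA" for z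
    using comp_eq_assoc[OF ni, of z] comp_eq_assoc[OF bi, of "nA \<cdot> z"] that by simp
  have bni': "b \<cdot> n \<cdot> iC = x \<cdot> bA \<cdot> nA"
    using ni comp_eq_assoc[OF bi, of nA] by simp
  have "q \<cdot> \<omega> \<cdot> I\<^sub>a iC = m \<cdot> p \<cdot> bA \<cdot> nA \<cdot> \<epsilon> CA"
    using comp_eq_assoc[OF q\<omega>, of "I\<^sub>a iC"] bni[of "\<epsilon> CA"]
      comp_eq_assoc[OF qx, of "bA \<cdot> nA \<cdot> \<epsilon> CA"] by simp
  then obtain \<omega>A where \<omega>A: "\<omega>A \<in> hom E (I\<^sub>o CA) X1" and x\<omega>A: "x \<cdot> \<omega>A = \<omega> \<cdot> I\<^sub>a iC"
    and p\<omega>A: "p \<cdot> \<omega>A = p \<cdot> bA \<cdot> nA \<cdot> \<epsilon> CA"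
    using pullback_lift[OF pbx, of "\<omega> \<cdot> I\<^sub>a iC" "p \<cdot> bA \<cdot> nA \<cdot> \<epsilon> CA"] by auto
  note [simp] = homD[OF \<omega>A]
  have "g \<cdot> u \<cdot> iC = x \<cdot> \<omega>A \<cdot> \<delta> 0 CA"
    using comp_eq_assoc[OF \<omega>0, of iC] comp_eq_assoc[OF x\<omega>A, of "\<delta> 0 CA"] by simp
  then obtain uA where uA: "uA \<in> hom E CA X0" and x0uA: "x0 \<cdot> uA = u \<cdot> iC"
    and fuA: "f \<cdot> uA = \<omega>A \<cdot> \<delta> 0 CA"
    using pullback_lift[OF pb0, of "u \<cdot> iC" "\<omega>A \<cdot> \<delta> 0 CA"] by auto
  note [simp] = homD[OF uA]
  have "x \<cdot> \<omega>A \<cdot> \<delta> 1 CA = x \<cdot> bA \<cdot> nA"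
    using comp_eq_assoc[OF x\<omega>A, of "\<delta> 1 CA"] comp_eq_assoc[OF \<omega>1, of iC] bni' by simp
  then have \<omega>A1: "\<omega>A \<cdot> \<delta> 1 CA = bA \<cdot> nA"
    using monicD[OF x_monic, of "\<omega>A \<cdot> \<delta> 1 CA" "bA \<cdot> nA"] by simp
  \<comment> \<open>Over \<open>A\<close>, the equivalence \<open>f\<close> extends the data from \<open>CA\<close> to \<open>DA\<close>.\<close>
  have "uA \<in> hom E CA (Dom E f)" "bA \<in> hom E DA (Dom E p)" "\<omega>A \<in> hom E (I\<^sub>o CA) (Dom E p)"
    by (simp_all add: hom_iff)
  then obtain h' \<Omega>' where "h' \<in> hom E DA (Dom E f)" "\<Omega>' \<in> hom E (I\<^sub>o DA) (Dom E p)"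
    and p\<Omega>': "p \<cdot> \<Omega>' = p \<cdot> bA \<cdot> \<epsilon> DA" and \<Omega>'0: "\<Omega>' \<cdot> \<delta> 0 DA = f \<cdot> h'"
    and \<Omega>'1: "\<Omega>' \<cdot> \<delta> 1 DA = bA" and h'n: "h' \<cdot> nA = uA" and \<Omega>'n: "\<Omega>' \<cdot> I\<^sub>a nA = \<omega>A"
    using f(2) nA_Cof nA p\<omega>A fuA[symmetric] \<omega>A1 unfolding extends_homotopies_def by meson
  then have h': "h' \<in> hom E DA X0" and \<Omega>': "\<Omega>' \<in> hom E (I\<^sub>o DA) X1"
    by simp_all
  note [simp] = homD[OF h'] homD[OF \<Omega>']
  \<comment> \<open>The union \<open>S\<close> of \<open>C\<close> and \<open>DA\<close> in \<open>D\<close>, and the glued homotopy \<open>\<sigma>\<close> on it.\<close>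
  obtain S jC jD where jC: "jC \<in> hom E C S" and jD: "jD \<in> hom E DA S"
    and po: "is_pushout E iC nA jC jD"
    using pushout_exists[OF iC nA] by blast
  note [simp] = homD[OF jC] homD[OF jD]
  obtain s where s: "s \<in> hom E S D" and sC: "s \<cdot> jC = n" and sD: "s \<cdot> jD = i"
    using pushout_desc[OF po, of n i] ni by auto
  note [simp] = homD[OF s]
  have s_Cof: "s \<in> Cof"
    by (rule Cof_union[OF n(1) i_Cof pbC po _ sC sD]) (simp add: hom_iff)
  note Ipo = cylinder_pushout[OF po]
  have IsC: "I\<^sub>a s \<cdot> I\<^sub>a jC = I\<^sub>a n"
    using arg_cong[OF sC, of I\<^sub>a] by simp
  have "\<omega> \<cdot> I\<^sub>a iC = (x \<cdot> \<Omega>') \<cdot> I\<^sub>a nA"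
    using x\<omega>A \<Omega>'n by simp
  then obtain \<sigma> where \<sigma>: "\<sigma> \<in> hom E (I\<^sub>o S) Y1" and \<sigma>C: "\<sigma> \<cdot> I\<^sub>a jC = \<omega>"
    and \<sigma>D: "\<sigma> \<cdot> I\<^sub>a jD = x \<cdot> \<Omega>'"
    using pushout_desc[OF Ipo, of \<omega> "x \<cdot> \<Omega>'"] by auto
  note [simp] = homD[OF \<sigma>]
  have \<sigma>\<delta>: "\<sigma> \<cdot> \<delta> k S \<cdot> jC = \<omega> \<cdot> \<delta> k C" "\<sigma> \<cdot> \<delta> k S \<cdot> jD = x \<cdot> \<Omega>' \<cdot> \<delta> k DA" if "k \<le> 1" for k
    using comp_eq_assoc[OF \<sigma>C, of "\<delta> k C"] comp_eq_assoc[OF \<sigma>D, of "\<delta> k DA"] that by simp_all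
  have fill1: "b \<cdot> s = \<sigma> \<cdot> \<delta> 1 S"
    using pushout_unique[OF po, of "b \<cdot> s" "\<sigma> \<cdot> \<delta> 1 S"] \<sigma>\<delta>[of 1] \<omega>1 \<Omega>'1 bi sC sD by simp
  have fill2: "q \<cdot> \<sigma> = (q \<cdot> b \<cdot> \<epsilon> D) \<cdot> I\<^sub>a s"
  proof -
    have "q \<cdot> \<sigma> \<cdot> I\<^sub>a jC = q \<cdot> b \<cdot> s \<cdot> jC \<cdot> \<epsilon> C"
      using \<sigma>C q\<omega> comp_eq_assoc[OF sC, of "\<epsilon> C"] by simp
    moreover have "q \<cdot> \<sigma> \<cdot> I\<^sub>a jD = q \<cdot> b \<cdot> s \<cdot> jD \<cdot> \<epsilon> DA"
      using \<sigma>D comp_eq_assoc[OF qx, of \<Omega>'] p\<Omega>' comp_eq_assoc[OF qx, of "bA \<cdot> \<epsilon> DA"]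
        comp_eq_assoc[OF bi, of "\<epsilon> DA"] comp_eq_assoc[OF sD, of "\<epsilon> DA"] by simp
    ultimately show ?thesis
      using pushout_unique[OF Ipo, of "q \<cdot> \<sigma>" "q \<cdot> b \<cdot> s \<cdot> \<epsilon> S"] by simp
  qed
  have "b \<in> hom E D (Dom E q)" "\<sigma> \<in> hom E (I\<^sub>o S) (Dom E q)" "q \<cdot> b \<cdot> \<epsilon> D \<in> hom E (I\<^sub>o D) (Cod E q)"
    "q \<cdot> b = (q \<cdot> b \<cdot> \<epsilon> D) \<cdot> \<delta> 1 D" "(1::nat) \<le> 1"
    by (simp_all add: hom_iff)
  then obtain \<Omega> where "\<Omega> \<in> hom E (I\<^sub>o D) (Dom E q)" and \<Omega>1: "\<Omega> \<cdot> \<delta> 1 D = b"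
    and \<Omega>s: "\<Omega> \<cdot> I\<^sub>a s = \<sigma>" and q\<Omega>: "q \<cdot> \<Omega> = q \<cdot> b \<cdot> \<epsilon> D"
    using q(2) s_Cof s fill1 fill2 unfolding has_fillers_def by meson
  then have \<Omega>: "\<Omega> \<in> hom E (I\<^sub>o D) Y1" by simp
  note [simp] = homD[OF \<Omega>]
  \<comment> \<open>The start of the filler factors through \<open>f\<close> over \<open>A\<close>, and so comes from \<open>Y0\<close>.\<close>
  let ?y = "\<Omega> \<cdot> \<delta> 0 D"
  have y: "?y \<in> hom E D Y1" by (simp add: hom_iff)
  have "q \<cdot> ?y = q \<cdot> b"
    using comp_eq_assoc[OF q\<Omega>, of "\<delta> 0 D"] by simp
  moreover have yi: "?y \<cdot> i = x \<cdot> f \<cdot> h'"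
  proof -
    have "?y \<cdot> i = (\<Omega> \<cdot> I\<^sub>a s) \<cdot> \<delta> 0 S \<cdot> jD"
      using sD by simp
    also have "\<dots> = x \<cdot> f \<cdot> h'"
      unfolding \<Omega>s using \<sigma>\<delta>(2)[of 0] \<Omega>'0 by simp
    finally show ?thesis .
  qed
  ultimately have pby: "is_pullback E i (f \<cdot> h') ?y x"
    by (intro pullback_change_fibre[OF x_monic pbx pbD]) (simp_all add: hom_iff)
  obtain h where h: "h \<in> hom E D Y0" and gh: "g \<cdot> h = ?y" and hi: "h \<cdot> i = x0 \<cdot> h'"
    using transpose[OF y pby i h' refl] by blast
  note [simp] = homD[OF h]
  have "?y \<cdot> n = (\<Omega> \<cdot> I\<^sub>a s) \<cdot> \<delta> 0 S \<cdot> jC"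
    using sC by simp
  also have "\<dots> = g \<cdot> u"
    unfolding \<Omega>s using \<sigma>\<delta>(1)[of 0] \<omega>0 by simp
  finally have yn: "?y \<cdot> n = g \<cdot> u" .
  have hn: "h \<cdot> n = u"
  proof (rule unique)
    show "h \<cdot> n \<in> hom E C Y0" "u \<in> hom E C Y0"
      using u by (simp_all add: hom_iff)
    show ghn: "g \<cdot> h \<cdot> n = g \<cdot> u"
      using comp_eq_assoc[OF gh, of n] yn by simp
    show "is_pullback E iC ((f \<cdot> h') \<cdot> nA) (g \<cdot> h \<cdot> n) x"
      using pullback_paste[OF pby pbC] yn ghn by simp
    have "(h \<cdot> n) \<cdot> iC = (h \<cdot> i) \<cdot> nA"
      using ni by simp
    also have "\<dots> = u \<cdot> iC"
      unfolding hi using h'n x0uA by simp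
    finally show "(h \<cdot> n) \<cdot> iC = u \<cdot> iC" .
  qed
  have "\<Omega> \<cdot> I\<^sub>a n = \<omega>"
    using comp_eq_assoc[OF \<Omega>s, of "I\<^sub>a jC"] IsC \<sigma>C by simp
  then show "\<exists>h \<in> hom E D (Dom E g). \<exists>\<Omega> \<in> hom E (I\<^sub>o D) (Dom E q).
      q \<cdot> \<Omega> = q \<cdot> b \<cdot> \<epsilon> D \<and> \<Omega> \<cdot> \<delta> 0 D = g \<cdot> h \<and> \<Omega> \<cdot> \<delta> 1 D = b \<and> h \<cdot> n = u \<and> \<Omega> \<cdot> I\<^sub>a n = \<omega>"
    using h \<Omega> q\<Omega> gh \<Omega>1 hn by (intro bexI[of _ h] bexI[of _ \<Omega>] conjI) simp_all
qed

text \<open>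
  Filling the image of the box in \<open>Y1\<close> gives a face \<open>b\<close> opposite to \<open>a\<close> that need not lie in \<open>Y0\<close>. On \<open>C\<close>
  it does, so the extension property of \<open>g\<close> for the constant homotopy on \<open>C\<close> replaces it by a face in
  \<open>Y0\<close>, in the same fibres and unchanged on \<open>C\<close>.
\<close>

lemma opposite_end_extends:
  assumes q: "q \<in> hom E Y1 B" "has_fillers q" and g: "g \<in> hom E Y0 Y1" "extends_homotopies q g"
    and k: "k \<le> 1" and n: "n \<in> Cof" "n \<in> hom E C D"
    and a: "a \<in> hom E D Y0" and w: "w \<in> hom E (I\<^sub>o C) Y0" and v: "v \<in> hom E (I\<^sub>o D) B"
    and an: "a \<cdot> n = w \<cdot> \<delta> k C" and qa: "q \<cdot> g \<cdot> a = v \<cdot> \<delta> k D" and qw: "q \<cdot> g \<cdot> w = v \<cdot> I\<^sub>a n"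
  obtains h where "h \<in> hom E D Y0" "h \<cdot> n = w \<cdot> \<delta> (1 - k) C" "q \<cdot> g \<cdot> h = v \<cdot> \<delta> (1 - k) D"
proof -
  note [simp] = homD[OF q(1)] homD[OF g(1)] homD[OF n(2)] homD[OF a] homD[OF w] homD[OF v] k
  have "g \<cdot> a \<in> hom E D (Dom E q)" "g \<cdot> w \<in> hom E (I\<^sub>o C) (Dom E q)" "v \<in> hom E (I\<^sub>o D) (Cod E q)"
    "(g \<cdot> a) \<cdot> n = (g \<cdot> w) \<cdot> \<delta> k C"
    using an by (simp_all add: hom_iff)
  then obtain z where "z \<in> hom E (I\<^sub>o D) (Dom E q)" and zn: "z \<cdot> I\<^sub>a n = g \<cdot> w" and qz: "q \<cdot> z = v"
    using q(2) k n qa qw unfolding has_fillers_def by meson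
  then have z: "z \<in> hom E (I\<^sub>o D) Y1" by simp
  note [simp] = homD[OF z]
  have l: "1 - k \<le> 1" by simp
  define b where "b = z \<cdot> \<delta> (1 - k) D"
  define u where "u = w \<cdot> \<delta> (1 - k) C"
  have b: "b \<in> hom E D Y1" and u: "u \<in> hom E C Y0"
    by (simp_all add: b_def u_def hom_iff)
  note [simp] = homD[OF b] homD[OF u]
  have bn: "b \<cdot> n = g \<cdot> u"
    using comp_eq_assoc[OF zn, of "\<delta> (1 - k) C"] by (simp add: b_def u_def)
  have "(g \<cdot> u \<cdot> \<epsilon> C) \<cdot> \<delta> 0 C = g \<cdot> u" "(g \<cdot> u \<cdot> \<epsilon> C) \<cdot> \<delta> 1 C = b \<cdot> n"
    "q \<cdot> g \<cdot> u \<cdot> \<epsilon> C = q \<cdot> b \<cdot> n \<cdot> \<epsilon> C"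
    using bn comp_eq_assoc[OF bn, of "\<epsilon> C"] by simp_all
  moreover have "u \<in> hom E C (Dom E g)" "b \<in> hom E D (Dom E q)"
    "g \<cdot> u \<cdot> \<epsilon> C \<in> hom E (I\<^sub>o C) (Dom E q)"
    by (simp_all add: hom_iff)
  ultimately obtain h \<Omega> where "h \<in> hom E D (Dom E g)" "\<Omega> \<in> hom E (I\<^sub>o D) (Dom E q)"
    and q\<Omega>: "q \<cdot> \<Omega> = q \<cdot> b \<cdot> \<epsilon> D" and \<Omega>0: "\<Omega> \<cdot> \<delta> 0 D = g \<cdot> h" and hn: "h \<cdot> n = u"
    using g(2) n unfolding extends_homotopies_def by meson
  then have h: "h \<in> hom E D Y0" and \<Omega>: "\<Omega> \<in> hom E (I\<^sub>o D) Y1" by simp_all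
  note [simp] = homD[OF h] homD[OF \<Omega>]
  have "q \<cdot> g \<cdot> h = q \<cdot> b"
    using comp_eq_assoc[OF q\<Omega>, of "\<delta> 0 D"] \<Omega>0 by simp
  also have "\<dots> = v \<cdot> \<delta> (1 - k) D"
    using comp_eq_assoc[OF qz, of "\<delta> (1 - k) D"] by (simp add: b_def)
  finally show thesis
    using that[OF h] hn by (simp add: u_def)
qed

text \<open>
  The filler of a box with base \<open>a\<close> and walls \<open>w\<close> is the opposite face of a box on the cylinder of \<open>D\<close>:
  its base is the degenerate \<open>a \<circ> \<epsilon>\<close>, its walls over the pushout product \<open>n'\<close> are \<open>a \<circ> \<epsilon>\<close> and \<open>w \<circ> \<gamma>\<close>.
  The connection \<open>\<gamma>\<close> is constant along the two \<open>k\<close>-sides of the square, which makes the pieces fit,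
  and the identity along the opposite sides, so that the opposite face restricts to \<open>a\<close> and \<open>w\<close>.
\<close>

lemma has_fillers_comp:
  assumes q: "q \<in> hom E Y1 B" "has_fillers q" and g: "g \<in> hom E Y0 Y1" "extends_homotopies q g"
  shows "has_fillers (q \<cdot> g)"
  unfolding has_fillers_def
proof (intro allI impI, elim conjE)
  note [simp] = homD[OF q(1)] homD[OF g(1)]
  fix k C D n a w v
  assume k [simp]: "k \<le> 1" and n: "n \<in> Cof" "n \<in> hom E C D" and "a \<in> hom E D (Dom E (q \<cdot> g))"
    "w \<in> hom E (I\<^sub>o C) (Dom E (q \<cdot> g))" "v \<in> hom E (I\<^sub>o D) (Cod E (q \<cdot> g))"
    and an: "a \<cdot> n = w \<cdot> \<delta> k C" and "(q \<cdot> g) \<cdot> a = v \<cdot> \<delta> k D" "(q \<cdot> g) \<cdot> w = v \<cdot> I\<^sub>a n"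
  then have a: "a \<in> hom E D Y0" and w: "w \<in> hom E (I\<^sub>o C) Y0" and v: "v \<in> hom E (I\<^sub>o D) B"
    by simp_all
  note [simp] = homD[OF n(2)] homD[OF a] homD[OF w] homD[OF v]
  have qa: "q \<cdot> g \<cdot> a = v \<cdot> \<delta> k D" and qw: "q \<cdot> g \<cdot> w = v \<cdot> I\<^sub>a n"
    using \<open>(q \<cdot> g) \<cdot> a = v \<cdot> \<delta> k D\<close> \<open>(q \<cdot> g) \<cdot> w = v \<cdot> I\<^sub>a n\<close> by simp_all
  obtain T i j n' where i: "i \<in> hom E D T" and j: "j \<in> hom E (I\<^sub>o C) T"
    and po: "is_pushout E n (\<delta> k C) i j" and n': "n' \<in> hom E T (I\<^sub>o D)"
    and n'i: "n' \<cdot> i = \<delta> k D" and n'j: "n' \<cdot> j = I\<^sub>a n"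
    by (rule pushout_product_exists[OF n(2) k])
  note [simp] = homD[OF i] homD[OF j] homD[OF n']
  have n'_Cof: "n' \<in> Cof"
    by (rule Cof_pushout_product[OF n k po _ n'i n'j]) (use n' in simp)
  note Ipo = cylinder_pushout[OF po]
  have In'i: "I\<^sub>a n' \<cdot> I\<^sub>a i = I\<^sub>a (\<delta> k D)" and In'j: "I\<^sub>a n' \<cdot> I\<^sub>a j = I\<^sub>a (I\<^sub>a n)"
    using arg_cong[OF n'i, of I\<^sub>a] arg_cong[OF n'j, of I\<^sub>a] by simp_all
  have "(a \<cdot> \<epsilon> D) \<cdot> I\<^sub>a n = (w \<cdot> \<gamma> k C) \<cdot> I\<^sub>a (\<delta> k C)"
    using comp_eq_assoc[OF an, of "\<epsilon> C"] by simp
  then obtain w' where w': "w' \<in> hom E (I\<^sub>o T) Y0" and w'i: "w' \<cdot> I\<^sub>a i = a \<cdot> \<epsilon> D"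
    and w'j: "w' \<cdot> I\<^sub>a j = w \<cdot> \<gamma> k C"
    using pushout_desc[OF Ipo, of "a \<cdot> \<epsilon> D" "w \<cdot> \<gamma> k C"] by auto
  note [simp] = homD[OF w']
  have w'\<delta>: "w' \<cdot> \<delta> l T \<cdot> i = a" "w' \<cdot> \<delta> l T \<cdot> j = w \<cdot> \<gamma> k C \<cdot> \<delta> l (I\<^sub>o C)" if "l \<le> 1" for l
    using comp_eq_assoc[OF w'i, of "\<delta> l D"] comp_eq_assoc[OF w'j, of "\<delta> l (I\<^sub>o C)"] that
    by simp_all
  have vc: "v \<cdot> \<gamma> k D \<in> hom E (I\<^sub>o (I\<^sub>o D)) B" and a\<epsilon>: "a \<cdot> \<epsilon> D \<in> hom E (I\<^sub>o D) Y0"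
    by (simp_all add: hom_iff)
  have "(a \<cdot> \<epsilon> D) \<cdot> n' = w' \<cdot> \<delta> k T"
  proof (rule pushout_unique[OF po])
    show "((a \<cdot> \<epsilon> D) \<cdot> n') \<cdot> i = (w' \<cdot> \<delta> k T) \<cdot> i"
      using w'\<delta>(1)[of k] n'i by simp
    show "((a \<cdot> \<epsilon> D) \<cdot> n') \<cdot> j = (w' \<cdot> \<delta> k T) \<cdot> j"
      using w'\<delta>(2)[of k] n'j comp_eq_assoc[OF an, of "\<epsilon> C"] by simp
  qed simp_all
  moreover have "q \<cdot> g \<cdot> a \<cdot> \<epsilon> D = (v \<cdot> \<gamma> k D) \<cdot> \<delta> k (I\<^sub>o D)"
    using arg_cong[OF qa, of "\<lambda>z. z \<cdot> \<epsilon> D"] by simp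
  moreover have "q \<cdot> g \<cdot> w' = (v \<cdot> \<gamma> k D) \<cdot> I\<^sub>a n'"
  proof (rule pushout_unique[OF Ipo])
    show "(q \<cdot> g \<cdot> w') \<cdot> I\<^sub>a i = ((v \<cdot> \<gamma> k D) \<cdot> I\<^sub>a n') \<cdot> I\<^sub>a i"
      using w'i In'i arg_cong[OF qa, of "\<lambda>z. z \<cdot> \<epsilon> D"] by simp
    show "(q \<cdot> g \<cdot> w') \<cdot> I\<^sub>a j = ((v \<cdot> \<gamma> k D) \<cdot> I\<^sub>a n') \<cdot> I\<^sub>a j"
      using w'j In'j arg_cong[OF qw, of "\<lambda>z. z \<cdot> \<gamma> k C"] by simp
  qed simp_all
  ultimately obtain h where h: "h \<in> hom E (I\<^sub>o D) Y0" and hn': "h \<cdot> n' = w' \<cdot> \<delta> (1 - k) T"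
    and qh: "q \<cdot> g \<cdot> h = (v \<cdot> \<gamma> k D) \<cdot> \<delta> (1 - k) (I\<^sub>o D)"
    by (rule opposite_end_extends[OF q g k n'_Cof n' a\<epsilon> w' vc])
  note [simp] = homD[OF h]
  have "h \<cdot> \<delta> k D = a"
    using comp_eq_assoc[OF hn', of i] w'\<delta>(1)[of "1 - k"] n'i by simp
  moreover have "h \<cdot> I\<^sub>a n = w"
    using comp_eq_assoc[OF hn', of j] w'\<delta>(2)[of "1 - k"] n'j by simp
  moreover have "(q \<cdot> g) \<cdot> h = v"
    using qh by simp
  ultimately show "\<exists>h \<in> hom E (I\<^sub>o D) (Dom E (q \<cdot> g)).
      h \<cdot> \<delta> k D = a \<and> h \<cdot> I\<^sub>a n = w \<and> (q \<cdot> g) \<cdot> h = v"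
    using h by auto
qed

end

theorem proposition5p1:
  fixes \<kappa> :: "'u rel"
    and E :: "('o, 'a) cat"
    and I :: "('o, 'a) cylinder"
    and Cof TFib Fib :: "'a set"
    and A B X\<^sub>0 X\<^sub>1 Y\<^sub>1 :: 'o
    and m p\<^sub>0 p\<^sub>1 q\<^sub>1 x\<^sub>1 f :: 'a
  assumes "inaccessible \<kappa>"
    and "suitable_category \<kappa> E"
    and "suitable_cylinder E I"
    and "suitable_wfs \<kappa> E I Cof TFib"
    and "Fib = fibrations E I Cof"
    and A1: "path_fibrations E I Fib"
    and A2: "local_class \<kappa> E Fib"
    and "m \<in> Cof" "m \<in> hom E A B"
    and "q\<^sub>1 \<in> Fib" "q\<^sub>1 \<in> hom E Y\<^sub>1 B"
    and "x\<^sub>1 \<in> hom E X\<^sub>1 Y\<^sub>1" "p\<^sub>1 \<in> hom E X\<^sub>1 A" "is_pullback E x\<^sub>1 p\<^sub>1 q\<^sub>1 m"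
    and "p\<^sub>0 \<in> Fib" "p\<^sub>0 \<in> hom E X\<^sub>0 A"
    and "f \<in> hom E X\<^sub>0 X\<^sub>1" "p\<^sub>1 \<odot>\<^bsub>E\<^esub> f = p\<^sub>0"
    and "equivalence_over E I TFib p\<^sub>0 p\<^sub>1 f"
  shows "\<exists>Y\<^sub>0 q\<^sub>0 g x\<^sub>0.
           q\<^sub>0 \<in> Fib \<and> q\<^sub>0 \<in> hom E Y\<^sub>0 B \<and>
           g \<in> hom E Y\<^sub>0 Y\<^sub>1 \<and> q\<^sub>1 \<odot>\<^bsub>E\<^esub> g = q\<^sub>0 \<and>
           equivalence_over E I TFib q\<^sub>0 q\<^sub>1 g \<and>
           x\<^sub>0 \<in> hom E X\<^sub>0 Y\<^sub>0 \<and> is_pullback E x\<^sub>0 p\<^sub>0 q\<^sub>0 m \<and>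
           g \<odot>\<^bsub>E\<^esub> x\<^sub>0 = x\<^sub>1 \<odot>\<^bsub>E\<^esub> f"
proof -
  have "category E"
    using assms(2) by (simp add: suitable_category_def locally_presentable_def)
  then interpret suitable_model E \<kappa> I Cof TFib
    using assms(1-4) by unfold_locales
  have x1: "x\<^sub>1 \<in> Cof"
    by (rule Cof_pullback[OF \<open>m \<in> Cof\<close> pullback_sym[OF assms(14)]])
  have q1: "has_fillers q\<^sub>1"
    using assms(5,10) fibration_iff_fillers[OF assms(11)] by simp
  have f: "extends_homotopies p\<^sub>1 f"
    using assms(18,19) equivalence_over_iff[OF assms(13,17)] by simp
  obtain Y0 g x0 where g: "g \<in> hom E Y0 Y\<^sub>1" and x0: "x0 \<in> hom E X\<^sub>0 Y0"
    and pb0: "is_pullback E x0 f g x\<^sub>1"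
    and "extends_homotopies q\<^sub>1 g"
    by (rule pushforward_along_monic[OF Cof_monic[OF x1] assms(12,17)])
      (rule that, assumption+, rule extends_homotopies_pushforward[OF assms(11) q1 x1 assms(12,14,17) f])
  note ext = \<open>extends_homotopies q\<^sub>1 g\<close>
  have qg: "q\<^sub>1 \<cdot> g \<in> hom E Y0 B"
    by (rule comp_hom[OF g assms(11)])
  have "q\<^sub>1 \<cdot> g \<in> Fib"
    using has_fillers_comp[OF assms(11) q1 g ext] fibration_iff_fillers[OF qg] assms(5) by simp
  moreover have "equivalence_over E I TFib (q\<^sub>1 \<cdot> g) q\<^sub>1 g"
    using ext equivalence_over_iff[OF assms(11) g] by simp
  moreover have "is_pullback E x0 p\<^sub>0 (q\<^sub>1 \<cdot> g) m"
    using pullback_paste[OF assms(14) pb0] assms(18) by simp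
  moreover have "g \<cdot> x0 = x\<^sub>1 \<cdot> f"
    using pullbackD(9)[OF pb0] .
  ultimately show ?thesis
    using g qg x0 by blast
qed

end
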